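(* Let $\theta_1,\theta_2\in[0,1]$ with $\theta_1+\theta_2=1$, let $N>0$ and $g_1,g_2\in L^\infty(0,\infty;H)$. Consider the mutual synchronization intertwinement $$\begin{aligned}\partial_tv_1+\nu Av_1+B(v_1,v_1)&=g_1+\theta_1\big(P_NB(v_1,v_1)-P_NB(v_2,v_2)\big),\\ \partial_tv_2+\nu Av_2+B(v_2,v_2)&=g_2+\theta_2\big(P_NB(v_2,v_2)-P_NB(v_1,v_1)\big),\end{aligned}$$ with initial data $(v_1(0),v_2(0))=(v_0^1,v_0^2)\in V\times V$. Let $\lambda:=\theta_1$, $g^\lambda:=\theta_2g_1+\theta_1g_2$ and $\mathfrak g_\lambda:=\sup_{t\ge0}|g^\lambda(t)|/\nu^2$. Suppose $$N\ge\begin{cases}\max\{48\sqrt3\,C_L^2\mathfrak g_\lambda^2,\ C_AC_L^{-2}\}, &\lambda\in\{0,1\},\\ 15\sqrt{27}\,C_L^2\mathfrak g_\lambda^2,&\lambda\in(0,1).\end{cases}$$ Then, for all $v_0^1,v_0^2\in V$, if $|g_1(t)-g_2(t)|\to0$ as $t\to\infty$, the unique global strong solution satisfies $|v_1(t)-v_2(t)|\to0$ as $t\to\infty$.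
   Context: Let $\Omega=[0,2\pi]^2$ with periodic boundary conditions. $H$ is the space of $2\pi$-periodic, divergence-free, mean-free vector fields in $L^2(\Omega)^2$, with inner product $(u,v)=\int_\Omega u\cdot v\,dx$ and norm $|u|=(u,u)^{1/2}$; $V$ is the subspace of $H$ consisting of fields in $H^1$, with norm $\|u\|=|\nabla u|$. $\mathbb P$ is the Leray projection, $A=-\mathbb P\Delta$ is the Stokes operator with domain $D(A)$, and $B(u,v)=\mathbb P((u\cdot\nabla)v)$. For real $N>0$, $P_N$ is the orthogonal projection onto the Fourier modes with wavenumbers $k\in\mathbb Z^2\setminus\{0\}$, $|k|\le N$, and $Q_N=I-P_N$. $\nu>0$ is the viscosity. $C_L,C_A,C_S$ are absolute constants such that $\|u\|_{L^4}^2\le C_L\|u\||u|$, $\|u\|_{L^\infty}^2\le C_A|Au||u|$ and $\|P_Nu\|_{L^\infty}\le C_S(\ln N)^{1/2}\|P_Nu\|$. A (global strong) solution of a system for $(v_1,v_2)$ means $v_j\in C([0,T];V)\cap L^2(0,T;D(A))$ for every $T>0$, satisfying the equations on $(0,T)$ and the initial conditions; the system above is globally well-posed in this sense. *)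

theory Defs
  imports "HOL-Analysis.Analysis"
begin

text \<open>Vector fields on the torus [0,2pi]^2 are represented by functions
  real^2 => real^2, regarded on the fundamental square; Fourier modes are
  indexed by k :: int * int.\<close>

type_synonym field = "real^2 \<Rightarrow> real^2"

definition sq :: "(real^2) set" where
  "sq = cbox 0 (\<chi> _. 2 * pi)"

definition kdot :: "int \<times> int \<Rightarrow> real^2 \<Rightarrow> real" where
  "kdot k x = of_int (fst k) * x $ 1 + of_int (snd k) * x $ 2"

definition ksq :: "int \<times> int \<Rightarrow> real" where
  "ksq k = (of_int (fst k))^2 + (of_int (snd k))^2"

definition kc :: "int \<times> int \<Rightarrow> complex^2" where
  "kc k = (\<chi> i. if i = 1 then of_int (fst k) else of_int (snd k))"

definition fc :: "field \<Rightarrow> int \<times> int \<Rightarrow> complex^2" where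
  "fc u k = (\<chi> i. complex_of_real (1 / (4 * pi^2)) *
      (LINT x:sq|lborel. complex_of_real (u x $ i) * cis (- kdot k x)))"

definition inL2 :: "field \<Rightarrow> bool" where
  "inL2 u \<longleftrightarrow> set_borel_measurable lborel sq u \<and>
     set_integrable lborel sq (\<lambda>x. (norm (u x))^2)"

text \<open>H: square integrable, mean free, divergence free (k . u_k = 0).\<close>
definition inH :: "field \<Rightarrow> bool" where
  "inH u \<longleftrightarrow> inL2 u \<and> fc u (0,0) = 0 \<and>
     (\<forall>k. (\<Sum>j\<in>UNIV. kc k $ j * fc u k $ j) = 0)"

definition inV :: "field \<Rightarrow> bool" where
  "inV u \<longleftrightarrow> inH u \<and> (\<lambda>k. ksq k * (norm (fc u k))^2) summable_on UNIV"

definition inDA :: "field \<Rightarrow> bool" where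
  "inDA u \<longleftrightarrow> inH u \<and> (\<lambda>k. (ksq k)^2 * (norm (fc u k))^2) summable_on UNIV"

text \<open>|u| (L^2 norm), ||u|| = |grad u| and |Au| via Parseval.\<close>
definition Hnorm :: "field \<Rightarrow> real" where
  "Hnorm u = sqrt (LINT x:sq|lborel. (norm (u x))^2)"

definition Vnorm :: "field \<Rightarrow> real" where
  "Vnorm u = sqrt (4 * pi^2 * (\<Sum>\<^sub>\<infinity>k. ksq k * (norm (fc u k))^2))"

definition Anorm :: "field \<Rightarrow> real" where
  "Anorm u = sqrt (4 * pi^2 * (\<Sum>\<^sub>\<infinity>k. (ksq k)^2 * (norm (fc u k))^2))"

definition L4norm :: "field \<Rightarrow> real" where
  "L4norm u = (LINT x:sq|lborel. (norm (u x))^4) powr (1/4)"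

definition CL_const :: "real \<Rightarrow> bool" where
  "CL_const C \<longleftrightarrow> (\<forall>u. inV u \<longrightarrow> (L4norm u)^2 \<le> C * Vnorm u * Hnorm u)"

definition CA_const :: "real \<Rightarrow> bool" where
  "CA_const C \<longleftrightarrow> (\<forall>u. inDA u \<longrightarrow>
      (AE x in lborel. x \<in> sq \<longrightarrow> (norm (u x))^2 \<le> C * Anorm u * Hnorm u))"

text \<open>Fourier coefficients of the Leray projection, of (u.grad)v, of B and of P_N.\<close>
definition lerayc :: "int \<times> int \<Rightarrow> complex^2 \<Rightarrow> complex^2" where
  "lerayc k w = (if k = (0,0) then 0 else
     (\<chi> i. w $ i - kc k $ i * (\<Sum>j\<in>UNIV. kc k $ j * w $ j) / complex_of_real (ksq k)))"

definition convc :: "field \<Rightarrow> field \<Rightarrow> int \<times> int \<Rightarrow> complex^2" where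
  "convc u v k = (\<Sum>\<^sub>\<infinity>l. (\<chi> i. (\<i> * (\<Sum>m\<in>UNIV. fc u (fst k - fst l, snd k - snd l) $ m * kc l $ m))
                         * fc v l $ i))"

definition Bc :: "field \<Rightarrow> field \<Rightarrow> int \<times> int \<Rightarrow> complex^2" where
  "Bc u v k = lerayc k (convc u v k)"

definition PNc :: "real \<Rightarrow> int \<times> int \<Rightarrow> complex^2 \<Rightarrow> complex^2" where
  "PNc N k w = (if 0 < ksq k \<and> ksq k \<le> N^2 then w else 0)"

text \<open>Forcing in L^infty(0,infty;H) (bounded for all t >= 0, weakly measurable).\<close>
definition forcing :: "(real \<Rightarrow> field) \<Rightarrow> bool" where
  "forcing g \<longleftrightarrow> (\<forall>t\<ge>0. inH (g t)) \<and>
     (\<forall>k. (\<lambda>t. fc (g t) k) \<in> borel_measurable (restrict_space lborel {0..})) \<and>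
     (\<exists>M. \<forall>t\<ge>0. Hnorm (g t) \<le> M)"

definition strong_reg :: "(real \<Rightarrow> field) \<Rightarrow> bool" where
  "strong_reg v \<longleftrightarrow> (\<forall>t\<ge>0. inV (v t)) \<and>
     (\<forall>t\<ge>0. ((\<lambda>s. Vnorm (v s - v t)) \<longlongrightarrow> 0) (at t within {0..})) \<and>
     (AE t in lborel. 0 \<le> t \<longrightarrow> inDA (v t)) \<and>
     (\<forall>T>0. set_integrable lborel {0..T} (\<lambda>t. (Anorm (v t))^2))"

text \<open>Mode-wise integral form of  d/dt v + nu A v = F(t), v(0) = v0.\<close>
definition mode_eq :: "real \<Rightarrow> (real \<Rightarrow> int \<times> int \<Rightarrow> complex^2) \<Rightarrow> (real \<Rightarrow> field) \<Rightarrow> field \<Rightarrow> bool" where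
  "mode_eq \<nu> F v v0 \<longleftrightarrow> (\<forall>k. \<forall>t\<ge>0.
     set_integrable lborel {0..t} (\<lambda>s. - complex_of_real (\<nu> * ksq k) *s fc (v s) k + F s k) \<and>
     fc (v t) k = fc v0 k +
       (LINT s:{0..t}|lborel. - complex_of_real (\<nu> * ksq k) *s fc (v s) k + F s k))"

definition mutual_sync_solution ::
  "real \<Rightarrow> real \<Rightarrow> real \<Rightarrow> real \<Rightarrow> (real \<Rightarrow> field) \<Rightarrow> (real \<Rightarrow> field) \<Rightarrow> field \<Rightarrow> field
    \<Rightarrow> (real \<Rightarrow> field) \<Rightarrow> (real \<Rightarrow> field) \<Rightarrow> bool" where
  "mutual_sync_solution \<nu> N \<theta>1 \<theta>2 g1 g2 v01 v02 v1 v2 \<longleftrightarrow>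
     strong_reg v1 \<and> strong_reg v2 \<and>
     mode_eq \<nu> (\<lambda>s k. - Bc (v1 s) (v1 s) k + fc (g1 s) k +
        complex_of_real \<theta>1 *s PNc N k (Bc (v1 s) (v1 s) k - Bc (v2 s) (v2 s) k)) v1 v01 \<and>
     mode_eq \<nu> (\<lambda>s k. - Bc (v2 s) (v2 s) k + fc (g2 s) k +
        complex_of_real \<theta>2 *s PNc N k (Bc (v2 s) (v2 s) k - Bc (v1 s) (v1 s) k)) v2 v02"

definition glam :: "real \<Rightarrow> real \<Rightarrow> real \<Rightarrow> (real \<Rightarrow> field) \<Rightarrow> (real \<Rightarrow> field) \<Rightarrow> real" where
  "glam \<nu> \<theta>1 \<theta>2 g1 g2 =
     (SUP t\<in>{0..}. Hnorm (\<lambda>x. \<theta>2 *\<^sub>R g1 t x + \<theta>1 *\<^sub>R g2 t x)) / \<nu>^2"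

end

theory Submission
  imports Defs
begin

text \<open>
  Put \<open>w = v1 - v2\<close> and \<open>V = \<theta>2 v1 + \<theta>1 v2\<close>, and split \<open>w = P + Q\<close> into low and high modes. The
  coupling removes the nonlinearity from the low modes, so \<open>P\<close> solves a forced heat equation and
  decays to zero. The remaining pair satisfies, up to terms that contain \<open>P\<close>,
  \<open>\<partial>\<^sub>t V + \<nu> A V + B(V,V) + \<theta>1 \<theta>2 B(Q,Q) = g\<^sup>\<lambda>\<close> and
  \<open>\<partial>\<^sub>t Q + \<nu> A Q + Q\<^sub>N (B(V,Q) + B(Q,V) + (\<theta>1 - \<theta>2) B(Q,Q)) = 0\<close>. In the balance of
  \<open>|V|\<^sup>2 + \<theta>1 \<theta>2 |Q|\<^sup>2\<close> the two cubic terms \<open>(B(Q,Q),V)\<close> and \<open>(B(Q,V),Q)\<close> cancel, so the long-time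
  average of \<open>\<parallel>V\<parallel>\<^sup>2\<close> is at most \<open>\<nu>\<^sup>2 \<gg>\<^sub>\<lambda>\<^sup>2\<close>, for all values of \<open>\<lambda>\<close> at once. In the balance of \<open>|Q|\<^sup>2\<close>
  alone, the Ladyzhenskaya inequality and \<open>\<parallel>Q\<parallel>\<^sup>2 \<ge> max(1, N\<^sup>2) |Q|\<^sup>2\<close> leave the growth rate
  \<open>-\<nu> max(1, N\<^sup>2) + C\<^sub>L\<^sup>2 \<parallel>V\<parallel>\<^sup>2 / \<nu>\<close>, whose average is negative as soon as
  \<open>C\<^sub>L\<^sup>2 \<gg>\<^sub>\<lambda>\<^sup>2 < max(1, N\<^sup>2)\<close>.

  All estimates are made on Fourier coefficients at almost every time, where both solutions lie in
  \<open>D(A)\<close> and hence have absolutely convergent Fourier series.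
\<close>

section \<open>Fourier coefficients on the torus\<close>

text \<open>Once a solution is coupled, its own equation loses the cancellation (B(v,v),v) = 0, and
  \<open>strong_reg\<close> bounds it only on compact time intervals. The weights in V are exchanged
  because then the coupling terms drop out of its equation; the weight
  \<open>\<theta>1 * \<theta>2\<close> of the Q energy is the factor with which the self-interaction
  of w enters that equation. If one weight is 0, V is the uncoupled solution. Terms with P are small
  because P has finitely many modes, so all its norms are at most a constant depending on N times
  |P|. They cost at most a vanishing factor times one plus the energy, which the dissipation absorbs
  before any bound on the energy is known.

  A solution is given mode by mode in integrated form, so nothing can be differentiated directly in
  H. Each balance is established on finite boxes of modes and carried to the limit by dominated
  convergence; the dominating function comes from |Av|^2, since summability of |k|^-4 over the
  lattice bounds the absolute sum of the coefficients by |Av|.\<close>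

abbreviation torus :: "(real^2) measure" where "torus \<equiv> restrict_space lborel sq"

lemma sq_sets [measurable]: "sq \<in> sets lborel" "sq \<in> sets borel"
  by (simp_all add: sq_def)

lemma space_torus [simp]: "space torus = sq"
  by (simp add: space_restrict_space)

lemma set_integral_torus:
  fixes f :: "real^2 \<Rightarrow> 'a::{banach,second_countable_topology}"
  shows "(LINT x:sq|lborel. f x) = integral\<^sup>L torus f"
  by (simp add: set_lebesgue_integral_def integral_restrict_space)

lemma set_integrable_torus:
  fixes f :: "real^2 \<Rightarrow> 'a::{banach,second_countable_topology}"
  shows "set_integrable lborel sq f \<longleftrightarrow> integrable torus f"
  by (simp add: set_integrable_def integrable_restrict_space)

lemma set_borel_measurable_torus:
  fixes f :: "real^2 \<Rightarrow> 'a::real_normed_vector"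
  shows "set_borel_measurable lborel sq f \<longleftrightarrow> f \<in> borel_measurable torus"
  by (simp add: set_borel_measurable_def borel_measurable_restrict_space_iff)

lemma finite_measure_torus: "finite_measure torus"
  by (rule finite_measureI) (simp add: emeasure_restrict_space sq_def emeasure_lborel_cbox_eq)

lemma mem_sq: "x \<in> sq \<longleftrightarrow> (\<forall>i. 0 \<le> x $ i \<and> x $ i \<le> 2 * pi)"
  by (simp add: sq_def mem_box_cart)

lemma continuous_on_kdot [continuous_intros]: "continuous_on A (kdot k)"
  unfolding kdot_def[abs_def] by (intro continuous_intros)

lemma kdot_add: "kdot (k + l) x = kdot k x + kdot l x"
  by (simp add: kdot_def algebra_simps)

lemma kdot_diff: "kdot (k - l) x = kdot k x - kdot l x"
  by (simp add: kdot_def algebra_simps)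

lemma kdot_minus: "kdot (- k) x = - kdot k x"
  by (simp add: kdot_def algebra_simps)

lemma kdot_0 [simp]: "kdot 0 x = 0" "kdot (0,0) x = 0"
  by (simp_all add: kdot_def)

lemma measurable_cis_kdot [measurable]: "(\<lambda>x. cis (kdot k x)) \<in> borel_measurable borel"
  by (intro borel_measurable_continuous_onI continuous_intros)

lemma measurable_torusI: "f \<in> borel_measurable borel \<Longrightarrow> f \<in> borel_measurable torus"
  by (rule measurable_restrict_space1) simp

lemma integral_cis_1:
  "(\<integral>r. indicator {0..2*pi} r *\<^sub>R cis (of_int n * r) \<partial>lborel) = (if n = 0 then complex_of_real (2*pi) else 0)"
proof (cases "n = 0")
  case True
  then show ?thesis by (simp add: scaleR_conv_of_real)
next
  case False
  have "(\<integral>r. indicator {0..2*pi} r *\<^sub>R cis (of_int n * r) \<partial>lborel)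
      = cis (of_int n * (2*pi)) / (\<i> * of_int n) - cis (of_int n * 0) / (\<i> * of_int n)"
  proof (rule integral_FTC_Icc)
    fix r :: real
    have "((\<lambda>z. exp (\<i> * of_int n * z) / (\<i> * of_int n)) has_field_derivative
        exp (\<i> * of_int n * of_real r)) (at (of_real r))"
      using False by (auto intro!: derivative_eq_intros simp: field_simps)
    then have "((\<lambda>r. exp (\<i> * of_int n * of_real r) / (\<i> * of_int n)) has_vector_derivative
        exp (\<i> * of_int n * of_real r)) (at r within {0..2*pi})"
      by (rule has_vector_derivative_real_field)
    then show "((\<lambda>r. cis (of_int n * r) / (\<i> * of_int n)) has_vector_derivative
        cis (of_int n * r)) (at r within {0..2*pi})"
      by (simp add: cis_conv_exp mult.assoc)
  qed (auto intro!: continuous_intros)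
  also have "cis (of_int n * (2*pi)) = 1"
    using cis_multiple_2pi[of "of_int n"] by (simp add: mult_ac)
  finally show ?thesis using False by simp
qed

text \<open>Orthogonality of the characters. Lebesgue measure on \<open>real^2\<close> is an image
  of the product measure over \<open>Basis\<close>, so the integral factors into two one-dimensional
  ones.\<close>

lemma integral_cis_kdot:
  "(\<integral>x. cis (kdot k x) \<partial>torus) = (if k = 0 then complex_of_real (4 * pi^2) else 0)"
proof -
  define n :: "real^2 \<Rightarrow> int" where "n b = (if b = axis 1 1 then fst k else snd k)" for b
  have ax: "(axis 2 1 :: real^2) \<noteq> axis 1 1" by (simp add: axis_eq_axis)
  have Bas: "(Basis :: (real^2) set) = {axis 1 1, axis 2 1}"
    unfolding Basis_vec_def Basis_real_def UNIV_2 by blast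
  define F :: "real^2 \<Rightarrow> real \<Rightarrow> complex" where "F b r = indicator {0..2*pi} r *\<^sub>R cis (of_int (n b) * r)" for b r
  have F: "integral\<^sup>L lborel (F b) = (if n b = 0 then complex_of_real (2*pi) else 0)" for b
    unfolding F_def by (rule integral_cis_1)
  have Fi: "integrable lborel (F b)" for b
  proof -
    have "set_integrable lborel {0..2*pi} (\<lambda>r. cis (of_int (n b) * r))"
      by (intro borel_integrable_atLeastAtMost' continuous_intros)
    then show ?thesis unfolding set_integrable_def F_def[abs_def] .
  qed
  have Fm[measurable]: "F b \<in> borel_measurable borel" for b using Fi[of b] by auto
  have "(\<integral>x. cis (kdot k x) \<partial>torus) = (\<integral>x. indicator sq x *\<^sub>R cis (kdot k x) \<partial>lborel)"
    by (simp add: integral_restrict_space)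
  also have "\<dots> = (\<integral>x. (\<Prod>b\<in>Basis. F b (x \<bullet> b)) \<partial>lborel)"
  proof (rule Bochner_Integration.integral_cong[OF refl])
    fix x :: "real^2"
    show "indicator sq x *\<^sub>R cis (kdot k x) = (\<Prod>b\<in>Basis. F b (x \<bullet> b))"
      using ax by (auto simp: Bas F_def n_def inner_axis mem_sq indicator_def forall_2 kdot_def cis_mult)
  qed
  also have "\<dots> = (\<integral>f. (\<Prod>b\<in>Basis. F b ((\<Sum>c\<in>Basis. f c *\<^sub>R c) \<bullet> b)) \<partial>(\<Pi>\<^sub>M b\<in>(Basis::(real^2) set). lborel))"
    by (subst lborel_eq, subst integral_distr) simp_all
  also have "\<dots> = (\<integral>f. (\<Prod>b\<in>Basis. F b (f b)) \<partial>(\<Pi>\<^sub>M b\<in>(Basis::(real^2) set). lborel))"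
    by (intro Bochner_Integration.integral_cong refl prod.cong) simp
  also have "\<dots> = (\<Prod>b\<in>Basis. integral\<^sup>L lborel (F b))"
  proof -
    interpret product_sigma_finite "\<lambda>_::real^2. lborel::real measure" ..
    show ?thesis by (rule product_integral_prod) (use Fi in auto)
  qed
  also have "\<dots> = (if k = 0 then complex_of_real (4 * pi^2) else 0)"
    using ax by (auto simp: Bas F n_def power2_eq_square prod_eq_iff)
  finally show ?thesis .
qed

section \<open>Scalar Fourier coefficients and Bessel's inequality\<close>

definition fcs :: "(real^2 \<Rightarrow> complex) \<Rightarrow> int \<times> int \<Rightarrow> complex" where
  "fcs f k = (1 / (4 * pi^2)) * (\<integral>x. f x * cis (- kdot k x) \<partial>torus)"

definition sqint :: "(real^2 \<Rightarrow> complex) \<Rightarrow> bool" where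
  "sqint f \<longleftrightarrow> f \<in> borel_measurable torus \<and> integrable torus (\<lambda>x. (cmod (f x))^2)"

lemma norm_add_sq_le: 
  fixes a b :: "'a::real_normed_vector"
  shows "(norm (a + b))^2 \<le> 2 * (norm a)^2 + 2 * (norm b)^2"
proof -
  have "(norm (a + b))^2 \<le> (norm a + norm b)^2" by (intro power_mono norm_triangle_ineq) auto
  also have "\<dots> \<le> 2 * (norm a)^2 + 2 * (norm b)^2" using sum_squares_bound[of "norm a" "norm b"] by (simp add: power2_sum)
  finally show ?thesis .
qed

lemma sqint_integrable:
  assumes "sqint f" shows "integrable torus f"
proof -
  interpret finite_measure torus by (rule finite_measure_torus)
  have "integrable torus (\<lambda>x. 1 + (cmod (f x))^2)"
    using assms unfolding sqint_def by simp
  then show ?thesis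
  proof (rule Bochner_Integration.integrable_bound)
    show "f \<in> borel_measurable torus" using assms by (simp add: sqint_def)
    show "AE x in torus. norm (f x) \<le> norm (1 + (cmod (f x))^2)"
    proof (intro AE_I2)
      fix x
      have "0 \<le> (cmod (f x) - 1)^2" by simp
      then have "2 * cmod (f x) \<le> 1 + (cmod (f x))^2" by (simp add: power2_diff)
      then show "norm (f x) \<le> norm (1 + (cmod (f x))^2)" using norm_ge_zero[of "f x"] by (simp del: norm_ge_zero)
    qed
  qed
qed

lemma sqint_add:
  assumes "sqint f" "sqint g" shows "sqint (\<lambda>x. f x + g x)"
  unfolding sqint_def
proof
  show m: "(\<lambda>x. f x + g x) \<in> borel_measurable torus"
    using assms unfolding sqint_def by (intro borel_measurable_add) auto
  have "integrable torus (\<lambda>x. 2 * (cmod (f x))^2 + 2 * (cmod (g x))^2)"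
    using assms by (simp add: sqint_def)
  then show "integrable torus (\<lambda>x. (cmod (f x + g x))^2)"
    by (rule Bochner_Integration.integrable_bound)
       (use m norm_add_sq_le[of "f _" "g _"] in auto)
qed

lemma sqint_bounded:
  assumes "f \<in> borel_measurable torus" "\<And>x. cmod (f x) \<le> B"
  shows "sqint f"
  unfolding sqint_def
proof
  interpret finite_measure torus by (rule finite_measure_torus)
  have "0 \<le> B" using assms(2)[of 0] norm_ge_zero order_trans by blast
  then show "integrable torus (\<lambda>x. (cmod (f x))^2)"
    by (intro integrable_const_bound[of _ "B^2"]) (use assms in \<open>auto intro: power_mono\<close>)
qed (rule assms(1))

lemma sqint_cmult:
  assumes "sqint f" shows "sqint (\<lambda>x. c * f x)"
  using assms by (auto simp: sqint_def norm_mult power_mult_distrib)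

lemma sqint_mult_cis:
  assumes "sqint f" shows "sqint (\<lambda>x. f x * cis (kdot k x))"
  using assms measurable_torusI[OF measurable_cis_kdot[of k]] by (auto simp: sqint_def norm_mult)

lemma sqint_cis: "sqint (\<lambda>x. cis (kdot k x))"
  by (rule sqint_bounded[of _ 1]) (auto intro: measurable_torusI)

lemma sqint_sum:
  assumes "finite S" "\<And>k. k \<in> S \<Longrightarrow> sqint (f k)" shows "sqint (\<lambda>x. \<Sum>k\<in>S. f k x)"
  using assms
proof (induction S)
  case empty
  show ?case by (rule sqint_bounded[of _ 0]) auto
next
  case (insert k S)
  then show ?case using sqint_add[of "f k" "\<lambda>x. \<Sum>k\<in>S. f k x"] by simp
qed

definition trigpoly :: "(int \<times> int) set \<Rightarrow> (int \<times> int \<Rightarrow> complex) \<Rightarrow> real^2 \<Rightarrow> complex" where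
  "trigpoly S a x = (\<Sum>k\<in>S. a k * cis (kdot k x))"

lemma sqint_trigpoly: "finite S \<Longrightarrow> sqint (trigpoly S a)"
  unfolding trigpoly_def[abs_def] by (intro sqint_sum sqint_cmult sqint_cis)

lemma integral_mult_cis:
  "(\<integral>x. f x * cis (- kdot k x) \<partial>torus) = (4 * pi^2) * fcs f k"
  by (simp add: fcs_def)

lemma fcs_add:
  assumes "sqint f" "sqint g"
  shows "fcs (\<lambda>x. f x + g x) k = fcs f k + fcs g k"
proof -
  note i = sqint_integrable[OF sqint_mult_cis[OF assms(1), of "-k"]] sqint_integrable[OF sqint_mult_cis[OF assms(2), of "-k"]]
  show ?thesis
    using Bochner_Integration.integral_add[OF i] by (simp add: fcs_def distrib_right kdot_minus add_divide_distrib)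
qed

lemma fcs_cmult: "fcs (\<lambda>x. c * f x) k = c * fcs f k"
  by (simp add: fcs_def mult.assoc)

lemma fcs_sum:
  assumes "finite S" "\<And>k. k \<in> S \<Longrightarrow> sqint (f k)" shows "fcs (\<lambda>x. \<Sum>k\<in>S. f k x) l = (\<Sum>k\<in>S. fcs (f k) l)"
  using assms
proof (induction S)
  case empty
  show ?case by (simp add: fcs_def)
next
  case (insert k S)
  then show ?case using fcs_add[of "f k" "\<lambda>x. \<Sum>k\<in>S. f k x"] sqint_sum[of S f] by simp
qed

lemma fcs_cis: "fcs (\<lambda>x. cis (kdot k x)) l = (if k = l then 1 else 0)"
proof -
  have "(\<lambda>x. cis (kdot k x) * cis (- kdot l x)) = (\<lambda>x. cis (kdot (k - l) x))"
    by (simp add: cis_mult kdot_diff)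
  then show ?thesis unfolding fcs_def by (simp add: integral_cis_kdot)
qed

lemma fcs_trigpoly:
  assumes "finite S" shows "fcs (trigpoly S a) l = (if l \<in> S then a l else 0)"
proof -
  have "fcs (trigpoly S a) l = (\<Sum>k\<in>S. a k * fcs (\<lambda>x. cis (kdot k x)) l)"
    unfolding trigpoly_def[abs_def] by (subst fcs_sum) (auto simp: assms fcs_cmult intro: sqint_cmult sqint_cis)
  then show ?thesis using assms by (simp add: fcs_cis if_distrib cong: if_cong)
qed

lemma cmod_diff_sq: "(cmod (z - w))^2 = (cmod z)^2 - 2 * Re (z * cnj w) + (cmod w)^2"
  by (simp add: cmod_power2 power2_diff algebra_simps)

lemma integral_trigpoly_cnj:
  assumes S: "finite S" and f: "sqint f"
  shows "integrable torus (\<lambda>x. f x * cnj (trigpoly S a x))"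
    "(\<integral>x. f x * cnj (trigpoly S a x) \<partial>torus) = 4 * pi^2 * (\<Sum>k\<in>S. fcs f k * cnj (a k))"
proof -
  have e: "(\<lambda>x. f x * cnj (trigpoly S a x)) = (\<lambda>x. \<Sum>k\<in>S. cnj (a k) * (f x * cis (- kdot k x)))"
    by (auto simp: trigpoly_def sum_distrib_left cis_cnj mult_ac)
  have i: "integrable torus (\<lambda>x. cnj (a k) * (f x * cis (- kdot k x)))" for k
    using sqint_integrable[OF sqint_mult_cis[OF f, of "-k"]] by (simp add: kdot_minus)
  show "integrable torus (\<lambda>x. f x * cnj (trigpoly S a x))"
    unfolding e using i by auto
  show "(\<integral>x. f x * cnj (trigpoly S a x) \<partial>torus) = 4 * pi^2 * (\<Sum>k\<in>S. fcs f k * cnj (a k))"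
    unfolding e using i
    by (subst Bochner_Integration.integral_sum, simp)
       (simp only: integral_mult_right_zero integral_mult_cis sum_distrib_left, simp add: mult_ac)
qed

lemma trigpoly_L2:
  assumes S: "finite S"
  shows "(\<integral>x. (cmod (trigpoly S a x))^2 \<partial>torus) = 4 * pi^2 * (\<Sum>k\<in>S. (cmod (a k))^2)"
proof -
  have "complex_of_real (\<integral>x. (cmod (trigpoly S a x))^2 \<partial>torus)
      = (\<integral>x. trigpoly S a x * cnj (trigpoly S a x) \<partial>torus)"
    unfolding integral_complex_of_real[symmetric] complex_norm_square ..
  also have "\<dots> = complex_of_real (4 * pi^2 * (\<Sum>k\<in>S. (cmod (a k))^2))"
    unfolding integral_trigpoly_cnj(2)[OF S sqint_trigpoly[OF S]]
    by (simp add: fcs_trigpoly[OF S], intro sum.cong refl, rule complex_norm_square[symmetric, simplified])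
  finally show ?thesis using of_real_eq_iff by blast
qed

text \<open>Completing the square in each coefficient gives the exact distance. The identity serves
  twice: with \<open>a = fcs f\<close> it yields Bessel, and with a good approximant it yields the
  reverse inequality in \<open>parseval_le\<close>.\<close>

lemma trigpoly_dist_L2:
  assumes S: "finite S" and f: "sqint f"
  shows "(\<integral>x. (cmod (f x - trigpoly S a x))^2 \<partial>torus) = (\<integral>x. (cmod (f x))^2 \<partial>torus)
    + 4 * pi^2 * (\<Sum>k\<in>S. (cmod (a k - fcs f k))^2 - (cmod (fcs f k))^2)"
proof -
  note t = sqint_trigpoly[OF S, of a]
  note c = integral_trigpoly_cnj[OF S f, of a]
  have i: "integrable torus (\<lambda>x. 2 * Re (f x * cnj (trigpoly S a x)))"
    using c(1) by (intro integrable_mult_right integrable_Re)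
  have "(\<integral>x. (cmod (f x - trigpoly S a x))^2 \<partial>torus) = (\<integral>x. (cmod (f x))^2 \<partial>torus)
      - (\<integral>x. 2 * Re (f x * cnj (trigpoly S a x)) \<partial>torus) + (\<integral>x. (cmod (trigpoly S a x))^2 \<partial>torus)"
    unfolding cmod_diff_sq using f t i by (simp add: sqint_def del: integral_mult_right_zero)
  also have "(\<integral>x. 2 * Re (f x * cnj (trigpoly S a x)) \<partial>torus) = 2 * Re (\<integral>x. f x * cnj (trigpoly S a x) \<partial>torus)"
    using c(1) by (simp only: integral_mult_right_zero integral_Re)
  also have "\<dots> = 4 * pi^2 * (\<Sum>k\<in>S. 2 * Re (fcs f k * cnj (a k)))"
    unfolding c(2) by (simp add: sum_distrib_left flip: of_real_power of_real_mult)
      (simp add: algebra_simps)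
  finally show ?thesis unfolding trigpoly_L2[OF S]
    by (simp add: cmod_diff_sq sum.distrib sum_subtractf right_diff_distrib distrib_left mult.commute[of "a _"])
qed

lemma bessel:
  assumes S: "finite S" and f: "sqint f"
  shows "4 * pi^2 * (\<Sum>k\<in>S. (cmod (fcs f k))^2) \<le> (\<integral>x. (cmod (f x))^2 \<partial>torus)"
proof -
  have "0 \<le> (\<integral>x. (cmod (f x - trigpoly S (fcs f) x))^2 \<partial>torus)" by simp
  then show ?thesis unfolding trigpoly_dist_L2[OF S f] by (simp add: sum_negf)
qed

section \<open>Density of trigonometric polynomials and Parseval\<close>

text \<open>Generating the class by monomials and sums turns closure under products into two nested
  inductions; \<open>trig_fun_trigpoly\<close> then recovers explicit coefficients on a finite
  set.\<close>

inductive trig_fun :: "(real^2 \<Rightarrow> complex) \<Rightarrow> bool" where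
  monomial: "trig_fun (\<lambda>x. a * cis (kdot k x))"
| add: "trig_fun f \<Longrightarrow> trig_fun g \<Longrightarrow> trig_fun (\<lambda>x. f x + g x)"

lemma trig_fun_trigpoly:
  assumes "trig_fun f"
  shows "\<exists>S a. finite S \<and> f = trigpoly S a"
  using assms
proof induction
  case (monomial a k)
  have "(\<lambda>x. a * cis (kdot k x)) = trigpoly {k} (\<lambda>_. a)"
    by (auto simp: trigpoly_def)
  then show ?case by blast
next
  case (add f g)
  then obtain S a S' a' where S: "finite S" "f = trigpoly S a" "finite S'" "g = trigpoly S' a'"
    by blast
  let ?a = "\<lambda>k. (if k \<in> S then a k else 0)" and ?a' = "\<lambda>k. (if k \<in> S' then a' k else 0)"
  have "f x + g x = trigpoly (S \<union> S') (\<lambda>k. ?a k + ?a' k) x" for x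
  proof -
    have "f x = (\<Sum>k\<in>S\<union>S'. ?a k * cis (kdot k x))"
      unfolding S trigpoly_def using S by (intro sum.mono_neutral_cong_left) auto
    moreover have "g x = (\<Sum>k\<in>S\<union>S'. ?a' k * cis (kdot k x))"
      unfolding S trigpoly_def using S by (intro sum.mono_neutral_cong_left) auto
    ultimately show ?thesis by (simp add: trigpoly_def sum.distrib distrib_right)
  qed
  then have "(\<lambda>x. f x + g x) = trigpoly (S \<union> S') (\<lambda>k. ?a k + ?a' k)" by blast
  then show ?case using S by blast
qed

lemma trig_fun_mult:
  assumes "trig_fun f" "trig_fun g"
  shows "trig_fun (\<lambda>x. f x * g x)"
  using assms(1)
proof induction
  case (monomial a k)
  show ?case using assms(2)
  proof induction
    case (monomial b l)
    have "(\<lambda>x. a * cis (kdot k x) * (b * cis (kdot l x))) = (\<lambda>x. (a * b) * cis (kdot (k + l) x))"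
      by (auto simp: kdot_add mult_ac cis_mult[symmetric])
    then show ?case by (simp only: trig_fun.monomial)
  next
    case (add f g)
    show ?case unfolding distrib_left using add.IH by (rule trig_fun.add)
  qed
next
  case (add f1 f2)
  show ?case unfolding distrib_right using add.IH by (rule trig_fun.add)
qed

lemma trig_fun_const: "trig_fun (\<lambda>_. c)"
  using trig_fun.monomial[of c 0] by simp

lemma trig_fun_cos: "trig_fun (\<lambda>x. complex_of_real (c * cos (kdot k x)))"
proof -
  have "(\<lambda>x. complex_of_real (c * cos (kdot k x)))
      = (\<lambda>x. (of_real c / 2) * cis (kdot k x) + (of_real c / 2) * cis (kdot (- k) x))"
    by (auto simp: complex_eq_iff kdot_minus)
  then show ?thesis by (simp only: trig_fun.intros)
qed

lemma trig_fun_sin: "trig_fun (\<lambda>x. complex_of_real (c * sin (kdot k x)))"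
proof -
  have "(\<lambda>x. complex_of_real (c * sin (kdot k x)))
      = (\<lambda>x. (- \<i> * of_real c / 2) * cis (kdot k x) + (\<i> * of_real c / 2) * cis (kdot (- k) x))"
    by (auto simp: complex_eq_iff kdot_minus)
  then show ?thesis by (simp only: trig_fun.intros)
qed

text \<open>The quotient map of the square onto the product of two unit circles. Its real
  coordinates are the cosines and sines of the two variables, so real polynomials on the target pull
  back to trigonometric polynomials.\<close>

definition circles :: "real^2 \<Rightarrow> complex \<times> complex" where
  "circles x = (cis (x $ 1), cis (x $ 2))"

lemma trig_fun_polynomial:
  assumes "real_polynomial_function p"
  shows "trig_fun (\<lambda>x. complex_of_real (p (circles x)))"
  using assms
proof induction
  case (linear p)
  interpret bounded_linear p by fact
  have "p (circles x) = cos (kdot (1,0) x) * p (1,0) + sin (kdot (1,0) x) * p (\<i>,0)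
     + (cos (kdot (0,1) x) * p (0,1) + sin (kdot (0,1) x) * p (0,\<i>))" for x
  proof -
    have "circles x = cos (kdot (1,0) x) *\<^sub>R (1,0) + sin (kdot (1,0) x) *\<^sub>R (\<i>,0)
     + (cos (kdot (0,1) x) *\<^sub>R (0,1) + sin (kdot (0,1) x) *\<^sub>R (0,\<i>))"
      by (simp add: circles_def kdot_def complex_eq_iff)
    then show ?thesis by (simp only: add scaleR real_scaleR_def)
  qed
  then have "(\<lambda>x. complex_of_real (p (circles x))) = (\<lambda>x.
      (complex_of_real (p (1,0) * cos (kdot (1,0) x)) + complex_of_real (p (\<i>,0) * sin (kdot (1,0) x)))
     + (complex_of_real (p (0,1) * cos (kdot (0,1) x)) + complex_of_real (p (0,\<i>) * sin (kdot (0,1) x))))"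
    by (simp add: mult.commute)
  then show ?case by (simp only: trig_fun.add trig_fun_cos trig_fun_sin)
next
  case (const c)
  show ?case by (rule trig_fun_const)
next
  case (add f g)
  then show ?case unfolding of_real_add by (intro trig_fun.add)
next
  case (mult f g)
  then show ?case unfolding of_real_mult by (intro trig_fun_mult)
qed

section \<open>Mean square approximation by trigonometric polynomials\<close>

definition L2_approx :: "(real^2 \<Rightarrow> complex) \<Rightarrow> bool" where
  "L2_approx f \<longleftrightarrow> sqint f \<and> (\<forall>e>0. \<exists>S a. finite S \<and> (\<integral>x. (cmod (f x - trigpoly S a x))^2 \<partial>torus) < e)"

lemma sqint_diff: "sqint f \<Longrightarrow> sqint g \<Longrightarrow> sqint (\<lambda>x. f x - g x)"
  using sqint_add[of f "\<lambda>x. (-1) * g x"] sqint_cmult[of g "-1"] by simp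

text \<open>Closure under dominated limits almost everywhere. It is applied twice, to pass from
  continuous functions vanishing off the open square to bounded ones and from these to all real
  square integrable functions.\<close>

lemma L2_approx_limit:
  assumes f: "sqint f" and g: "\<And>n. L2_approx (g n)"
    and G: "integrable torus (\<lambda>x. (G x)^2)" "\<And>n x. cmod (g n x) \<le> G x"
    and lim: "AE x in torus. (\<lambda>n. g n x) \<longlonglongrightarrow> f x"
  shows "L2_approx f"
  unfolding L2_approx_def
proof (intro conjI allI impI f)
  fix e :: real assume e: "e > 0"
  have gs: "sqint (g n)" for n using g by (simp add: L2_approx_def)
  have m: "(\<lambda>x. (cmod (f x - g n x))^2) \<in> borel_measurable torus" for n
    using sqint_diff[OF f gs[of n]] by (simp add: sqint_def borel_measurable_integrable)
  have "(\<lambda>n. \<integral>x. (cmod (f x - g n x))^2 \<partial>torus) \<longlonglongrightarrow> (\<integral>x. 0 \<partial>torus)"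
  proof (rule integral_dominated_convergence[where w="\<lambda>x. 2 * (cmod (f x))^2 + 2 * (G x)^2"])
    show "integrable torus (\<lambda>x. 2 * (cmod (f x))^2 + 2 * (G x)^2)"
      using f G by (simp add: sqint_def)
    show "AE x in torus. (\<lambda>n. (cmod (f x - g n x))^2) \<longlonglongrightarrow> 0"
      using lim
    proof eventually_elim
      case (elim x)
      have "(\<lambda>n. (cmod (f x - g n x))^2) \<longlonglongrightarrow> (cmod (f x - f x))^2"
        using elim by (intro tendsto_intros)
      then show ?case by simp
    qed
    show "AE x in torus. norm ((cmod (f x - g n x))^2) \<le> 2 * (cmod (f x))^2 + 2 * (G x)^2" for n
    proof (intro AE_I2)
      fix x
      have "(cmod (g n x))^2 \<le> (G x)^2" using G(2) by (intro power_mono) auto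
      then show "norm ((cmod (f x - g n x))^2) \<le> 2 * (cmod (f x))^2 + 2 * (G x)^2"
        using norm_add_sq_le[of "f x" "- g n x"] by simp
    qed
  qed (use m in auto)
  then have "\<forall>\<^sub>F n in sequentially. (\<integral>x. (cmod (f x - g n x))^2 \<partial>torus) < e / 4"
    using e by (intro order_tendstoD) auto
  then obtain n where n: "(\<integral>x. (cmod (f x - g n x))^2 \<partial>torus) < e / 4"
    unfolding eventually_sequentially by blast
  obtain S a where S: "finite S" "(\<integral>x. (cmod (g n x - trigpoly S a x))^2 \<partial>torus) < e / 4"
    using g[of n] e unfolding L2_approx_def by (metis zero_less_divide_iff zero_less_numeral)
  have i1: "integrable torus (\<lambda>x. (cmod (f x - g n x))^2)"
    using sqint_diff[OF f gs] by (simp add: sqint_def)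
  have i2: "integrable torus (\<lambda>x. (cmod (g n x - trigpoly S a x))^2)"
    using sqint_diff[OF gs sqint_trigpoly[OF S(1)]] by (simp add: sqint_def)
  have "(\<integral>x. (cmod (f x - trigpoly S a x))^2 \<partial>torus)
      \<le> (\<integral>x. 2 * (cmod (f x - g n x))^2 + 2 * (cmod (g n x - trigpoly S a x))^2 \<partial>torus)"
  proof (rule integral_mono)
    show "integrable torus (\<lambda>x. (cmod (f x - trigpoly S a x))^2)"
      using sqint_diff[OF f sqint_trigpoly[OF S(1)]] by (simp add: sqint_def)
    show "(cmod (f x - trigpoly S a x))^2 \<le> 2 * (cmod (f x - g n x))^2 + 2 * (cmod (g n x - trigpoly S a x))^2" for x
      using norm_add_sq_le[of "f x - g n x" "g n x - trigpoly S a x"] by simp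
  qed (use i1 i2 in auto)
  also have "\<dots> = 2 * (\<integral>x. (cmod (f x - g n x))^2 \<partial>torus) + 2 * (\<integral>x. (cmod (g n x - trigpoly S a x))^2 \<partial>torus)"
    using i1 i2 by simp
  also have "\<dots> < e" using n S(2) by simp
  finally show "\<exists>S a. finite S \<and> (\<integral>x. (cmod (f x - trigpoly S a x))^2 \<partial>torus) < e" using S(1) by blast
qed

definition inner_sq :: "(real^2) set" where "inner_sq = box 0 (\<chi> _. 2 * pi)"

lemma mem_inner_sq: "x \<in> inner_sq \<longleftrightarrow> (\<forall>i. 0 < x $ i \<and> x $ i < 2 * pi)"
  by (simp add: inner_sq_def mem_box_cart)

text \<open>Only one of the two angles has to avoid the endpoints: this already forces the
  difference to be smaller than a full period, hence the multiple of \<open>2 * pi\<close> to be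
  0.\<close>

lemma cis_inj_period:
  assumes "cis a = cis b" "0 < a" "a < 2 * pi" "0 \<le> b" "b \<le> 2 * pi"
  shows "a = b"
proof -
  have "cis (a - b) = 1" using assms(1) by (simp flip: cis_divide)
  then have "cos (a - b) = 1" by (metis cis.simps(1) one_complex.simps(1))
  then obtain n :: int where n: "a - b = of_int n * 2 * pi" using cos_one_2pi_int by blast
  have "\<bar>of_int n * 2 * pi\<bar> < 2 * pi" unfolding n[symmetric] using assms by linarith
  then have "\<bar>of_int n\<bar> < (1::real)" by (simp add: abs_mult)
  then have "n = 0" by linarith
  then show ?thesis using n by simp
qed

lemma circles_inj:
  assumes "circles x = circles y" "x \<in> inner_sq" "y \<in> sq"
  shows "x = y"
  using assms cis_inj_period[of "x $ 1" "y $ 1"] cis_inj_period[of "x $ 2" "y $ 2"]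
  by (simp add: circles_def mem_inner_sq mem_sq vec_eq_iff forall_2)

lemma continuous_on_circles: "continuous_on A circles"
  unfolding circles_def[abs_def] by (intro continuous_intros)

lemma compact_sq: "compact sq" by (simp add: sq_def)

text \<open>A function vanishing on the boundary of the square descends to the product of two
  circles, where the Stone--Weierstrass theorem applies.\<close>

lemma L2_approx_continuous:
  fixes h :: "real^2 \<Rightarrow> real"
  assumes h: "continuous_on UNIV h" and B: "\<And>x. \<bar>h x\<bar> \<le> B"
    and h0: "\<And>x. x \<notin> inner_sq \<Longrightarrow> h x = 0"
  shows "L2_approx (\<lambda>x. complex_of_real (h x))"
  unfolding L2_approx_def
proof (intro conjI allI impI)
  have "h \<in> borel_measurable torus"
    using h by (intro measurable_torusI borel_measurable_continuous_onI)
  then show hs: "sqint (\<lambda>x. complex_of_real (h x))"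
    by (intro sqint_bounded[of _ B]) (use B in auto)
  fix e :: real assume e: "e > 0"
  \<comment> \<open>Any preimage may be chosen: two different points of the square with the same
    image both lie on the boundary, where \<open>h\<close> vanishes.\<close>
  define H where "H z = h (SOME x. x \<in> sq \<and> circles x = z)" for z
  have H: "H (circles x) = h x" if x: "x \<in> sq" for x
  proof -
    define y where "y = (SOME y. y \<in> sq \<and> circles y = circles x)"
    have "y \<in> sq \<and> circles y = circles x"
      unfolding y_def by (rule someI[of _ x]) (use x in auto)
    then have "y \<in> sq" "circles y = circles x" by auto
    then have "h y = h x"
      using circles_inj[of x y] circles_inj[of y x] x h0[of x] h0[of y] by metis
    then show ?thesis by (simp add: H_def y_def)
  qed
  have cK: "compact (circles ` sq)"
    by (intro compact_continuous_image continuous_on_circles compact_sq)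
  \<comment> \<open>Continuity is tested on preimages of closed sets. Such a preimage is the image
    under \<open>circles\<close> of a compact subset of the square, hence compact.\<close>
  have "continuous_on (circles ` sq) H"
    unfolding continuous_on_closed_vimage[OF compact_imp_closed[OF cK]]
  proof (intro allI impI)
    fix C :: "real set" assume "closed C"
    then have "closed (h -` C \<inter> sq)"
      using continuous_on_closed_vimage[OF compact_imp_closed[OF compact_sq], of h]
        continuous_on_subset[OF h] by blast
    then have "compact (sq \<inter> (h -` C \<inter> sq))"
      by (rule compact_Int_closed[OF compact_sq])
    then have "compact (circles ` (sq \<inter> (h -` C \<inter> sq)))"
      by (intro compact_continuous_image continuous_on_circles)
    moreover have "circles ` (sq \<inter> (h -` C \<inter> sq)) = H -` C \<inter> circles ` sq"
      using H by auto
    ultimately show "closed (H -` C \<inter> circles ` sq)" by (simp add: compact_imp_closed)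
  qed
  \<comment> \<open>The square has area \<open>4 * pi^2\<close>, so a uniform error \<open>d\<close>
    costs at most \<open>4 * pi^2 * d^2 = e / 2\<close> in the integral.\<close>
  define d where "d = sqrt (e / (8 * pi^2))"
  have d: "d > 0" using e by (simp add: d_def)
  obtain p where p: "real_polynomial_function p" "\<And>z. z \<in> circles ` sq \<Longrightarrow> \<bar>H z - p z\<bar> < d"
    using Stone_Weierstrass_real_polynomial_function[OF cK \<open>continuous_on (circles ` sq) H\<close> d] by blast
  obtain S a where S: "finite S" "(\<lambda>x. complex_of_real (p (circles x))) = trigpoly S a"
    using trig_fun_trigpoly[OF trig_fun_polynomial[OF p(1)]] by blast
  interpret finite_measure torus by (rule finite_measure_torus)
  have mt: "measure torus sq = 4 * pi^2"
  proof -
    have "complex_of_real (measure torus sq) = complex_of_real (4 * pi^2)"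
      using integral_cis_kdot[of 0] by (simp add: scaleR_conv_of_real)
    then show ?thesis using of_real_eq_iff by blast
  qed
  have "(\<integral>x. (cmod (complex_of_real (h x) - trigpoly S a x))^2 \<partial>torus) \<le> (\<integral>x. d^2 \<partial>torus)"
  proof (rule integral_mono)
    show "integrable torus (\<lambda>x. (cmod (complex_of_real (h x) - trigpoly S a x))^2)"
      using sqint_diff[OF hs sqint_trigpoly[OF S(1)]] by (simp add: sqint_def)
    fix x assume "x \<in> space torus"
    then have "\<bar>h x - p (circles x)\<bar> < d" using p(2)[of "circles x"] H by auto
    moreover have "complex_of_real (h x) - trigpoly S a x = complex_of_real (h x - p (circles x))"
      using fun_cong[OF S(2), of x] by simp
    ultimately show "(cmod (complex_of_real (h x) - trigpoly S a x))^2 \<le> d^2"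
      by (metis norm_of_real abs_ge_zero less_imp_le power_mono)
  qed auto
  also have "\<dots> = 4 * pi^2 * d^2" by (simp add: mt)
  also have "\<dots> = e / 2" using e by (simp add: d_def)
  also have "\<dots> < e" using e by simp
  finally show "\<exists>S a. finite S \<and> (\<integral>x. (cmod (complex_of_real (h x) - trigpoly S a x))^2 \<partial>torus) < e"
    using S(1) by blast
qed

lemma AE_torus_inner: "AE x in torus. x \<in> inner_sq"
proof -
  have "AE x in lebesgue. x \<notin> sq - inner_sq"
    using negligible_frontier_interval[of 0 "\<chi> _. 2 * pi"]
    unfolding sq_def inner_sq_def negligible_iff_null_sets by (rule AE_not_in)
  then have "AE x in lborel. x \<notin> sq - inner_sq" by (simp add: AE_completion_iff)
  then show ?thesis by (auto simp: AE_restrict_space_iff elim!: eventually_mono)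
qed

text \<open>A measurable function is, off a null set, a limit of continuous functions. After
  clamping them and cutting them off at the boundary, the continuous case and dominated convergence
  apply.\<close>

lemma L2_approx_bounded:
  fixes f :: "real^2 \<Rightarrow> real"
  assumes f: "f \<in> borel_measurable torus" and B: "\<And>x. \<bar>f x\<bar> \<le> B"
  shows "L2_approx (\<lambda>x. complex_of_real (f x))"
proof -
  have B0: "0 \<le> B" using B[of 0] by linarith
  have "(\<lambda>x. indicator sq x *\<^sub>R f x) \<in> borel_measurable lborel"
    using f by (simp add: borel_measurable_restrict_space_iff)
  then have "(\<lambda>x. indicator sq x *\<^sub>R f x) \<in> borel_measurable lebesgue"
    by (rule measurable_completion)
  then have "(\<lambda>x. indicator sq x *\<^sub>R f x) measurable_on UNIV"
    by (simp add: measurable_on_iff_borel_measurable)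
  then obtain N g where N: "negligible N" and g: "\<And>n. continuous_on UNIV (g n)"
    and lim: "\<And>x. x \<notin> N \<Longrightarrow> (\<lambda>n. g n x) \<longlonglongrightarrow> indicator sq x *\<^sub>R f x"
    unfolding measurable_on_def by auto
  \<comment> \<open>Clamping to \<open>[-B, B]\<close> supplies the dominating constant. The second
    factor vanishes outside the open square, and at each interior point it equals 1 for all large
    \<open>n\<close>.\<close>
  define h where "h n x = max (- B) (min B (g n x)) * min 1 (real n * infdist x (- inner_sq))" for n x
  have ne: "- inner_sq \<noteq> {}" using mem_inner_sq[of 0] by auto
  have cl: "closed (- inner_sq)" by (simp add: inner_sq_def open_box closed_Compl)
  have hb: "\<bar>h n x\<bar> \<le> B" for n x
  proof -
    have "\<bar>h n x\<bar> \<le> B * 1"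
      unfolding h_def abs_mult using B0 infdist_nonneg[of x "- inner_sq"]
        mult_nonneg_nonneg[OF of_nat_0_le_iff[of n] infdist_nonneg[of x "- inner_sq"]]
      by (intro mult_mono) auto
    then show ?thesis by simp
  qed
  show ?thesis
  proof (rule L2_approx_limit[where g="\<lambda>n x. complex_of_real (h n x)" and G="\<lambda>_. B"])
    show "sqint (\<lambda>x. complex_of_real (f x))"
      by (rule sqint_bounded[of _ B]) (use f B in auto)
    show "L2_approx (\<lambda>x. complex_of_real (h n x))" for n
    proof (rule L2_approx_continuous[OF _ hb])
      show "continuous_on UNIV (h n)"
        unfolding h_def[abs_def] by (intro continuous_intros g)
      show "h n x = 0" if "x \<notin> inner_sq" for x using that by (simp add: h_def)
    qed
    interpret finite_measure torus by (rule finite_measure_torus)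
    show "integrable torus (\<lambda>x. B^2)" by simp
    show "cmod (complex_of_real (h n x)) \<le> B" for n x using hb by simp
    have "AE x in lebesgue. x \<notin> N" using N unfolding negligible_iff_null_sets by (rule AE_not_in)
    then have "AE x in lborel. x \<notin> N" by (simp add: AE_completion_iff)
    then have "AE x in torus. x \<notin> N" by (auto simp: AE_restrict_space_iff elim!: eventually_mono)
    then show "AE x in torus. (\<lambda>n. complex_of_real (h n x)) \<longlonglongrightarrow> complex_of_real (f x)"
      using AE_torus_inner
    proof eventually_elim
      case (elim x)
      then have xs: "x \<in> sq" by (auto simp: mem_inner_sq mem_sq less_imp_le)
      have pos: "infdist x (- inner_sq) > 0"
        using infdist_pos_not_in_closed[OF cl ne] elim by auto
      have "\<forall>\<^sub>F n in sequentially. min 1 (real n * infdist x (- inner_sq)) = 1"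
      proof -
        obtain m where m: "1 < real m * infdist x (- inner_sq)" using reals_Archimedean3[OF pos] by blast
        have "1 \<le> real n * infdist x (- inner_sq)" if "n \<ge> m" for n
          using m mult_right_mono[of "real m" "real n" "infdist x (- inner_sq)"] that pos by linarith
        then show ?thesis unfolding eventually_sequentially by force
      qed
      then have "(\<lambda>n. min 1 (real n * infdist x (- inner_sq))) \<longlonglongrightarrow> 1"
        by (rule tendsto_eventually)
      moreover have "(\<lambda>n. g n x) \<longlonglongrightarrow> f x" using lim[of x] elim xs by simp
      ultimately have "(\<lambda>n. h n x) \<longlonglongrightarrow> max (- B) (min B (f x)) * 1"
        unfolding h_def by (intro tendsto_intros)
      moreover have "max (- B) (min B (f x)) = f x" using B[of x] by (auto simp: abs_le_iff)
      ultimately have "(\<lambda>n. h n x) \<longlonglongrightarrow> f x" by simp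
      then show ?case by (rule tendsto_of_real)
    qed
  qed
qed

text \<open>Truncation at height \<open>n\<close> is eventually exact at each point and is dominated
  by the function itself.\<close>

lemma L2_approx_real:
  fixes f :: "real^2 \<Rightarrow> real"
  assumes f: "sqint (\<lambda>x. complex_of_real (f x))"
  shows "L2_approx (\<lambda>x. complex_of_real (f x))"
proof (rule L2_approx_limit[where g="\<lambda>n x. complex_of_real (max (- real n) (min (real n) (f x)))" and G="\<lambda>x. \<bar>f x\<bar>"])
  show "sqint (\<lambda>x. complex_of_real (f x))" by fact
  have "(\<lambda>x. complex_of_real (f x)) \<in> borel_measurable torus" using f by (simp add: sqint_def)
  from measurable_compose[OF this borel_measurable_Re] have [measurable]: "f \<in> borel_measurable torus" by simp
  show "L2_approx (\<lambda>x. complex_of_real (max (- real n) (min (real n) (f x))))" for n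
    by (rule L2_approx_bounded[of _ "real n"]) auto
  show "integrable torus (\<lambda>x. \<bar>f x\<bar>^2)" using f by (simp add: sqint_def)
  show "cmod (complex_of_real (max (- real n) (min (real n) (f x)))) \<le> \<bar>f x\<bar>" for n x
    unfolding norm_of_real by (auto simp: max_def min_def abs_if)
  show "AE x in torus. (\<lambda>n. complex_of_real (max (- real n) (min (real n) (f x)))) \<longlonglongrightarrow> complex_of_real (f x)"
  proof (intro AE_I2 tendsto_of_real tendsto_eventually)
    fix x
    obtain m where m: "\<bar>f x\<bar> < real m" using reals_Archimedean2 by blast
    show "\<forall>\<^sub>F n in sequentially. max (- real n) (min (real n) (f x)) = f x"
      unfolding eventually_sequentially by (rule exI[of _ m]) (use m in \<open>auto simp: max_def min_def abs_if split: if_splits\<close>)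
  qed
qed

text \<open>In \<open>trigpoly_dist_L2\<close> the squared coefficient errors may be discarded. An
  approximant at squared distance below \<open>e\<close> then bounds the integral by
  \<open>4 * pi^2 * M + e\<close>.\<close>

lemma parseval_le:
  fixes f :: "real^2 \<Rightarrow> real"
  assumes f: "sqint (\<lambda>x. complex_of_real (f x))"
    and M: "\<And>S. finite S \<Longrightarrow> (\<Sum>k\<in>S. (cmod (fcs (\<lambda>x. complex_of_real (f x)) k))^2) \<le> M"
  shows "(\<integral>x. (f x)^2 \<partial>torus) \<le> 4 * pi^2 * M"
proof (rule field_le_epsilon)
  fix e :: real assume "e > 0"
  then obtain S a where S: "finite S" "(\<integral>x. (cmod (complex_of_real (f x) - trigpoly S a x))^2 \<partial>torus) < e"
    using L2_approx_real[OF f] unfolding L2_approx_def by blast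
  let ?c = "fcs (\<lambda>x. complex_of_real (f x))"
  have "(\<integral>x. (f x)^2 \<partial>torus) + 4 * pi^2 * (\<Sum>k\<in>S. (cmod (a k - ?c k))^2 - (cmod (?c k))^2) < e"
    using S(2) unfolding trigpoly_dist_L2[OF S(1) f] by simp
  moreover have "(\<Sum>k\<in>S. (cmod (a k - ?c k))^2 - (cmod (?c k))^2) \<ge> - M"
  proof -
    have "(\<Sum>k\<in>S. - ((cmod (?c k))^2)) \<le> (\<Sum>k\<in>S. (cmod (a k - ?c k))^2 - (cmod (?c k))^2)"
      by (intro sum_mono) simp
    then show ?thesis using M[OF S(1)] by (simp add: sum_negf)
  qed
  then have "4 * pi^2 * (\<Sum>k\<in>S. (cmod (a k - ?c k))^2 - (cmod (?c k))^2) \<ge> 4 * pi^2 * (- M)"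
    by (intro mult_left_mono) auto
  moreover have "X \<le> 4 * pi^2 * M + e" if "X + Y < e" "Y \<ge> 4 * pi^2 * (- M)" for X Y :: real
    using that by simp
  ultimately show "(\<integral>x. (f x)^2 \<partial>torus) \<le> 4 * pi^2 * M + e" by blast
qed

section \<open>Coefficient sequences and the trilinear form\<close>

definition ell2 :: "('i \<Rightarrow> real) \<Rightarrow> bool" where
  "ell2 x \<longleftrightarrow> (\<lambda>k. (x k)^2) summable_on UNIV"

text \<open>A divergent infinite sum has value 0, so this number is a norm only together with
  \<open>ell2\<close>; the two are therefore established side by side.\<close>

definition nrm2 :: "('i \<Rightarrow> real) \<Rightarrow> real" where
  "nrm2 x = sqrt (\<Sum>\<^sub>\<infinity>k. (x k)^2)"

lemma nrm2_nonneg [simp]: "0 \<le> nrm2 x"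
  unfolding nrm2_def by (intro real_sqrt_ge_zero infsum_nonneg) auto

lemma nrm2_sq: "(nrm2 x)^2 = (\<Sum>\<^sub>\<infinity>k. (x k)^2)"
  unfolding nrm2_def by (intro real_sqrt_pow2 infsum_nonneg) auto

lemma summable_on_nonnegI:
  fixes f :: "'i \<Rightarrow> real"
  assumes "\<And>k. 0 \<le> f k" "\<And>F. finite F \<Longrightarrow> sum f F \<le> B"
  shows "f summable_on UNIV" "infsum f UNIV \<le> B"
proof -
  show s: "f summable_on UNIV"
    by (rule nonneg_bdd_above_summable_on) (use assms in \<open>auto intro!: bdd_aboveI2\<close>)
  show "infsum f UNIV \<le> B" by (rule infsum_le_finite_sums[OF s]) (use assms in auto)
qed

lemma sum_sq_le_nrm2: "ell2 x \<Longrightarrow> finite F \<Longrightarrow> (\<Sum>k\<in>F. (x k)^2) \<le> (nrm2 x)^2"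
  unfolding ell2_def nrm2_sq by (rule finite_sum_le_infsum) auto

lemma L2_set_le_nrm2:
  assumes "ell2 x" "finite F" shows "L2_set x F \<le> nrm2 x"
  unfolding L2_set_def using sum_sq_le_nrm2[OF assms] by (intro real_le_lsqrt) (auto simp: sum_nonneg)

text \<open>A bound uniform over finite sets gives summability and the norm bound at once, which
  reduces inequalities for \<open>nrm2\<close> to those for \<open>L2_set\<close>.\<close>

lemma nrm2_leI:
  assumes "\<And>F. finite F \<Longrightarrow> L2_set x F \<le> B"
  shows "ell2 x" "nrm2 x \<le> B"
proof -
  have "0 \<le> B" using assms[of "{}"] by simp
  have "(\<Sum>k\<in>F. (x k)^2) \<le> B^2" if "finite F" for F
    using assms[OF that] power_mono[OF assms[OF that] L2_set_nonneg, of 2] by (simp add: L2_set_def sum_nonneg)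
  note s = summable_on_nonnegI[of "\<lambda>k. (x k)^2", OF _ this]
  show "ell2 x" unfolding ell2_def using s(1) by simp
  show "nrm2 x \<le> B" unfolding nrm2_def using s(2) \<open>0 \<le> B\<close> by (intro real_le_lsqrt infsum_nonneg) auto
qed

lemma nrm2_triangle:
  assumes "ell2 x" "ell2 y" "\<And>k. \<bar>z k\<bar> \<le> \<bar>x k\<bar> + \<bar>y k\<bar>"
  shows "ell2 z" "nrm2 z \<le> nrm2 x + nrm2 y"
proof -
  have "L2_set z F \<le> nrm2 x + nrm2 y" if "finite F" for F
  proof -
    have "L2_set z F \<le> L2_set (\<lambda>k. \<bar>x k\<bar> + \<bar>y k\<bar>) F"
      unfolding L2_set_def using assms(3)
      by (intro real_sqrt_le_mono sum_mono) (metis abs_ge_zero power2_abs power_mono)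
    also have "\<dots> \<le> L2_set (\<lambda>k. \<bar>x k\<bar>) F + L2_set (\<lambda>k. \<bar>y k\<bar>) F" by (rule L2_set_triangle_ineq)
    also have "\<dots> = L2_set x F + L2_set y F" by (simp add: L2_set_def)
    also have "\<dots> \<le> nrm2 x + nrm2 y" using that assms by (intro add_mono L2_set_le_nrm2)
    finally show ?thesis .
  qed
  from nrm2_leI[OF this] show "ell2 z" "nrm2 z \<le> nrm2 x + nrm2 y" by auto
qed

lemma nrm2_mono:
  assumes "ell2 x" "\<And>k. \<bar>z k\<bar> \<le> \<bar>x k\<bar>"
  shows "ell2 z" "nrm2 z \<le> nrm2 x"
proof -
  have "ell2 (\<lambda>_::'a. 0)" "nrm2 (\<lambda>_::'a. 0) = 0" by (simp_all add: ell2_def nrm2_def)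
  with nrm2_triangle[OF assms(1), of "\<lambda>_. 0" z] assms(2) show "ell2 z" "nrm2 z \<le> nrm2 x" by auto
qed

lemma nrm2_cmult:
  assumes "ell2 x"
  shows "ell2 (\<lambda>k. c * x k)" "nrm2 (\<lambda>k. c * x k) = \<bar>c\<bar> * nrm2 x"
  using assms unfolding ell2_def nrm2_def power_mult_distrib infsum_cmult_right' real_sqrt_mult
  by (rule summable_on_cmult_right) simp

lemma cauchy_schwarz_ell2:
  assumes "ell2 x" "ell2 y"
  shows "(\<lambda>k. \<bar>x k\<bar> * \<bar>y k\<bar>) summable_on UNIV" "(\<Sum>\<^sub>\<infinity>k. \<bar>x k\<bar> * \<bar>y k\<bar>) \<le> nrm2 x * nrm2 y"
    "finite F \<Longrightarrow> (\<Sum>k\<in>F. \<bar>x k\<bar> * \<bar>y k\<bar>) \<le> nrm2 x * nrm2 y"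
proof -
  have *: "(\<Sum>k\<in>F. \<bar>x k\<bar> * \<bar>y k\<bar>) \<le> nrm2 x * nrm2 y" if "finite F" for F
    using assms that by (intro order_trans[OF L2_set_mult_ineq] mult_mono L2_set_le_nrm2) (auto intro: L2_set_nonneg)
  then show "finite F \<Longrightarrow> (\<Sum>k\<in>F. \<bar>x k\<bar> * \<bar>y k\<bar>) \<le> nrm2 x * nrm2 y" .
  show "(\<lambda>k. \<bar>x k\<bar> * \<bar>y k\<bar>) summable_on UNIV" "(\<Sum>\<^sub>\<infinity>k. \<bar>x k\<bar> * \<bar>y k\<bar>) \<le> nrm2 x * nrm2 y"
    by (rule summable_on_nonnegI[OF _ *]; simp)+
qed

lemma ell2_shift:
  fixes z :: "'i::ab_group_add \<Rightarrow> real"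
  shows "ell2 (\<lambda>l. z (m + l)) \<longleftrightarrow> ell2 z" "nrm2 (\<lambda>l. z (m + l)) = nrm2 z"
proof -
  have b: "bij_betw (\<lambda>l. m + l) UNIV UNIV" by (rule bij_betwI[of _ _ _ "\<lambda>l. l - m"]) auto
  show "ell2 (\<lambda>l. z (m + l)) \<longleftrightarrow> ell2 z"
    unfolding ell2_def by (rule summable_on_reindex_bij_betw[OF b])
  show "nrm2 (\<lambda>l. z (m + l)) = nrm2 z"
    unfolding nrm2_def using infsum_reindex_bij_betw[OF b, of "\<lambda>k. (z k)^2"] by simp
qed

text \<open>For fixed \<open>m\<close> the sum over \<open>l\<close> is a Cauchy-Schwarz pairing,
  and the \<ell>2 norm of \<open>z\<close> does not notice the shift by \<open>m\<close>; summing
  over \<open>m\<close> leaves the \<ell>1 norm of \<open>x\<close>. A finite index set is first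
  enlarged to the product of its projections.\<close>

lemma young_sum:
  fixes x y z :: "'i::ab_group_add \<Rightarrow> real"
  assumes x: "x summable_on UNIV" and y: "ell2 y" and z: "ell2 z"
    and pos: "\<And>k. 0 \<le> x k" "\<And>k. 0 \<le> y k" "\<And>k. 0 \<le> z k"
  shows "(\<lambda>(m,l). x m * y l * z (m + l)) summable_on UNIV"
    "(\<Sum>\<^sub>\<infinity>(m,l). x m * y l * z (m + l)) \<le> infsum x UNIV * (nrm2 y * nrm2 z)"
proof -
  have *: "(\<Sum>(m,l)\<in>F. x m * y l * z (m + l)) \<le> infsum x UNIV * (nrm2 y * nrm2 z)" if F: "finite F" for F
  proof -
    have "(\<Sum>(m,l)\<in>F. x m * y l * z (m + l)) \<le> (\<Sum>(m,l)\<in>fst ` F \<times> snd ` F. x m * y l * z (m + l))"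
      using F pos by (intro sum_mono2) (auto intro: rev_image_eqI)
    also have "\<dots> = (\<Sum>m\<in>fst ` F. x m * (\<Sum>l\<in>snd ` F. \<bar>y l\<bar> * \<bar>z (m + l)\<bar>))"
      using pos by (simp add: sum.cartesian_product[symmetric] sum_distrib_left mult.assoc)
    also have "\<dots> \<le> (\<Sum>m\<in>fst ` F. x m * (nrm2 y * nrm2 z))"
    proof (intro sum_mono mult_left_mono pos)
      fix m
      show "(\<Sum>l\<in>snd ` F. \<bar>y l\<bar> * \<bar>z (m + l)\<bar>) \<le> nrm2 y * nrm2 z"
        using cauchy_schwarz_ell2(3)[of y "\<lambda>l. z (m + l)" "snd ` F"] y z F by (simp add: ell2_shift)
    qed
    also have "\<dots> = (\<Sum>m\<in>fst ` F. x m) * (nrm2 y * nrm2 z)" by (simp add: sum_distrib_right)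
    also have "\<dots> \<le> infsum x UNIV * (nrm2 y * nrm2 z)"
      using F pos x by (intro mult_right_mono finite_sum_le_infsum) auto
    finally show ?thesis .
  qed
  show "(\<lambda>(m,l). x m * y l * z (m + l)) summable_on UNIV"
    "(\<Sum>\<^sub>\<infinity>(m,l). x m * y l * z (m + l)) \<le> infsum x UNIV * (nrm2 y * nrm2 z)"
    by (rule summable_on_nonnegI[OF _ *]; use pos in auto)+
qed

lemma young_sum':
  fixes x y z :: "'i::ab_group_add \<Rightarrow> real"
  assumes x: "ell2 x" and y: "y summable_on UNIV" and z: "ell2 z"
    and pos: "\<And>k. 0 \<le> x k" "\<And>k. 0 \<le> y k" "\<And>k. 0 \<le> z k"
  shows "(\<lambda>(m,l). x m * y l * z (m + l)) summable_on UNIV"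
    "(\<Sum>\<^sub>\<infinity>(m,l). x m * y l * z (m + l)) \<le> infsum y UNIV * (nrm2 x * nrm2 z)"
proof -
  have b: "bij_betw prod.swap UNIV (UNIV :: ('i \<times> 'i) set)" by (rule bij_betwI[of _ _ _ prod.swap]) auto
  have e: "(\<lambda>p. (\<lambda>(m,l). y m * x l * z (m + l)) (prod.swap p)) = (\<lambda>(m,l). x m * y l * z (m + l))"
    by (auto simp: mult_ac add.commute)
  note Y = young_sum[OF y x z pos(2) pos(1) pos(3)]
  show "(\<lambda>(m,l). x m * y l * z (m + l)) summable_on UNIV"
    using Y(1) summable_on_reindex_bij_betw[OF b, of "\<lambda>(m,l). y m * x l * z (m + l)"] unfolding e by simp
  show "(\<Sum>\<^sub>\<infinity>(m,l). x m * y l * z (m + l)) \<le> infsum y UNIV * (nrm2 x * nrm2 z)"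
    using Y(2) infsum_reindex_bij_betw[OF b, of "\<lambda>(m,l). y m * x l * z (m + l)"] unfolding e by simp
qed

section \<open>Divergence-free coefficient sequences\<close>

type_synonym cseq = "int \<times> int \<Rightarrow> complex^2"

text \<open>Bilinear rather than Hermitian: times the imaginary unit, \<open>dotk (a m) l\<close> is
  the factor with which mode \<open>m\<close> of the advecting field differentiates mode
  \<open>l\<close>.\<close>

definition dotk :: "complex^2 \<Rightarrow> int \<times> int \<Rightarrow> complex" where
  "dotk w k = (\<Sum>j\<in>UNIV. w $ j * kc k $ j)"

text \<open>These norms leave out the factor \<open>2 * pi\<close> of Parseval's identity, so that
  \<open>Hnorm u = 2 * pi * seq_L2 (fc u)\<close> for square integrable fields; the same factor
  relates \<open>Vnorm\<close> and \<open>seq_H1\<close>.\<close>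

definition seq_L2 :: "cseq \<Rightarrow> real" where "seq_L2 a = nrm2 (\<lambda>k. norm (a k))"
definition seq_H1 :: "cseq \<Rightarrow> real" where "seq_H1 a = nrm2 (\<lambda>k. sqrt (ksq k) * norm (a k))"
definition seq_l1 :: "cseq \<Rightarrow> real" where "seq_l1 a = (\<Sum>\<^sub>\<infinity>k. norm (a k))"

text \<open>Mean zero, zero divergence and reality of the field. The last condition is what makes
  the reflection in \<open>triterm_antisym\<close> possible.\<close>

definition solenoidal :: "cseq \<Rightarrow> bool" where
  "solenoidal a \<longleftrightarrow> a 0 = 0 \<and> (\<forall>k. dotk (a k) k = 0) \<and> (\<forall>k i. a (- k) $ i = cnj (a k $ i))"

lemma solenoidal_dotk: "solenoidal a \<Longrightarrow> dotk (a k) k = 0"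
  and solenoidal_cnj: "solenoidal a \<Longrightarrow> a (- k) $ i = cnj (a k $ i)"
  and solenoidal_0: "solenoidal a \<Longrightarrow> a 0 = 0"
  unfolding solenoidal_def by blast+

definition inH1 :: "cseq \<Rightarrow> bool" where
  "inH1 a \<longleftrightarrow> solenoidal a \<and> ell2 (\<lambda>k. sqrt (ksq k) * norm (a k))"

text \<open>The coefficients of a solution are of this kind at almost every time, and the sums
  defining the trilinear form converge absolutely on this class.\<close>

definition wiener_H1 :: "cseq \<Rightarrow> bool" where
  "wiener_H1 a \<longleftrightarrow> inH1 a \<and> (\<lambda>k. norm (a k)) summable_on UNIV"

lemma ksq_nonneg [simp]: "0 \<le> ksq k" by (simp add: ksq_def)

lemma ksq_minus [simp]: "ksq (- k) = ksq k" by (simp add: ksq_def)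

lemma ksq_ge_1: assumes "k \<noteq> 0" shows "1 \<le> ksq k"
proof -
  have "(fst k)^2 + (snd k)^2 \<ge> 1"
    using assms by (metis add_cancel_right_left int_one_le_iff_zero_less prod_eq_iff zero_prod_def fst_conv snd_conv
        sum_power2_gt_zero_iff)
  then have "real_of_int ((fst k)^2 + (snd k)^2) \<ge> 1" by linarith
  then show ?thesis by (simp add: ksq_def)
qed

lemma ksq_0 [simp]: "ksq 0 = 0" "ksq (0,0) = 0" by (simp_all add: ksq_def)

lemma dotk_add: "dotk (a + b) k = dotk a k + dotk b k" "dotk w (k + l) = dotk w k + dotk w l"
  by (simp_all add: dotk_def sum_2 kc_def algebra_simps)

lemma dotk_scaleR: "dotk (c *\<^sub>R a) k = c *\<^sub>R dotk a k"
  by (simp add: dotk_def sum_2 algebra_simps)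

lemma dotk_minus: "dotk w (- k) = - dotk w k" "dotk (- w) k = - dotk w k"
  by (simp_all add: dotk_def sum_2 kc_def algebra_simps)

lemma norm_kc: "norm (kc k) = sqrt (ksq k)"
  by (simp add: norm_vec_def L2_set_def sum_2 kc_def ksq_def)

lemma norm_vec2_sq: "(norm (w :: complex^2))^2 = (cmod (w $ 1))^2 + (cmod (w $ 2))^2"
  by (simp add: norm_vec_def L2_set_def sum_2)

lemma norm_dotk: "cmod (dotk w k) \<le> norm w * sqrt (ksq k)"
proof -
  have "cmod (dotk w k) \<le> (\<Sum>j\<in>UNIV. \<bar>cmod (w $ j)\<bar> * \<bar>cmod (kc k $ j)\<bar>)"
    unfolding dotk_def by (rule order_trans[OF norm_sum]) (simp add: norm_mult)
  also have "\<dots> \<le> norm w * norm (kc k)"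
    unfolding norm_vec_def by (rule L2_set_mult_ineq)
  finally show ?thesis by (simp add: norm_kc)
qed

lemma norm_vector_smult: "norm (c *s (w :: complex^2)) = cmod c * norm w"
  by (rule power2_eq_imp_eq) (simp_all add: power_mult_distrib norm_vec2_sq norm_mult distrib_left)

section \<open>The trilinear form and its antisymmetry\<close>

definition triterm :: "cseq \<Rightarrow> cseq \<Rightarrow> cseq \<Rightarrow> (int \<times> int) \<times> (int \<times> int) \<Rightarrow> real" where
  "triterm a b c = (\<lambda>(m,l). ((\<i> * dotk (a m) l) *s b l) \<bullet> c (m + l))"

text \<open>Up to the factor \<open>4 * pi^2\<close> this is the integral of (u.grad)v . w. The pair
  \<open>(m, l)\<close> records that modes \<open>m\<close> and \<open>l\<close> feed mode
  \<open>m + l\<close>, and the inner product of \<open>complex^2\<close> is already the real part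
  of the Hermitian one.\<close>

definition tri :: "cseq \<Rightarrow> cseq \<Rightarrow> cseq \<Rightarrow> real" where
  "tri a b c = infsum (triterm a b c) UNIV"

lemma triterm_bound:
  "\<bar>triterm a b c (m,l)\<bar> \<le> norm (a m) * (sqrt (ksq l) * norm (b l)) * norm (c (m + l))"
proof -
  have "\<bar>triterm a b c (m,l)\<bar> \<le> norm ((\<i> * dotk (a m) l) *s b l) * norm (c (m + l))"
    unfolding triterm_def by (simp add: Cauchy_Schwarz_ineq2)
  also have "\<dots> = (cmod (dotk (a m) l) * norm (b l)) * norm (c (m + l))"
    by (simp add: norm_vector_smult norm_mult)
  also have "\<dots> \<le> ((norm (a m) * sqrt (ksq l)) * norm (b l)) * norm (c (m + l))"
    by (intro mult_right_mono norm_dotk) auto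
  finally show ?thesis by (simp add: mult_ac)
qed

lemma triterm_bound_pair:
  "\<bar>triterm a b c p\<bar> \<le> (case p of (m,l) \<Rightarrow> norm (a m) * (sqrt (ksq l) * norm (b l)) * norm (c (m + l)))"
  unfolding split_beta using triterm_bound[of a b c "fst p" "snd p"] by simp

lemma tri_boundI:
  assumes "(\<lambda>(m,l). norm (a m) * (sqrt (ksq l) * norm (b l)) * norm (c (m + l))) summable_on UNIV"
    "(\<Sum>\<^sub>\<infinity>(m,l). norm (a m) * (sqrt (ksq l) * norm (b l)) * norm (c (m + l))) \<le> B"
  shows "triterm a b c summable_on UNIV" "\<bar>tri a b c\<bar> \<le> B"
proof -
  have s: "(\<lambda>p. norm (triterm a b c p)) summable_on UNIV"
    by (rule summable_on_comparison_test[OF assms(1)]) (simp_all only: real_norm_def triterm_bound_pair abs_ge_zero)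
  then show "triterm a b c summable_on UNIV" by (rule abs_summable_summable)
  have "\<bar>tri a b c\<bar> \<le> (\<Sum>\<^sub>\<infinity>p. norm (triterm a b c p))"
    unfolding tri_def real_norm_def[symmetric] by (rule norm_infsum_bound[OF s])
  also have "\<dots> \<le> (\<Sum>\<^sub>\<infinity>(m,l). norm (a m) * (sqrt (ksq l) * norm (b l)) * norm (c (m + l)))"
    by (rule infsum_mono[OF s assms(1)]) (simp only: real_norm_def triterm_bound_pair)
  also have "\<dots> \<le> B" by fact
  finally show "\<bar>tri a b c\<bar> \<le> B" .
qed

lemma tri_bound_seq_l1:
  assumes "(\<lambda>k. norm (a k)) summable_on UNIV" "ell2 (\<lambda>k. sqrt (ksq k) * norm (b k))" "ell2 (\<lambda>k. norm (c k))"
  shows "triterm a b c summable_on UNIV" "\<bar>tri a b c\<bar> \<le> seq_l1 a * (seq_H1 b * seq_L2 c)"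
  using tri_boundI[OF young_sum[OF assms], unfolded seq_l1_def[symmetric] seq_H1_def[symmetric] seq_L2_def[symmetric]] by auto

text \<open>The counterpart of \<open>tri_bound_seq_l1\<close> with the absolute sum taken on the
  differentiated factor. It serves the terms in which the derivative falls on the low modes.\<close>

lemma tri_bound_seq_l1':
  assumes "ell2 (\<lambda>k. norm (a k))" "(\<lambda>k. sqrt (ksq k) * norm (b k)) summable_on UNIV" "ell2 (\<lambda>k. norm (c k))"
  shows "\<bar>tri a b c\<bar> \<le> (\<Sum>\<^sub>\<infinity>k. sqrt (ksq k) * norm (b k)) * (seq_L2 a * seq_L2 c)"
  using tri_boundI(2)[OF young_sum'[OF assms], unfolded seq_L2_def[symmetric]] by auto

text \<open>Poincare's inequality with constant 1: the zero mode vanishes and every other lattice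
  point has \<open>ksq k \<ge> 1\<close>.\<close>

lemma inH1_ell2:
  assumes "inH1 a"
  shows "ell2 (\<lambda>k. norm (a k))" "seq_L2 a \<le> seq_H1 a"
proof -
  have "norm (a k) \<le> sqrt (ksq k) * norm (a k)" for k
  proof (cases "k = 0")
    case True then show ?thesis using assms by (simp add: inH1_def solenoidal_def)
  next
    case False
    then have "1 \<le> sqrt (ksq k)" using ksq_ge_1 by simp
    then show ?thesis using mult_right_mono[of 1 "sqrt (ksq k)" "norm (a k)"] by simp
  qed
  with nrm2_mono[of "\<lambda>k. sqrt (ksq k) * norm (a k)" "\<lambda>k. norm (a k)"] assms
  show "ell2 (\<lambda>k. norm (a k))" "seq_L2 a \<le> seq_H1 a" unfolding inH1_def seq_L2_def seq_H1_def by auto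
qed

lemma triterm_summable:
  assumes "wiener_H1 a" "wiener_H1 b" "wiener_H1 c" shows "triterm a b c summable_on UNIV"
  by (rule tri_bound_seq_l1(1)) (use assms inH1_ell2 in \<open>auto simp: wiener_H1_def inH1_def\<close>)

lemma dotc_add: "(z *s (a + b)) \<bullet> (c::complex^2) = (z *s a) \<bullet> c + (z *s b) \<bullet> c"
  "((z + z') *s a) \<bullet> c = (z *s a) \<bullet> c + (z' *s a) \<bullet> c"
  by (simp_all add: inner_vec_def sum_2 algebra_simps inner_add_left)

lemma dotc_scaleR: "(z *s (r *\<^sub>R a)) \<bullet> (c::complex^2) = r * ((z *s a) \<bullet> c)"
  "((r *\<^sub>R z) *s a) \<bullet> c = r * ((z *s a) \<bullet> c)"
  by (simp_all add: inner_vec_def sum_2 inner_complex_def algebra_simps)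

lemma triterm_add:
  "triterm (\<lambda>k. a k + a' k) b c p = triterm a b c p + triterm a' b c p"
  "triterm a (\<lambda>k. b k + b' k) c p = triterm a b c p + triterm a b' c p"
  "triterm a b (\<lambda>k. c k + c' k) p = triterm a b c p + triterm a b c' p"
  unfolding triterm_def split_beta dotk_add(1) distrib_left dotc_add inner_add_right by (rule refl)+

lemma triterm_scaleR:
  "triterm (\<lambda>k. r *\<^sub>R a k) b c p = r * triterm a b c p"
  "triterm a (\<lambda>k. r *\<^sub>R b k) c p = r * triterm a b c p"
  "triterm a b (\<lambda>k. r *\<^sub>R c k) p = r * triterm a b c p"
  unfolding triterm_def split_beta dotk_scaleR mult_scaleR_right dotc_scaleR inner_scaleR_right by (rule refl)+

lemma tri_add:
  assumes "wiener_H1 a" "wiener_H1 b" "wiener_H1 c"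
  shows "wiener_H1 a' \<Longrightarrow> tri (\<lambda>k. a k + a' k) b c = tri a b c + tri a' b c"
    "wiener_H1 b' \<Longrightarrow> tri a (\<lambda>k. b k + b' k) c = tri a b c + tri a b' c"
    "wiener_H1 c' \<Longrightarrow> tri a b (\<lambda>k. c k + c' k) = tri a b c + tri a b c'"
  using assms unfolding tri_def triterm_add[abs_def]
  by (simp_all add: infsum_add triterm_summable)

lemma tri_scaleR:
  "tri (\<lambda>k. r *\<^sub>R a k) b c = r * tri a b c"
  "tri a (\<lambda>k. r *\<^sub>R b k) c = r * tri a b c"
  "tri a b (\<lambda>k. r *\<^sub>R c k) = r * tri a b c"
  unfolding tri_def triterm_scaleR[abs_def] by (rule infsum_cmult_right')+

lemma wiener_H1_add: assumes "wiener_H1 a" "wiener_H1 b" shows "wiener_H1 (\<lambda>k. a k + b k)"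
proof -
  have "ell2 (\<lambda>k. sqrt (ksq k) * norm (a k + b k))"
  proof (rule nrm2_triangle(1)[of "\<lambda>k. sqrt (ksq k) * norm (a k)" "\<lambda>k. sqrt (ksq k) * norm (b k)"])
    show "\<bar>sqrt (ksq k) * norm (a k + b k)\<bar> \<le> \<bar>sqrt (ksq k) * norm (a k)\<bar> + \<bar>sqrt (ksq k) * norm (b k)\<bar>" for k
      using mult_left_mono[OF norm_triangle_ineq[of "a k" "b k"], of "sqrt (ksq k)"] by (simp add: distrib_left)
  qed (use assms in \<open>auto simp: wiener_H1_def inH1_def\<close>)
  moreover have "(\<lambda>k. norm (a k + b k)) summable_on UNIV"
  proof (rule summable_on_comparison_test)
    show "(\<lambda>k. norm (a k) + norm (b k)) summable_on UNIV"
      using assms by (intro summable_on_add) (auto simp: wiener_H1_def)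
  qed (auto intro: norm_triangle_ineq)
  ultimately show ?thesis using assms by (auto simp: wiener_H1_def inH1_def solenoidal_def dotk_add)
qed

lemma wiener_H1_scaleR: assumes "wiener_H1 a" shows "wiener_H1 (\<lambda>k. r *\<^sub>R a k)"
proof -
  have "ell2 (\<lambda>k. sqrt (ksq k) * norm (r *\<^sub>R a k))"
    using assms nrm2_cmult(1)[of "\<lambda>k. sqrt (ksq k) * norm (a k)" "\<bar>r\<bar>"]
    by (simp add: wiener_H1_def inH1_def mult_ac)
  moreover have "(\<lambda>k. norm (r *\<^sub>R a k)) summable_on UNIV"
    using assms by (auto simp: wiener_H1_def intro: summable_on_cmult_right)
  ultimately show ?thesis using assms by (auto simp: wiener_H1_def inH1_def solenoidal_def dotk_scaleR)
qed

text \<open>The substitution exchanges the wavenumbers \<open>l\<close> and \<open>m + l\<close> of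
  the last two slots. Zero divergence removes the component of the transport factor along
  \<open>m\<close>, reality replaces \<open>a (- m)\<close> by a conjugate, and conjugating the
  imaginary unit produces the sign.\<close>

lemma triterm_antisym:
  assumes "solenoidal a" "solenoidal b" "solenoidal c"
  shows "triterm a b c (- m, m + l) = - triterm a c b (m, l)"
proof -
  have d: "dotk (a (- m)) (m + l) = cnj (dotk (a m) l)"
  proof -
    have "dotk (a (- m)) m = 0"
      using solenoidal_dotk[OF assms(1), of "-m"] dotk_minus(1)[of "a (-m)" "-m"] by simp
    moreover have "dotk (a (- m)) l = cnj (dotk (a m) l)"
      using solenoidal_cnj[OF assms(1)] by (simp add: dotk_def sum_2 kc_def)
    ultimately show ?thesis by (simp add: dotk_add)
  qed
  show ?thesis
    unfolding triterm_def prod.case d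
    by (simp add: inner_vec_def sum_2 inner_complex_def algebra_simps)
qed

lemma tri_antisym:
  assumes "wiener_H1 a" "wiener_H1 b" "wiener_H1 c"
  shows "tri a b c = - tri a c b"
proof -
  define j where "j = (\<lambda>(m,l). (- m, m + l) :: (int \<times> int) \<times> (int \<times> int))"
  have b: "bij_betw j UNIV UNIV" by (rule bij_betwI[of _ _ _ j]) (auto simp: j_def)
  have "tri a b c = infsum (\<lambda>p. triterm a b c (j p)) UNIV"
    unfolding tri_def by (rule infsum_reindex_bij_betw[OF b, symmetric])
  also have "(\<lambda>p. triterm a b c (j p)) = (\<lambda>p. - triterm a c b p)"
    using assms unfolding j_def wiener_H1_def inH1_def
    by (intro ext) (simp only: split_beta triterm_antisym prod.collapse)
  also have "infsum \<dots> UNIV = - tri a c b"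
    unfolding tri_def by (rule infsum_uminus)
  finally show ?thesis .
qed

lemma tri_same: "wiener_H1 a \<Longrightarrow> wiener_H1 b \<Longrightarrow> tri a b b = 0"
  using tri_antisym[of a b b] by simp

section \<open>The nonlinearity mode by mode\<close>

definition conv :: "cseq \<Rightarrow> cseq \<Rightarrow> cseq" where
  "conv a b k = (\<Sum>\<^sub>\<infinity>l. (\<i> * dotk (a (k - l)) l) *s b l)"

lemma convc_eq_conv: "convc u v k = conv (fc u) (fc v) k"
  unfolding convc_def conv_def dotk_def vector_scalar_mult_def minus_prod_def by simp

text \<open>Reindexing by \<open>k = m + l\<close> turns the double sum of \<open>tri\<close> into a
  sum over modes. The absolute versions are what dominates the nonlinearity when the energy balance
  is summed over modes.\<close>

lemma conv_inner:
  assumes a: "wiener_H1 a" and b: "wiener_H1 b" and c: "wiener_H1 c"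
  shows "(\<lambda>k. conv a b k \<bullet> c k) summable_on UNIV" "(\<Sum>\<^sub>\<infinity>k. conv a b k \<bullet> c k) = tri a b c"
    "(\<lambda>k. \<bar>conv a b k \<bullet> c k\<bar>) summable_on UNIV" "(\<Sum>\<^sub>\<infinity>k. \<bar>conv a b k \<bullet> c k\<bar>) \<le> seq_l1 a * (seq_H1 b * seq_L2 c)"
proof -
  define j where "j = (\<lambda>(k,l). (k - l, l) :: (int \<times> int) \<times> (int \<times> int))"
  have bj: "bij_betw j UNIV UNIV" by (rule bij_betwI[of _ _ _ "\<lambda>(m,l). (m + l, l)"]) (auto simp: j_def)
  have bj': "bij_betw j (UNIV \<times> UNIV) UNIV" using bj by simp
  have ea: "ell2 (\<lambda>k. norm (a k))" and eb: "ell2 (\<lambda>k. sqrt (ksq k) * norm (b k))"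
    and ec: "ell2 (\<lambda>k. norm (c k))" and sa: "(\<lambda>k. norm (a k)) summable_on UNIV"
    using a b c inH1_ell2 by (auto simp: wiener_H1_def inH1_def)
  define f where "f = (\<lambda>k l. triterm a b c (k - l, l))"
  have s: "(\<lambda>(k,l). f k l) summable_on UNIV \<times> UNIV"
    using triterm_summable[OF a b c] summable_on_reindex_bij_betw[OF bj', of "triterm a b c"]
    by (simp add: j_def f_def case_prod_unfold)
  have inner: "conv a b k \<bullet> c k = (\<Sum>\<^sub>\<infinity>l. f k l)" for k
  proof -
    have "(\<lambda>l. (\<i> * dotk (a (k - l)) l) *s b l) summable_on UNIV"
    proof (rule abs_summable_summable, rule summable_on_comparison_test)
      have bk: "bij_betw (\<lambda>l. k - l) UNIV (UNIV :: (int \<times> int) set)" by (rule bij_betwI[of _ _ _ "\<lambda>l. k - l"]) auto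
      have "ell2 (\<lambda>l. norm (a (k - l)))"
        using ea summable_on_reindex_bij_betw[OF bk, of "\<lambda>l. (norm (a l))^2"] by (simp add: ell2_def)
      then show "(\<lambda>l. \<bar>norm (a (k - l))\<bar> * \<bar>sqrt (ksq l) * norm (b l)\<bar>) summable_on UNIV"
        using eb by (rule cauchy_schwarz_ell2(1))
      show "norm ((\<i> * dotk (a (k - l)) l) *s b l) \<le> \<bar>norm (a (k - l))\<bar> * \<bar>sqrt (ksq l) * norm (b l)\<bar>" for l
        using mult_right_mono[OF norm_dotk[of "a (k - l)" l], of "norm (b l)"]
        by (simp add: norm_vector_smult norm_mult mult.assoc)
    qed auto
    then have "((\<lambda>l. ((\<i> * dotk (a (k - l)) l) *s b l) \<bullet> c k) has_sum (conv a b k \<bullet> c k)) UNIV"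
      unfolding conv_def by (intro has_sum_bounded_linear[OF bounded_linear_inner_left] has_sum_infsum)
    then show ?thesis unfolding f_def triterm_def by (simp add: infsumI)
  qed
  have sabs: "(\<lambda>p. norm (case p of (k,l) \<Rightarrow> f k l)) summable_on UNIV \<times> UNIV"
    by (rule summable_on_iff_abs_summable_on_real[THEN iffD1, OF s])
  show "(\<Sum>\<^sub>\<infinity>k. conv a b k \<bullet> c k) = tri a b c"
  proof -
    have "(\<Sum>\<^sub>\<infinity>k. conv a b k \<bullet> c k) = infsum (\<lambda>(k,l). f k l) (UNIV \<times> UNIV)"
      unfolding inner using infsum_Sigma_banach[OF s] by simp
    also have "\<dots> = tri a b c"
      using infsum_reindex_bij_betw[OF bj', of "triterm a b c"]
      by (simp add: tri_def j_def f_def case_prod_unfold)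
    finally show ?thesis .
  qed
  \<comment> \<open>Row sums of absolute values: each dominates the pairing in mode
    \<open>k\<close>, and together they give back the absolute double sum.\<close>
  define x where "x = (\<lambda>k. \<Sum>\<^sub>\<infinity>l. \<bar>f k l\<bar>)"
  have sx: "x summable_on UNIV" and sf: "\<And>k. (\<lambda>l. \<bar>f k l\<bar>) summable_on UNIV"
  proof -
    note S = Infinite_Sum.abs_summable_on_Sigma_iff[where f="\<lambda>(k,l). f k l" and A=UNIV and B="\<lambda>_. UNIV", THEN iffD1, OF sabs]
    have "(\<lambda>k. norm (x k)) summable_on UNIV" unfolding x_def using conjunct2[OF S] by simp
    moreover have "(\<lambda>l. \<bar>f k l\<bar>) summable_on UNIV" for k
      using bspec[OF conjunct1[OF S] UNIV_I, of k] by simp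
    moreover have "norm (x k) = x k" for k unfolding x_def by (simp add: infsum_nonneg)
    ultimately show "x summable_on UNIV" "\<And>k. (\<lambda>l. \<bar>f k l\<bar>) summable_on UNIV" by auto
  qed
  have le: "\<bar>conv a b k \<bullet> c k\<bar> \<le> x k" for k
    unfolding inner x_def using norm_infsum_bound[of "f k" UNIV] sf[of k] by simp
  show sc: "(\<lambda>k. \<bar>conv a b k \<bullet> c k\<bar>) summable_on UNIV"
    by (rule summable_on_comparison_test[OF sx]) (use le in auto)
  then show "(\<lambda>k. conv a b k \<bullet> c k) summable_on UNIV"
    using summable_on_iff_abs_summable_on_real by auto
  have "(\<Sum>\<^sub>\<infinity>k. \<bar>conv a b k \<bullet> c k\<bar>) \<le> infsum x UNIV"
    by (rule infsum_mono[OF sc sx]) (use le in auto)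
  also have "\<dots> = infsum (\<lambda>p. \<bar>case p of (k,l) \<Rightarrow> f k l\<bar>) (UNIV \<times> UNIV)"
    unfolding x_def using infsum_Sigma_banach[OF sabs[unfolded real_norm_def]] by simp
  also have "\<dots> = infsum (\<lambda>p. \<bar>triterm a b c p\<bar>) UNIV"
    using infsum_reindex_bij_betw[OF bj', of "\<lambda>p. \<bar>triterm a b c p\<bar>"]
    by (simp add: j_def f_def case_prod_unfold)
  also have "\<dots> \<le> (\<Sum>\<^sub>\<infinity>(m,l). norm (a m) * (sqrt (ksq l) * norm (b l)) * norm (c (m + l)))"
  proof (rule infsum_mono)
    show "(\<lambda>p. \<bar>triterm a b c p\<bar>) summable_on UNIV"
      using triterm_summable[OF a b c] summable_on_iff_abs_summable_on_real[of "triterm a b c" UNIV] by simp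
    show "(\<lambda>(m,l). norm (a m) * (sqrt (ksq l) * norm (b l)) * norm (c (m + l))) summable_on UNIV"
      using young_sum(1)[OF sa eb ec] by simp
  qed (simp only: triterm_bound_pair)
  also have "\<dots> \<le> seq_l1 a * (seq_H1 b * seq_L2 c)"
    using young_sum(2)[OF sa eb ec] by (simp add: seq_l1_def seq_H1_def seq_L2_def)
  finally show "(\<Sum>\<^sub>\<infinity>k. \<bar>conv a b k \<bullet> c k\<bar>) \<le> seq_l1 a * (seq_H1 b * seq_L2 c)" .
qed

text \<open>The Leray projection subtracts a multiple of \<open>kc k\<close>, which is orthogonal to
  the coefficient of a divergence-free field.\<close>

lemma Bc_inner:
  assumes "solenoidal c"
  shows "Bc u v k \<bullet> c k = conv (fc u) (fc v) k \<bullet> c k"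
proof (cases "k = (0,0)")
  case True
  then show ?thesis using assms by (simp add: solenoidal_def zero_prod_def)
next
  case False
  define w where "w = conv (fc u) (fc v) k"
  define z where "z = (\<Sum>j\<in>UNIV. kc k $ j * w $ j) / complex_of_real (ksq k)"
  have e: "lerayc k w = w - z *s kc k"
    using False by (auto simp: lerayc_def z_def vec_eq_iff)
  have "(z *s kc k) \<bullet> c k = Re (z * cnj (dotk (c k) k))"
    by (simp add: inner_vec_def sum_2 inner_complex_def dotk_def kc_def algebra_simps)
  also have "\<dots> = 0" using solenoidal_dotk[OF assms] by simp
  finally show ?thesis
    unfolding Bc_def convc_eq_conv w_def[symmetric] e by (simp add: inner_diff_left)
qed

section \<open>Absolutely continuous functions and Gronwall estimates\<close>

text \<open>Local absolute continuity on \<open>[a, \<infinity>)\<close>, expressed through the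
  density rather than through a derivative almost everywhere. Differential inequalities become
  pointwise inequalities for \<open>f\<close> off a null set.\<close>

definition primitive_from :: "real \<Rightarrow> (real \<Rightarrow> real) \<Rightarrow> (real \<Rightarrow> real) \<Rightarrow> bool" where
  "primitive_from a x f \<longleftrightarrow> (\<forall>t\<ge>a. set_integrable lborel {a..t} f \<and>
     x t = x a + (LINT s:{a..t}|lborel. f s))"

lemma primitive_fromD:
  assumes "primitive_from a x f" "a \<le> t"
  shows "set_integrable lborel {a..t} f" "x t = x a + (LINT s:{a..t}|lborel. f s)"
proof -
  have "set_integrable lborel {a..t} f \<and> x t = x a + (LINT s:{a..t}|lborel. f s)"
    using assms(1)[unfolded primitive_from_def, rule_format, OF assms(2)] .
  then show "set_integrable lborel {a..t} f" "x t = x a + (LINT s:{a..t}|lborel. f s)"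
    by (rule conjunct1, rule conjunct2)
qed

lemma primitive_from_diff:
  assumes "primitive_from a x f" "a \<le> s" "s \<le> t"
  shows "set_integrable lborel {s..t} f" "x t - x s = (LINT r:{s..t}|lborel. f r)"
proof -
  have it: "set_integrable lborel {a..t} f" and si: "set_integrable lborel {a..s} f"
    and xt: "x t = x a + (LINT s:{a..t}|lborel. f s)" and xs: "x s = x a + (LINT s:{a..s}|lborel. f s)"
    using primitive_fromD[OF assms(1)] assms(2,3) order_trans by blast+
  show st: "set_integrable lborel {s..t} f"
    by (rule set_integrable_subset[OF it]) (use assms in auto)
  have "integral {a..s} f + integral {s..t} f = integral {a..t} f"
    using set_borel_integral_eq_integral(1)[OF it] assms
    by (intro Henstock_Kurzweil_Integration.integral_combine) auto
  then show "x t - x s = (LINT r:{s..t}|lborel. f r)"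
    using xt xs it si st by (simp add: set_borel_integral_eq_integral)
qed

lemma primitive_from_later:
  assumes "primitive_from a x f" "a \<le> b"
  shows "primitive_from b x f"
  unfolding primitive_from_def
proof (intro allI impI conjI)
  fix t assume t: "b \<le> t"
  show "set_integrable lborel {b..t} f" "x t = x b + (LINT s:{b..t}|lborel. f s)"
    using primitive_from_diff[OF assms t] by auto
qed

lemma primitive_from_continuous:
  assumes "primitive_from a x f"
  shows "continuous_on {a..b} x"
proof (cases "a \<le> b")
  case True
  have it: "set_integrable lborel {a..t} f" if "t \<ge> a" for t
    using primitive_fromD(1)[OF assms that] .
  have "continuous_on {a..b} (\<lambda>t. x a + integral {a..t} f)"
    using set_borel_integral_eq_integral(1)[OF it[OF True]]
    by (intro continuous_intros indefinite_integral_continuous_1)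
  moreover have "x a + integral {a..t} f = x t" if "t \<in> {a..b}" for t
    using that primitive_fromD(2)[OF assms, of t] set_borel_integral_eq_integral(2)[OF it, of t] by simp
  ultimately show ?thesis
    by (rule continuous_on_eq)
qed auto

lemma primitive_from_const: "primitive_from a (\<lambda>_. c) (\<lambda>_. 0)"
  unfolding primitive_from_def set_integrable_def set_lebesgue_integral_def by simp

lemma primitive_from_add:
  assumes "primitive_from a x f" "primitive_from a y g"
  shows "primitive_from a (\<lambda>t. x t + y t) (\<lambda>t. f t + g t)"
  unfolding primitive_from_def
proof (intro allI impI conjI)
  fix t assume t: "a \<le> t"
  note D = primitive_fromD[OF assms(1) t] primitive_fromD[OF assms(2) t]
  show "set_integrable lborel {a..t} (\<lambda>t. f t + g t)"
    using D by (intro set_integral_add)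
  show "x t + y t = x a + y a + (LINT s:{a..t}|lborel. f s + g s)"
    using D by (subst set_integral_add) linarith+
qed

lemma primitive_from_cmult:
  assumes "primitive_from a x f"
  shows "primitive_from a (\<lambda>t. c * x t) (\<lambda>t. c * f t)"
  unfolding primitive_from_def
proof (intro allI impI conjI)
  fix t assume t: "a \<le> t"
  note D = primitive_fromD[OF assms t]
  show "set_integrable lborel {a..t} (\<lambda>t. c * f t)"
    using D by simp
  show "c * x t = c * x a + (LINT s:{a..t}|lborel. c * f s)"
    by (subst D(2)) (simp add: algebra_simps)
qed

lemma primitive_from_sum:
  assumes "finite I" "\<And>i. i \<in> I \<Longrightarrow> primitive_from a (x i) (f i)"
  shows "primitive_from a (\<lambda>t. \<Sum>i\<in>I. x i t) (\<lambda>t. \<Sum>i\<in>I. f i t)"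
  using assms
proof (induction I)
  case (insert i I)
  then show ?case using primitive_from_add[of a "x i" "f i" "\<lambda>t. \<Sum>i\<in>I. x i t" "\<lambda>t. \<Sum>i\<in>I. f i t"] by simp
qed (simp add: primitive_from_const)

lemma set_integrable_mult_continuous:
  fixes f x :: "real \<Rightarrow> real"
  assumes "set_integrable lborel {a..b} f" "continuous_on {a..b} x"
  shows "set_integrable lborel {a..b} (\<lambda>t. f t * x t)"
proof -
  have "bounded (x ` {a..b})"
    using assms(2) by (intro compact_imp_bounded compact_continuous_image) auto
  then obtain B where B: "\<And>t. t \<in> {a..b} \<Longrightarrow> \<bar>x t\<bar> \<le> B"
    unfolding bounded_iff by (metis imageI real_norm_def)
  have "set_borel_measurable lborel {a..b} x"
    using borel_measurable_continuous_on_indicator[OF _ assms(2)]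
    unfolding set_borel_measurable_def by simp
  then have "(\<lambda>t. (indicator {a..b} t *\<^sub>R f t) * (indicator {a..b} t *\<^sub>R x t)) \<in> borel_measurable lborel"
    using assms(1) unfolding set_borel_measurable_def set_integrable_def
    by (intro borel_measurable_times) auto
  then have m: "(\<lambda>t. indicator {a..b} t *\<^sub>R (f t * x t)) \<in> borel_measurable lborel"
    by (rule measurable_cong[THEN iffD1, rotated]) (auto simp: indicator_def)
  have "integrable lborel (\<lambda>t. B * (indicator {a..b} t *\<^sub>R f t))"
    using assms(1) unfolding set_integrable_def by auto
  then have "integrable lborel (\<lambda>t. indicator {a..b} t *\<^sub>R (f t * x t))"
  proof (rule Bochner_Integration.integrable_bound[OF _ m], intro AE_I2)
    fix t
    show "norm (indicator {a..b} t *\<^sub>R (f t * x t)) \<le> norm (B * (indicator {a..b} t *\<^sub>R f t))"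
      using B[of t] by (auto simp: indicator_def abs_mult mult.commute[of _ "\<bar>x t\<bar>"] intro!: mult_right_mono)
  qed
  then show ?thesis unfolding set_integrable_def .
qed

text \<open>The plane splits into the half \<open>r \<le> s\<close> and the half
  \<open>s < r\<close>, and Fubini is applied on each. This is integration by parts for densities
  that are merely integrable.\<close>

lemma triangle_fubini:
  fixes F G :: "real \<Rightarrow> real"
  assumes F: "integrable lborel F" and G: "integrable lborel G"
  shows "(\<integral>s. F s * (\<integral>r. indicator {..s} r * G r \<partial>lborel) \<partial>lborel)
       + (\<integral>r. G r * (\<integral>s. indicator {..r} s * F s \<partial>lborel) \<partial>lborel)
       = (\<integral>s. F s \<partial>lborel) * (\<integral>r. G r \<partial>lborel)"
proof -
  have [measurable]: "F \<in> borel_measurable borel" "G \<in> borel_measurable borel"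
    using F G by auto
  have FG: "integrable (lborel \<Otimes>\<^sub>M lborel) (\<lambda>(s,r). F s * G r)"
    using F G by (intro lborel_pair.Fubini_integrable) (auto simp: abs_mult)
  have I1: "integrable (lborel \<Otimes>\<^sub>M lborel) (\<lambda>(s,r). indicator {..s} r * (F s * G r))"
    by (rule Bochner_Integration.integrable_bound[OF FG])
       (auto simp: split_beta' indicator_def)
  have I2: "integrable (lborel \<Otimes>\<^sub>M lborel) (\<lambda>(s,r). indicator {..<r} s * (F s * G r))"
    by (rule Bochner_Integration.integrable_bound[OF FG])
       (auto simp: split_beta' indicator_def)
  \<comment> \<open>The diagonal belongs to only one of the two halves; the single point by which
    the half-lines differ is null.\<close>
  have h: "(\<integral>s. indicator {..r} s * F s \<partial>lborel) = (\<integral>s. indicator {..<r} s * F s \<partial>lborel)" for r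
    using AE_lborel_singleton[of r] by (intro integral_cong_AE) (auto simp: indicator_def elim!: eventually_mono)
  have A: "(\<integral>s. F s * (\<integral>r. indicator {..s} r * G r \<partial>lborel) \<partial>lborel)
      = (\<integral>(s,r). indicator {..s} r * (F s * G r) \<partial>(lborel \<Otimes>\<^sub>M lborel))"
    using lborel_pair.integral_fst'[OF I1] by (simp add: mult.left_commute)
  have B: "(\<integral>r. G r * (\<integral>s. indicator {..r} s * F s \<partial>lborel) \<partial>lborel)
      = (\<integral>(s,r). indicator {..<r} s * (F s * G r) \<partial>(lborel \<Otimes>\<^sub>M lborel))"
  proof -
    have "(\<integral>r. \<integral>s. indicator {..<r} s * (F s * G r) \<partial>lborel \<partial>lborel)
      = (\<integral>r. G r * (\<integral>s. indicator {..<r} s * F s \<partial>lborel) \<partial>lborel)"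
      by (intro Bochner_Integration.integral_cong refl, subst integral_mult_right_zero[symmetric])
         (simp add: mult_ac)
    then show ?thesis unfolding h using lborel_pair.integral_snd[OF I2] by simp
  qed
  have "(\<integral>s. F s \<partial>lborel) * (\<integral>r. G r \<partial>lborel) = (\<integral>(s,r). F s * G r \<partial>(lborel \<Otimes>\<^sub>M lborel))"
    using lborel_pair.integral_fst'[OF FG] by simp
  also have "\<dots> = (\<integral>p. (case p of (s,r) \<Rightarrow> indicator {..s} r * (F s * G r)) +
      (case p of (s,r) \<Rightarrow> indicator {..<r} s * (F s * G r)) \<partial>(lborel \<Otimes>\<^sub>M lborel))"
    by (intro Bochner_Integration.integral_cong) (auto simp: indicator_def)
  also have "\<dots> = (\<integral>(s,r). indicator {..s} r * (F s * G r) \<partial>(lborel \<Otimes>\<^sub>M lborel)) +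
      (\<integral>(s,r). indicator {..<r} s * (F s * G r) \<partial>(lborel \<Otimes>\<^sub>M lborel))"
    by (rule Bochner_Integration.integral_add[OF I1 I2])
  finally show ?thesis unfolding A B by simp
qed

text \<open>The product rule is \<open>triangle_fubini\<close> for the two densities cut off outside
  \<open>[a, t]\<close>, whose inner integrals are the increments of the two functions.\<close>

lemma primitive_from_mult:
  assumes x: "primitive_from a x f" and y: "primitive_from a y g"
  shows "primitive_from a (\<lambda>t. x t * y t) (\<lambda>t. f t * y t + g t * x t)"
  unfolding primitive_from_def
proof (intro allI impI conjI)
  fix t assume t: "a \<le> t"
  define F where "F = (\<lambda>s. indicator {a..t} s *\<^sub>R f s)"
  define G where "G = (\<lambda>s. indicator {a..t} s *\<^sub>R g s)"
  have F: "integrable lborel F" and G: "integrable lborel G"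
    using primitive_fromD(1)[OF x t] primitive_fromD(1)[OF y t] unfolding set_integrable_def F_def G_def by auto
  have fy: "set_integrable lborel {a..t} (\<lambda>s. f s * y s)"
    by (rule set_integrable_mult_continuous[OF primitive_fromD(1)[OF x t] primitive_from_continuous[OF y]])
  have gx: "set_integrable lborel {a..t} (\<lambda>s. g s * x s)"
    by (rule set_integrable_mult_continuous[OF primitive_fromD(1)[OF y t] primitive_from_continuous[OF x]])
  show "set_integrable lborel {a..t} (\<lambda>s. f s * y s + g s * x s)"
    using fy gx by (rule set_integral_add)
  have iG: "(\<integral>r. indicator {..s} r * G r \<partial>lborel) = y s - y a" if "s \<in> {a..t}" for s
  proof -
    have "(\<integral>r. indicator {..s} r * G r \<partial>lborel) = (LINT r:{a..s}|lborel. g r)"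
      unfolding set_lebesgue_integral_def G_def using that
      by (intro Bochner_Integration.integral_cong) (auto simp: indicator_def)
    then show ?thesis using primitive_fromD(2)[OF y, of s] that by simp
  qed
  have iF: "(\<integral>r. indicator {..s} r * F r \<partial>lborel) = x s - x a" if "s \<in> {a..t}" for s
  proof -
    have "(\<integral>r. indicator {..s} r * F r \<partial>lborel) = (LINT r:{a..s}|lborel. f r)"
      unfolding set_lebesgue_integral_def F_def using that
      by (intro Bochner_Integration.integral_cong) (auto simp: indicator_def)
    then show ?thesis using primitive_fromD(2)[OF x, of s] that by simp
  qed
  have F1: "(\<integral>s. F s \<partial>lborel) = x t - x a" and G1: "(\<integral>s. G s \<partial>lborel) = y t - y a"
    using primitive_fromD(2)[OF x t] primitive_fromD(2)[OF y t] unfolding set_lebesgue_integral_def F_def G_def by auto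
  have "(\<integral>s. F s * (\<integral>r. indicator {..s} r * G r \<partial>lborel) \<partial>lborel)
      = (\<integral>s. indicator {a..t} s *\<^sub>R (f s * y s) - y a * F s \<partial>lborel)"
    by (intro Bochner_Integration.integral_cong refl, case_tac "x \<in> {a..t}")
       (simp_all add: iG, simp_all add: F_def algebra_simps)
  also have "\<dots> = (LINT s:{a..t}|lborel. f s * y s) - y a * (x t - x a)"
    using fy F F1 unfolding set_integrable_def set_lebesgue_integral_def
    by (subst Bochner_Integration.integral_diff) auto
  finally have e1: "(\<integral>s. F s * (\<integral>r. indicator {..s} r * G r \<partial>lborel) \<partial>lborel)
      = (LINT s:{a..t}|lborel. f s * y s) - y a * (x t - x a)" .
  have "(\<integral>s. G s * (\<integral>r. indicator {..s} r * F r \<partial>lborel) \<partial>lborel)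
      = (\<integral>s. indicator {a..t} s *\<^sub>R (g s * x s) - x a * G s \<partial>lborel)"
    by (intro Bochner_Integration.integral_cong refl, case_tac "xa \<in> {a..t}")
       (simp_all add: iF, simp_all add: G_def algebra_simps)
  also have "\<dots> = (LINT s:{a..t}|lborel. g s * x s) - x a * (y t - y a)"
    using gx G G1 unfolding set_integrable_def set_lebesgue_integral_def
    by (subst Bochner_Integration.integral_diff) auto
  finally have e2: "(\<integral>s. G s * (\<integral>r. indicator {..s} r * F r \<partial>lborel) \<partial>lborel)
      = (LINT s:{a..t}|lborel. g s * x s) - x a * (y t - y a)" .
  show "x t * y t = x a * y a + (LINT s:{a..t}|lborel. f s * y s + g s * x s)"
    using triangle_fubini[OF F G] unfolding e1 e2 F1 G1 set_integral_add(2)[OF fy gx]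
    by (simp add: algebra_simps)
qed

text \<open>The chain rule for the exponential follows from the product rule alone: powers by
  induction, then the series term by term under the dominating function
  \<open>\<bar>f s * exp \<bar>A s\<bar>\<bar>\<close>. The normalization \<open>A a = 0\<close>
  makes all positive powers vanish at the left end.\<close>

lemma primitive_from_exp:
  assumes A: "primitive_from a A f" and A0: "A a = 0"
  shows "primitive_from a (\<lambda>t. exp (A t)) (\<lambda>t. exp (A t) * f t)"
proof -
  have pow: "primitive_from a (\<lambda>t. A t ^ Suc n) (\<lambda>t. of_nat (Suc n) * (A t ^ n * f t))" for n
  proof (induction n)
    case (Suc n)
    show ?case
      using primitive_from_mult[OF A Suc] by (simp add: algebra_simps)
  qed (use A in auto)
  have powi: "primitive_from a (\<lambda>t. A t ^ Suc n / fact (Suc n)) (\<lambda>t. A t ^ n / fact n * f t)" for n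
    using primitive_from_cmult[OF pow, of "inverse (fact (Suc n))" n]
    by (simp add: field_simps del: of_nat_Suc power_Suc)
  show ?thesis unfolding primitive_from_def
  proof (intro allI impI conjI)
    fix t assume t: "a \<le> t"
    have f: "set_integrable lborel {a..t} f" using primitive_fromD(1)[OF A t] .
    have cA: "continuous_on {a..t} A" using A by (rule primitive_from_continuous)
    show "set_integrable lborel {a..t} (\<lambda>t. exp (A t) * f t)"
      using set_integrable_mult_continuous[OF f, of "\<lambda>t. exp (A t)"] cA
      by (simp add: mult.commute continuous_intros)
    have fe: "set_integrable lborel {a..t} (\<lambda>s. f s * exp \<bar>A s\<bar>)"
      by (intro set_integrable_mult_continuous f continuous_intros cA)
    \<comment> \<open>The density of \<open>A t ^ Suc n / fact (Suc n)\<close>, cut off outside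
      \<open>[a, t]\<close>.\<close>
    define u where "u = (\<lambda>n s. indicator {a..t} s *\<^sub>R (A s ^ n / fact n * f s))"
    have ui: "integrable lborel (u n)" for n
      using primitive_fromD(1)[OF powi t] unfolding set_integrable_def u_def .
    have uI: "integral\<^sup>L lborel (u n) = A t ^ Suc n / fact (Suc n)" for n
      using primitive_fromD(2)[OF powi t, of n] A0 unfolding set_lebesgue_integral_def u_def by simp
    have "(\<lambda>n. integral\<^sup>L lborel (\<lambda>s. \<Sum>i<n. u i s)) \<longlonglongrightarrow> integral\<^sup>L lborel (\<lambda>s. indicator {a..t} s *\<^sub>R (exp (A s) * f s))"
    proof (rule integral_dominated_convergence[where w="\<lambda>s. \<bar>indicator {a..t} s *\<^sub>R (f s * exp \<bar>A s\<bar>)\<bar>"])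
      show "integrable lborel (\<lambda>s. \<bar>indicator {a..t} s *\<^sub>R (f s * exp \<bar>A s\<bar>)\<bar>)"
        using fe unfolding set_integrable_def by auto
      show "(\<lambda>s. indicator {a..t} s *\<^sub>R (exp (A s) * f s)) \<in> borel_measurable lborel"
        using \<open>set_integrable lborel {a..t} (\<lambda>t. exp (A t) * f t)\<close> unfolding set_integrable_def by auto
      show "(\<lambda>s. \<Sum>i<n. u i s) \<in> borel_measurable lborel" for n
        using ui by auto
      have E: "(\<lambda>n. A s ^ n / fact n) sums exp (A s)" "(\<lambda>n. \<bar>A s\<bar> ^ n / fact n) sums exp \<bar>A s\<bar>" for s
        using exp_converges[of "A s"] exp_converges[of "\<bar>A s\<bar>"] by (simp_all add: divide_inverse mult.commute)
      have S: "(\<Sum>i<n. u i s) = indicator {a..t} s * f s * (\<Sum>i<n. A s ^ i / fact i)" for n s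
        unfolding u_def by (simp add: sum_distrib_left sum_distrib_right mult_ac)
      show "AE s in lborel. (\<lambda>n. \<Sum>i<n. u i s) \<longlonglongrightarrow> indicator {a..t} s *\<^sub>R (exp (A s) * f s)"
      proof (intro AE_I2)
        fix s
        have "(\<lambda>n. indicator {a..t} s * f s * (\<Sum>i<n. A s ^ i / fact i)) \<longlonglongrightarrow> indicator {a..t} s * f s * exp (A s)"
          using E(1)[of s] unfolding sums_def by (intro tendsto_intros)
        then show "(\<lambda>n. \<Sum>i<n. u i s) \<longlonglongrightarrow> indicator {a..t} s *\<^sub>R (exp (A s) * f s)"
          unfolding S by (simp add: mult_ac)
      qed
      show "AE s in lborel. norm (\<Sum>i<n. u i s) \<le> \<bar>indicator {a..t} s *\<^sub>R (f s * exp \<bar>A s\<bar>)\<bar>" for n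
      proof (intro AE_I2)
        fix s
        have "\<bar>\<Sum>i<n. A s ^ i / fact i\<bar> \<le> (\<Sum>i<n. \<bar>A s\<bar> ^ i / fact i)"
          by (rule order_trans[OF sum_abs]) (simp add: power_abs)
        also have "\<dots> \<le> exp \<bar>A s\<bar>"
          unfolding sums_unique[OF E(2)]
          by (rule sum_le_suminf[OF sums_summable[OF E(2)]]) auto
        finally show "norm (\<Sum>i<n. u i s) \<le> \<bar>indicator {a..t} s *\<^sub>R (f s * exp \<bar>A s\<bar>)\<bar>"
          unfolding S by (auto simp: abs_mult indicator_def mult_left_mono)
      qed
    qed
    \<comment> \<open>The primitives start with the linear term, so \<open>n\<close> of them make up
      the first \<open>n + 1\<close> terms of the exponential series without the constant 1.\<close>
    moreover have "integral\<^sup>L lborel (\<lambda>s. \<Sum>i<n. u i s) = (\<Sum>i<Suc n. A t ^ i / fact i) - 1" for n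
      by (subst Bochner_Integration.integral_sum) (auto simp: ui uI sum.lessThan_Suc_shift simp del: sum.lessThan_Suc)
    moreover have "(\<lambda>n. (\<Sum>i<Suc n. A t ^ i / fact i) - 1) \<longlonglongrightarrow> exp (A t) - 1"
      using LIMSEQ_Suc[of "\<lambda>n. \<Sum>i<n. A t ^ i / fact i"] exp_converges[of "A t"]
      by (intro tendsto_intros) (simp_all add: divide_inverse mult.commute sums_def del: sum.lessThan_Suc)
    ultimately have "integral\<^sup>L lborel (\<lambda>s. indicator {a..t} s *\<^sub>R (exp (A s) * f s)) = exp (A t) - 1"
      using LIMSEQ_unique by auto
    then show "exp (A t) = exp (A a) + (LINT s:{a..t}|lborel. exp (A s) * f s)"
      unfolding set_lebesgue_integral_def A0 by simp
  qed
qed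

text \<open>Multiplication by the integrating factor \<open>exp (A t)\<close> removes
  \<open>b\<close>. No sign of \<open>b\<close> at individual times is assumed: its integrals have
  to grow at rate \<open>\<alpha>\<close> only up to the defect \<open>K\<close>, and this defect
  costs the factor \<open>exp K\<close>.\<close>

lemma gronwall_bound:
  assumes y: "primitive_from t0 y h"
    and b: "\<And>t. t \<ge> t0 \<Longrightarrow> set_integrable lborel {t0..t} b"
    and h: "AE r in lborel. t0 \<le> r \<longrightarrow> h r \<le> - b r * y r + \<Gamma>"
    and lower: "\<And>r t. t0 \<le> r \<Longrightarrow> r \<le> t \<Longrightarrow> (LINT s:{r..t}|lborel. b s) \<ge> \<alpha> * (t - r) - K"
    and pos: "\<alpha> > 0" "\<Gamma> \<ge> 0" "y t0 \<ge> 0" and t: "t \<ge> t0"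
  shows "y t \<le> exp K * (y t0 * exp (- \<alpha> * (t - t0)) + \<Gamma> / \<alpha>)"
proof -
  define A where "A = (\<lambda>t. LINT s:{t0..t}|lborel. b s)"
  have A0: "A t0 = 0"
  proof -
    have "(LINT s:{t0..t0}|lborel. b s) = integral {t0..t0} b"
      using b[of t0] by (intro set_borel_integral_eq_integral) auto
    then show ?thesis unfolding A_def by simp
  qed
  have A: "primitive_from t0 A b"
    unfolding primitive_from_def A0 using b by (auto simp: A_def)
  note E = primitive_from_exp[OF A A0]
  note M = primitive_from_mult[OF y E]
  have lo: "A t - A r \<ge> \<alpha> * (t - r) - K" if "t0 \<le> r" "r \<le> t" for r
    using primitive_from_diff(2)[OF A that] lower[OF that] by simp
  have ie: "set_integrable lborel {t0..t} (\<lambda>r. \<Gamma> * exp K * exp (A t) * exp (- \<alpha> * (t - r)))"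
    by (intro borel_integrable_atLeastAtMost'  continuous_intros)
  have "y t * exp (A t) - y t0 = (LINT r:{t0..t}|lborel. h r * exp (A r) + exp (A r) * b r * y r)"
    using primitive_from_diff(2)[OF M order_refl t] by (simp add: A0 mult_ac)
  also have "\<dots> \<le> (LINT r:{t0..t}|lborel. \<Gamma> * exp K * exp (A t) * exp (- \<alpha> * (t - r)))"
    unfolding set_lebesgue_integral_def
  proof (rule integral_mono_AE)
    show "integrable lborel (\<lambda>r. indicator {t0..t} r *\<^sub>R (h r * exp (A r) + exp (A r) * b r * y r))"
      using primitive_from_diff(1)[OF M order_refl t] unfolding set_integrable_def by (simp add: mult_ac)
    show "integrable lborel (\<lambda>r. indicator {t0..t} r *\<^sub>R (\<Gamma> * exp K * exp (A t) * exp (- \<alpha> * (t - r))))"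
      using ie unfolding set_integrable_def .
    show "AE r in lborel. indicator {t0..t} r *\<^sub>R (h r * exp (A r) + exp (A r) * b r * y r)
        \<le> indicator {t0..t} r *\<^sub>R (\<Gamma> * exp K * exp (A t) * exp (- \<alpha> * (t - r)))"
      using h
    proof eventually_elim
      case (elim r)
      show ?case
      proof (cases "r \<in> {t0..t}")
        case True
        have "h r * exp (A r) + exp (A r) * b r * y r = (h r + b r * y r) * exp (A r)"
          by (simp add: algebra_simps)
        also have "\<dots> \<le> \<Gamma> * exp (A r)"
          using elim True by (intro mult_right_mono) auto
        also have "\<dots> \<le> \<Gamma> * exp (K + A t + - \<alpha> * (t - r))"
          using lo[of r] True pos by (intro mult_left_mono) auto
        also have "\<dots> = \<Gamma> * exp K * exp (A t) * exp (- \<alpha> * (t - r))"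
          by (simp only: exp_add mult.assoc)
        finally show ?thesis using True by simp
      qed auto
    qed
  qed
  also have "\<dots> = \<Gamma> * exp K * exp (A t) * (LINT r:{t0..t}|lborel. exp (- \<alpha> * (t - r)))"
    by (rule set_integral_mult_right)
  also have "(LINT r:{t0..t}|lborel. exp (- \<alpha> * (t - r))) = exp (- \<alpha> * (t - t)) / \<alpha> - exp (- \<alpha> * (t - t0)) / \<alpha>"
    unfolding set_lebesgue_integral_def
    by (rule integral_FTC_Icc[OF t])
       (use pos in \<open>auto intro!: derivative_eq_intros continuous_intros simp flip: has_real_derivative_iff_has_vector_derivative\<close>)
  also have "\<Gamma> * exp K * exp (A t) * \<dots> \<le> \<Gamma> * exp K * exp (A t) * (1 / \<alpha>)"
    using pos by (intro mult_left_mono) (auto simp: field_simps)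
  finally have "y t * exp (A t) \<le> y t0 + \<Gamma> * exp K * exp (A t) * (1 / \<alpha>)" by simp
  then have "y t \<le> (y t0 + \<Gamma> * exp K * exp (A t) * (1 / \<alpha>)) / exp (A t)"
    by (simp add: pos_le_divide_eq)
  also have "\<dots> = y t0 * exp (- A t) + \<Gamma> * exp K / \<alpha>"
    by (simp add: field_simps exp_minus)
  also have "y t0 * exp (- A t) \<le> y t0 * exp (K + - \<alpha> * (t - t0))"
    using lo[of t0] t pos A0 by (intro mult_left_mono) auto
  also have "y t0 * exp (K + - \<alpha> * (t - t0)) + \<Gamma> * exp K / \<alpha>
      = exp K * (y t0 * exp (- \<alpha> * (t - t0)) + \<Gamma> / \<alpha>)"
    by (simp only: exp_add distrib_left times_divide_eq_right mult_ac)
  finally show ?thesis by simp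
qed

text \<open>The bound of \<open>gronwall_bound\<close> is restarted at a time after which the
  inhomogeneity is small. The lower bound on the integrals of \<open>b\<close> survives the restart
  with the same \<open>K\<close>.\<close>

lemma gronwall_tendsto_0:
  assumes y: "primitive_from t0 y h" and y0: "\<And>t. t \<ge> t0 \<Longrightarrow> y t \<ge> 0"
    and b: "\<And>t. t \<ge> t0 \<Longrightarrow> set_integrable lborel {t0..t} b"
    and h: "AE r in lborel. t0 \<le> r \<longrightarrow> h r \<le> - b r * y r + \<gamma> r"
    and lower: "\<And>r t. t0 \<le> r \<Longrightarrow> r \<le> t \<Longrightarrow> (LINT s:{r..t}|lborel. b s) \<ge> \<alpha> * (t - r) - K"
    and pos: "\<alpha> > 0" and \<gamma>: "(\<gamma> \<longlongrightarrow> 0) at_top"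
  shows "(y \<longlongrightarrow> 0) at_top"
proof (rule tendstoI)
  fix e :: real assume e: "e > 0"
  \<comment> \<open>Chosen so that the limit \<open>exp K * \<Gamma> / \<alpha>\<close> of the bound
    is \<open>e / 4\<close>.\<close>
  define \<Gamma> where "\<Gamma> = e * \<alpha> / (4 * exp K)"
  have \<Gamma>: "\<Gamma> > 0" using e pos by (simp add: \<Gamma>_def)
  then obtain t1 where t1: "t1 \<ge> t0" "\<And>t. t \<ge> t1 \<Longrightarrow> \<gamma> t \<le> \<Gamma>"
    using order_tendstoD(2)[OF \<gamma> \<Gamma>] unfolding eventually_at_top_linorder
    by (metis less_imp_le max.bounded_iff max.cobounded1 max.cobounded2)
  have bnd: "y t \<le> exp K * (y t1 * exp (- \<alpha> * (t - t1)) + \<Gamma> / \<alpha>)" if "t \<ge> t1" for t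
  proof (rule gronwall_bound[where b=b])
    show "primitive_from t1 y h" using primitive_from_later[OF y t1(1)] .
    show "set_integrable lborel {t1..t} b" if "t \<ge> t1" for t
      by (rule set_integrable_subset[OF b[of t]]) (use that t1 in auto)
    show "AE r in lborel. t1 \<le> r \<longrightarrow> h r \<le> - b r * y r + \<Gamma>"
      using h by eventually_elim (use t1 in force)
  qed (use lower t1 pos \<Gamma> y0 that in auto)
  have "((\<lambda>t. exp (- \<alpha> * (t - t1))) \<longlongrightarrow> 0) at_top"
  proof -
    have "filterlim (\<lambda>t. - t1 + t) at_top at_top" by (rule filterlim_tendsto_add_at_top[OF tendsto_const filterlim_ident])
    then have "filterlim (\<lambda>t. \<alpha> * (t - t1)) at_top at_top"
      using pos by (intro filterlim_tendsto_pos_mult_at_top[OF tendsto_const]) auto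
    then have "filterlim (\<lambda>t. - (\<alpha> * (t - t1))) at_bot at_top"
      by (simp add: filterlim_uminus_at_bot)
    then show ?thesis by (auto intro: filterlim_compose[OF exp_at_bot])
  qed
  then have "((\<lambda>t. exp K * (y t1 * exp (- \<alpha> * (t - t1)) + \<Gamma> / \<alpha>)) \<longlongrightarrow> exp K * (y t1 * 0 + \<Gamma> / \<alpha>)) at_top"
    by (intro tendsto_intros)
  moreover have "exp K * (y t1 * 0 + \<Gamma> / \<alpha>) < e"
    using e pos by (simp add: \<Gamma>_def)
  ultimately have "\<forall>\<^sub>F t in at_top. exp K * (y t1 * exp (- \<alpha> * (t - t1)) + \<Gamma> / \<alpha>) < e"
    by (rule order_tendstoD)
  then show "\<forall>\<^sub>F t in at_top. dist (y t) 0 < e"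
    using eventually_ge_at_top[of t1]
    by eventually_elim (use bnd y0 t1 in \<open>force simp: dist_real_def\<close>)
qed

section \<open>Fields and their coefficient sequences\<close>

lemma inL2_torus:
  "inL2 u \<longleftrightarrow> u \<in> borel_measurable torus \<and> integrable torus (\<lambda>x. (norm (u x))^2)"
  by (simp add: inL2_def set_borel_measurable_torus set_integrable_torus)

lemma fc_fcs: "fc u k $ i = fcs (\<lambda>x. complex_of_real (u x $ i)) k"
  by (simp add: fc_def fcs_def set_integral_torus)

lemma measurable_vec_nth_torus:
  fixes u :: "real^2 \<Rightarrow> real^2"
  assumes "u \<in> borel_measurable torus" shows "(\<lambda>x. u x $ i) \<in> borel_measurable torus"
  using measurable_compose[OF assms, of "\<lambda>v. v $ i" borel]
  by (simp add: borel_measurable_continuous_onI continuous_intros)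

lemma norm_real2_sq: "(norm (v :: real^2))^2 = (v $ 1)^2 + (v $ 2)^2"
  by (simp add: norm_vec_def L2_set_def sum_2)

lemma inL2_sqint:
  assumes "inL2 u" shows "sqint (\<lambda>x. complex_of_real (u x $ i))"
proof -
  have m: "(\<lambda>x. u x $ i) \<in> borel_measurable torus"
    using assms by (intro measurable_vec_nth_torus) (simp add: inL2_torus)
  have "integrable torus (\<lambda>x. (u x $ i)^2)"
  proof (rule Bochner_Integration.integrable_bound)
    show "integrable torus (\<lambda>x. (norm (u x))^2)" using assms by (simp add: inL2_torus)
    show "AE x in torus. norm ((u x $ i)^2) \<le> norm ((norm (u x))^2)"
      using component_le_norm_cart[of _ i] by (auto simp: abs_le_square_iff[symmetric])
  qed (use m in auto)
  then show ?thesis using m by (simp add: sqint_def)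
qed

lemma inL2I:
  assumes "u \<in> borel_measurable torus" "\<And>i. sqint (\<lambda>x. complex_of_real (u x $ i))"
  shows "inL2 u"
  using assms(1) assms(2)[of 1] assms(2)[of 2] by (simp add: inL2_torus norm_real2_sq sqint_def)

lemma Hnorm_torus: "(Hnorm u)^2 = (\<integral>x. (norm (u x))^2 \<partial>torus)" "0 \<le> Hnorm u"
  by (simp_all add: Hnorm_def set_integral_torus)

lemma Hnorm_components:
  assumes "inL2 u"
  shows "(Hnorm u)^2 = (\<integral>x. (u x $ 1)^2 \<partial>torus) + (\<integral>x. (u x $ 2)^2 \<partial>torus)"
  using inL2_sqint[OF assms, of 1] inL2_sqint[OF assms, of 2]
  by (simp add: Hnorm_torus norm_real2_sq sqint_def)

text \<open>Parseval for both components: Bessel gives one inequality together with summability, and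
  the density of trigonometric polynomials, through \<open>parseval_le\<close>, gives the
  other.\<close>

lemma Hnorm_eq_seq_L2:
  assumes u: "inL2 u"
  shows "ell2 (\<lambda>k. norm (fc u k))" "Hnorm u = 2 * pi * seq_L2 (fc u)"
proof -
  note s = inL2_sqint[OF u]
  have sum_fc: "(\<Sum>k\<in>F. (norm (fc u k))^2) = (\<Sum>k\<in>F. (cmod (fcs (\<lambda>x. complex_of_real (u x $ 1)) k))^2)
      + (\<Sum>k\<in>F. (cmod (fcs (\<lambda>x. complex_of_real (u x $ 2)) k))^2)" for F
    by (simp add: norm_vec2_sq fc_fcs sum.distrib)
  have le: "4 * pi^2 * (\<Sum>k\<in>F. (norm (fc u k))^2) \<le> (Hnorm u)^2" if "finite F" for F
    using bessel[OF that s[of 1]] bessel[OF that s[of 2]]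
    unfolding Hnorm_components[OF u] sum_fc by (simp add: distrib_left)
  have "L2_set (\<lambda>k. norm (fc u k)) F \<le> Hnorm u / (2 * pi)" if "finite F" for F
  proof -
    have "(\<Sum>k\<in>F. (norm (fc u k))^2) \<le> (Hnorm u / (2 * pi))^2"
      using le[OF that] by (simp add: power_divide power_mult_distrib pos_le_divide_eq mult.commute)
    then show ?thesis unfolding L2_set_def
      by (intro real_le_lsqrt) (auto simp: sum_nonneg Hnorm_torus(2))
  qed
  from nrm2_leI[OF this] have e: "ell2 (\<lambda>k. norm (fc u k))" and "seq_L2 (fc u) \<le> Hnorm u / (2 * pi)"
    by (auto simp: seq_L2_def)
  then have ge: "2 * pi * seq_L2 (fc u) \<le> Hnorm u" by (simp add: pos_le_divide_eq mult.commute)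
  have i: "(\<lambda>k. (cmod (fc u k $ i))^2) summable_on UNIV" for i
  proof (rule summable_on_comparison_test[OF e[unfolded ell2_def]])
    show "(cmod (fc u k $ i))^2 \<le> (norm (fc u k))^2" for k
      using Finite_Cartesian_Product.norm_nth_le[of "fc u k" i] by (intro power_mono) auto
  qed auto
  have "(\<integral>x. (u x $ i)^2 \<partial>torus) \<le> 4 * pi^2 * (\<Sum>\<^sub>\<infinity>k. (cmod (fc u k $ i))^2)" for i
  proof (rule parseval_le[OF s])
    fix S :: "(int \<times> int) set" assume "finite S"
    then show "(\<Sum>k\<in>S. (cmod (fcs (\<lambda>x. complex_of_real (u x $ i)) k))^2) \<le> (\<Sum>\<^sub>\<infinity>k. (cmod (fc u k $ i))^2)"
      using finite_sum_le_infsum[OF i[of i], of S] by (simp add: fc_fcs)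
  qed
  from add_mono[OF this[of 1] this[of 2]]
  have "(Hnorm u)^2 \<le> 4 * pi^2 * (\<Sum>\<^sub>\<infinity>k. (cmod (fc u k $ 1))^2 + (cmod (fc u k $ 2))^2)"
    unfolding Hnorm_components[OF u] by (simp add: infsum_add[OF i i] distrib_left)
  also have "\<dots> = (2 * pi * seq_L2 (fc u))^2"
    by (simp add: norm_vec2_sq power_mult_distrib seq_L2_def nrm2_sq)
  finally have "Hnorm u \<le> 2 * pi * seq_L2 (fc u)"
    by (rule power2_le_imp_le) (simp add: seq_L2_def)
  then show "Hnorm u = 2 * pi * seq_L2 (fc u)" using ge by (rule antisym)
  show "ell2 (\<lambda>k. norm (fc u k))" by (rule e)
qed

lemma Vnorm_eq_seq_H1: "Vnorm u = 2 * pi * seq_H1 (fc u)"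
  by (simp add: Vnorm_def seq_H1_def nrm2_def power_mult_distrib real_sqrt_mult)

lemma fc_cnj: "fc u (- k) $ i = cnj (fc u k $ i)"
proof -
  have "cnj (\<integral>x. complex_of_real (u x $ i) * cis (- kdot k x) \<partial>torus)
      = (\<integral>x. cnj (complex_of_real (u x $ i) * cis (- kdot k x)) \<partial>torus)"
    by (rule Bochner_Integration.integral_cnj[symmetric])
  then show ?thesis by (simp add: fc_fcs fcs_def kdot_minus cis_cnj)
qed

lemma inH_solenoidal: "inH u \<Longrightarrow> solenoidal (fc u)"
  by (simp add: inH_def solenoidal_def fc_cnj dotk_def mult.commute zero_prod_def)

lemma inV_inH1: "inV u \<Longrightarrow> inH1 (fc u)"
  using inH_solenoidal by (simp add: inV_def inH1_def ell2_def power_mult_distrib)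

lemma fc_linear:
  assumes "inL2 u" "inL2 v"
  shows "inL2 (\<lambda>x. r *\<^sub>R u x + s *\<^sub>R v x)" "fc (\<lambda>x. r *\<^sub>R u x + s *\<^sub>R v x) k = r *\<^sub>R fc u k + s *\<^sub>R fc v k"
proof -
  note su = sqint_cmult[OF inL2_sqint[OF assms(1)], of "complex_of_real r"]
    and sv = sqint_cmult[OF inL2_sqint[OF assms(2)], of "complex_of_real s"]
  show "inL2 (\<lambda>x. r *\<^sub>R u x + s *\<^sub>R v x)"
  proof (rule inL2I)
    show "(\<lambda>x. r *\<^sub>R u x + s *\<^sub>R v x) \<in> borel_measurable torus"
      using assms by (intro borel_measurable_add borel_measurable_scaleR) (auto simp: inL2_torus)
    show "sqint (\<lambda>x. complex_of_real ((r *\<^sub>R u x + s *\<^sub>R v x) $ i))" for i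
      using sqint_add[OF su[of i] sv[of i]] by simp
  qed
  show "fc (\<lambda>x. r *\<^sub>R u x + s *\<^sub>R v x) k = r *\<^sub>R fc u k + s *\<^sub>R fc v k"
  proof -
    have "fcs (\<lambda>x. complex_of_real ((r *\<^sub>R u x + s *\<^sub>R v x) $ i)) k
        = of_real r * fcs (\<lambda>x. complex_of_real (u x $ i)) k + of_real s * fcs (\<lambda>x. complex_of_real (v x $ i)) k" for i
      using fcs_add[OF su[of i] sv[of i], of k] by (simp add: fcs_cmult)
    then show ?thesis by (simp add: vec_eq_iff fc_fcs complex_eq_iff)
  qed
qed

lemma fc_diff:
  assumes "inL2 u" "inL2 v"
  shows "inL2 (u - v)" "fc (u - v) k = fc u k - fc v k"
proof -
  have e: "u - v = (\<lambda>x. 1 *\<^sub>R u x + (-1) *\<^sub>R v x)" by (auto simp: fun_eq_iff)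
  show "inL2 (u - v)" "fc (u - v) k = fc u k - fc v k"
    unfolding e using fc_linear[OF assms, of 1 "-1"] by simp_all
qed

lemma summable_inverse_square_int: "(\<lambda>n::int. 1 / (1 + (real_of_int n)^2)) summable_on UNIV"
proof -
  have s: "(\<lambda>n::nat. 1 / (1 + (real n)^2)) summable_on UNIV"
  proof (rule summable_on_comparison_test)
    have "summable (\<lambda>n. inverse (real (Suc n) ^ 2))"
      using inverse_power_summable[of 2, where 'a=real] summable_Suc_iff[of "\<lambda>n. inverse (real n ^ 2)"] by simp
    then have "summable (\<lambda>n. 2 * inverse (real (Suc n) ^ 2))" by (rule summable_mult)
    then show "(\<lambda>n. 2 * inverse (real (Suc n) ^ 2)) summable_on UNIV"
      by (intro norm_summable_imp_summable_on) simp
    show "1 / (1 + (real n)^2) \<le> 2 * inverse (real (Suc n) ^ 2)" for n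
    proof -
      have "(real (Suc n))^2 \<le> 2 * (1 + (real n)^2)"
        using sum_squares_bound[of 1 "real n"] by (simp add: power2_sum)
      moreover have "0 < (real (Suc n))^2" "0 < 1 + (real n)^2" by (auto intro: add_pos_nonneg)
      ultimately show ?thesis by (simp add: field_simps del: of_nat_Suc)
    qed
  qed auto
  have "(\<lambda>n::int. 1 / (1 + (real_of_int n)^2)) summable_on (range int)"
    using s by (subst summable_on_reindex) (auto simp: inj_on_def o_def)
  moreover have "(\<lambda>n::int. 1 / (1 + (real_of_int n)^2)) summable_on (range (\<lambda>n. - int n))"
    using s by (subst summable_on_reindex) (auto simp: inj_on_def o_def)
  ultimately have "(\<lambda>n::int. 1 / (1 + (real_of_int n)^2)) summable_on (range int \<union> range (\<lambda>n. - int n))"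
    by (rule summable_on_union)
  moreover have "range int \<union> range (\<lambda>n. - int n) = UNIV"
    by (auto intro: int_cases2 simp: image_iff)
  ultimately show ?thesis by simp
qed

text \<open>In dimension two |k|^-4 is summable. With x and y the squares of the entries of
  \<open>k\<close>, each of 1, x + y and x y is at most (x + y)^2 when x + y \<ge> 1, so (1 + x)(1 +
  y) \<le> 3 (x + y)^2 and the sum is compared with a product of one-dimensional sums. At
  \<open>k = 0\<close> the quotient is 0 by convention.\<close>

lemma ell2_inverse_ksq: "ell2 (\<lambda>k. 1 / ksq k)"
proof -
  define g where "g n = 1 / (1 + (real_of_int n)^2)" for n
  have g: "g summable_on UNIV" and g0: "\<And>n. 0 \<le> g n"
    using summable_inverse_square_int unfolding g_def[abs_def] by auto
  have gI: "sum g F \<le> infsum g UNIV" if "finite F" for F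
    using g that by (intro finite_sum_le_infsum) (auto simp: g0)
  have "(\<lambda>k. 3 * (g (fst k) * g (snd k))) summable_on UNIV"
  proof (rule summable_on_nonnegI)
    fix F :: "(int \<times> int) set" assume F: "finite F"
    have "(\<Sum>k\<in>F. g (fst k) * g (snd k)) \<le> (\<Sum>k\<in>fst ` F \<times> snd ` F. g (fst k) * g (snd k))"
      using F g0 by (intro sum_mono2) (auto intro: rev_image_eqI)
    also have "\<dots> = sum g (fst ` F) * sum g (snd ` F)"
      by (simp add: sum_product sum.cartesian_product split_beta)
    also have "\<dots> \<le> infsum g UNIV * infsum g UNIV"
      using F g0 by (intro mult_mono gI infsum_nonneg sum_nonneg) auto
    finally show "(\<Sum>k\<in>F. 3 * (g (fst k) * g (snd k))) \<le> 3 * (infsum g UNIV * infsum g UNIV)"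
      by (simp add: sum_distrib_left[symmetric])
  qed (simp add: g0)
  then show ?thesis unfolding ell2_def
  proof (rule summable_on_comparison_test)
    fix k :: "int \<times> int"
    show "(1 / ksq k)^2 \<le> 3 * (g (fst k) * g (snd k))"
    proof (cases "k = 0")
      case False
      then have k1: "1 \<le> ksq k" by (rule ksq_ge_1)
      define x y where "x = (real_of_int (fst k))^2" and "y = (real_of_int (snd k))^2"
      have xy: "ksq k = x + y" "0 \<le> x" "0 \<le> y" by (auto simp: x_def y_def ksq_def)
      have "1 \<le> (x + y)^2" "x + y \<le> (x + y)^2"
        using k1 xy one_le_power[of "x + y" 2] self_le_power[of "x + y" 2] by auto
      moreover have "x * y \<le> (x + y)^2" using xy by (simp add: power2_sum)
      ultimately have "(1 + x) * (1 + y) \<le> 3 * (x + y)^2" by (simp add: algebra_simps)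
      moreover have "0 < (1 + x) * (1 + y)" "0 < (x + y)^2" using xy k1 by (auto intro!: mult_pos_pos)
      ultimately have "1 / (x + y)^2 \<le> 3 * (1 / ((1 + x) * (1 + y)))"
        by (simp add: pos_divide_le_eq pos_le_divide_eq)
      then show ?thesis by (simp add: xy(1) g_def power_divide flip: x_def y_def)
    qed (simp add: g0)
  qed auto
qed

text \<open>Cauchy-Schwarz after writing the coefficient as |k|^-2 times |k|^2 times itself. At the
  zero mode both sides vanish, the coefficient because the field is mean free. The factor
  \<open>2 * pi \<ge> 1\<close> in \<open>Anorm\<close> is given away.\<close>

lemma inDA_wiener_H1:
  assumes "inV u" "inDA u"
  shows "wiener_H1 (fc u)" "seq_l1 (fc u) \<le> nrm2 (\<lambda>k. 1 / ksq k) * Anorm u"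
proof -
  have e: "ell2 (\<lambda>k. ksq k * norm (fc u k))"
    using assms(2) by (simp add: inDA_def ell2_def power_mult_distrib)
  have eq: "norm (fc u k) = \<bar>1 / ksq k\<bar> * \<bar>ksq k * norm (fc u k)\<bar>" for k
  proof (cases "k = 0")
    case True
    then show ?thesis using solenoidal_0[OF inH_solenoidal] assms by (simp add: inV_def)
  next
    case False
    then show ?thesis using ksq_ge_1[of k] by simp
  qed
  note cs = cauchy_schwarz_ell2[OF ell2_inverse_ksq e, folded eq]
  show "wiener_H1 (fc u)" using inV_inH1[OF assms(1)] cs(1) by (simp add: wiener_H1_def)
  have A: "Anorm u = 2 * pi * nrm2 (\<lambda>k. ksq k * norm (fc u k))"
    by (simp add: Anorm_def nrm2_def power_mult_distrib real_sqrt_mult)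
  have "nrm2 (\<lambda>k. ksq k * norm (fc u k)) \<le> Anorm u"
    using mult_right_mono[of 1 "2 * pi" "nrm2 (\<lambda>k. ksq k * norm (fc u k))"] pi_gt3 unfolding A by simp
  then show "seq_l1 (fc u) \<le> nrm2 (\<lambda>k. 1 / ksq k) * Anorm u"
    unfolding seq_l1_def using cs(2) mult_left_mono[of _ "Anorm u" "nrm2 (\<lambda>k. 1 / ksq k)"] by fastforce
qed

section \<open>The Ladyzhenskaya bound\<close>

text \<open>The trilinear form paired with itself in the outer slots only sees the tensor
  \<open>u \<otimes> u\<close>, whose Fourier coefficients are controlled in \<open>\<ell>\<^sup>2\<close> by the \<open>L\<^sup>4\<close> norm (Bessel).\<close>

lemma tensor_pairing_bound:
  fixes x y :: "complex^2" and t :: "2 \<Rightarrow> 2 \<Rightarrow> complex"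
  shows "cmod (\<Sum>i\<in>UNIV. \<Sum>j\<in>UNIV. x $ i * y $ j * t i j)
    \<le> norm x * norm y * sqrt (\<Sum>i\<in>UNIV. \<Sum>j\<in>UNIV. (cmod (t i j))^2)"
proof -
  have "cmod (\<Sum>i\<in>UNIV. \<Sum>j\<in>UNIV. x $ i * y $ j * t i j)
      \<le> (\<Sum>(i,j)\<in>UNIV. \<bar>cmod (x $ i) * cmod (y $ j)\<bar> * \<bar>cmod (t i j)\<bar>)"
    unfolding sum.cartesian_product UNIV_Times_UNIV
    by (rule order_trans[OF norm_sum]) (simp add: split_beta norm_mult)
  also have "\<dots> \<le> L2_set (\<lambda>(i,j). cmod (x $ i) * cmod (y $ j)) UNIV * L2_set (\<lambda>(i,j). cmod (t i j)) UNIV"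
    using L2_set_mult_ineq[of "\<lambda>(i,j). cmod (x $ i) * cmod (y $ j)" "\<lambda>(i,j). cmod (t i j)" UNIV]
    by (simp add: split_beta)
  also have "L2_set (\<lambda>(i,j). cmod (x $ i) * cmod (y $ j)) UNIV = norm x * norm y"
  proof -
    have "(\<Sum>(i,j)\<in>UNIV. (cmod (x $ i) * cmod (y $ j))^2) = (norm x)^2 * (norm y)^2"
      unfolding UNIV_Times_UNIV[symmetric] sum.cartesian_product[symmetric]
      by (simp add: sum_2 norm_vec2_sq power_mult_distrib algebra_simps)
    then show ?thesis by (simp add: L2_set_def split_beta real_sqrt_mult)
  qed
  also have "L2_set (\<lambda>(i,j). cmod (t i j)) UNIV = sqrt (\<Sum>i\<in>UNIV. \<Sum>j\<in>UNIV. (cmod (t i j))^2)"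
    unfolding L2_set_def UNIV_Times_UNIV[symmetric] sum.cartesian_product by (simp add: split_beta)
  finally show ?thesis .
qed

text \<open>The constant \<open>C_L\<close> is known for fields, not for coefficient sequences. This
  finite truncation is a genuine element of V; on a set of modes symmetric under negation its sum is
  real, so \<open>Re\<close> loses nothing.\<close>

definition trig_field :: "(int \<times> int) set \<Rightarrow> cseq \<Rightarrow> field" where
  "trig_field S a x = (\<chi> i. Re (trigpoly S (\<lambda>k. a k $ i) x))"

context
  fixes S :: "(int \<times> int) set" and a :: cseq
  assumes S: "finite S" "\<And>k. k \<in> S \<Longrightarrow> - k \<in> S" and a: "solenoidal a"
begin

lemma trig_field_complex: "complex_of_real (trig_field S a x $ i) = trigpoly S (\<lambda>k. a k $ i) x"
proof -
  have b: "bij_betw uminus S S" by (rule bij_betwI[of _ _ _ uminus]) (use S in auto)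
  have "cnj (trigpoly S (\<lambda>k. a k $ i) x) = (\<Sum>k\<in>S. a (- k) $ i * cis (kdot (- k) x))"
    by (simp add: trigpoly_def solenoidal_cnj[OF a] kdot_minus cis_cnj)
  also have "\<dots> = trigpoly S (\<lambda>k. a k $ i) x"
    unfolding trigpoly_def by (rule sum.reindex_bij_betw[OF b])
  finally have "trigpoly S (\<lambda>k. a k $ i) x \<in> \<real>" by (simp add: Reals_cnj_iff)
  then show ?thesis by (simp add: trig_field_def of_real_Re)
qed

lemma continuous_trig_field: "continuous_on UNIV (trig_field S a)"
  unfolding trig_field_def[abs_def] trigpoly_def by (intro continuous_intros)

lemma fc_trig_field: "fc (trig_field S a) k = (if k \<in> S then a k else 0)"
  by (simp add: vec_eq_iff fc_fcs trig_field_complex fcs_trigpoly S)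

lemma inL2_trig_field: "inL2 (trig_field S a)"
proof (rule inL2I)
  show "trig_field S a \<in> borel_measurable torus"
    by (intro measurable_torusI borel_measurable_continuous_onI continuous_trig_field)
  show "sqint (\<lambda>x. complex_of_real (trig_field S a x $ i))" for i
    unfolding trig_field_complex by (rule sqint_trigpoly[OF S(1)])
qed

lemma inV_trig_field: "inV (trig_field S a)"
proof -
  have "(\<lambda>k. ksq k * (norm (fc (trig_field S a) k))^2) summable_on UNIV"
    by (rule finite_nonzero_values_imp_summable_on)
       (auto intro: finite_subset[OF _ S(1)] simp: fc_trig_field split: if_splits)
  moreover have "(\<Sum>j\<in>UNIV. kc k $ j * fc (trig_field S a) k $ j) = 0" for k
    using solenoidal_dotk[OF a, of k] by (simp add: fc_trig_field dotk_def mult.commute)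
  moreover have "fc (trig_field S a) (0,0) = 0"
    using solenoidal_0[OF a] by (simp add: fc_trig_field zero_prod_def)
  ultimately show ?thesis using inL2_trig_field by (simp add: inV_def inH_def)
qed

text \<open>Since the second component is real it may be replaced by its conjugate. The pair
  \<open>(m, n)\<close> then has frequency \<open>m - n\<close>, which explains the argument
  \<open>- l\<close>.\<close>

lemma fcs_tensor:
  "fcs (\<lambda>x. complex_of_real (trig_field S a x $ i * trig_field S a x $ j)) (- l)
    = (\<Sum>(m,n)\<in>S\<times>S. if n - m = l then a m $ i * cnj (a n $ j) else 0)"
proof -
  have e: "complex_of_real (trig_field S a x $ i * trig_field S a x $ j)
      = (\<Sum>p\<in>S\<times>S. a (fst p) $ i * cnj (a (snd p) $ j) * cis (kdot (fst p - snd p) x))" for x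
  proof -
    have "complex_of_real (trig_field S a x $ j) = cnj (trigpoly S (\<lambda>k. a k $ j) x)"
      unfolding trig_field_complex[symmetric] by simp
    then have "complex_of_real (trig_field S a x $ i * trig_field S a x $ j)
        = trigpoly S (\<lambda>k. a k $ i) x * cnj (trigpoly S (\<lambda>k. a k $ j) x)"
      by (simp add: trig_field_complex)
    also have "\<dots> = (\<Sum>p\<in>S\<times>S. a (fst p) $ i * cis (kdot (fst p) x) * cnj (a (snd p) $ j * cis (kdot (snd p) x)))"
      unfolding trigpoly_def cnj_sum sum_product sum.cartesian_product by (simp add: split_beta)
    also have "\<dots> = (\<Sum>p\<in>S\<times>S. a (fst p) $ i * cnj (a (snd p) $ j) * cis (kdot (fst p - snd p) x))"
      by (intro sum.cong refl) (simp add: cis_cnj kdot_diff mult_ac flip: cis_divide cis_inverse divide_inverse)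
    finally show ?thesis .
  qed
  have "fcs (\<lambda>x. complex_of_real (trig_field S a x $ i * trig_field S a x $ j)) (- l)
      = (\<Sum>p\<in>S\<times>S. a (fst p) $ i * cnj (a (snd p) $ j) * (if fst p - snd p = - l then 1 else 0))"
    unfolding e by (subst fcs_sum) (auto simp: S(1) fcs_cmult fcs_cis intro: sqint_cmult sqint_cis)
  also have "\<dots> = (\<Sum>(m,n)\<in>S\<times>S. if n - m = l then a m $ i * cnj (a n $ j) else 0)"
  proof (intro sum.cong refl)
    fix p :: "(int \<times> int) \<times> (int \<times> int)"
    have "fst p - snd p = - l \<longleftrightarrow> snd p - fst p = l" by (metis minus_diff_eq minus_equation_iff)
    then show "a (fst p) $ i * cnj (a (snd p) $ j) * (if fst p - snd p = - l then 1 else 0)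
      = (case p of (m,n) \<Rightarrow> if n - m = l then a m $ i * cnj (a n $ j) else 0)"
      by (simp add: split_beta)
  qed
  finally show ?thesis .
qed

text \<open>The squares of the four products of components add up to the fourth power of the length
  of the field, so Bessel for each product gives the fourth power of the L4 norm.\<close>

lemma tensor_bessel:
  assumes L: "finite L"
  shows "4 * pi^2 * (\<Sum>l\<in>L. \<Sum>i\<in>UNIV. \<Sum>j\<in>UNIV.
      (cmod (fcs (\<lambda>x. complex_of_real (trig_field S a x $ i * trig_field S a x $ j)) (- l)))^2)
    \<le> (L4norm (trig_field S a))^4"
proof -
  let ?u = "trig_field S a"
  let ?f = "\<lambda>i j x. complex_of_real (?u x $ i * ?u x $ j)"
  have mu: "(\<lambda>x. ?u x $ i) \<in> borel_measurable torus" for i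
    by (intro measurable_torusI borel_measurable_continuous_onI continuous_intros continuous_trig_field)
  have "\<exists>B. \<forall>x. cmod (complex_of_real (?u x $ i)) \<le> B" for i
    unfolding trig_field_complex trigpoly_def
    by (rule exI[of _ "\<Sum>k\<in>S. cmod (a k $ i)"]) (auto intro!: order_trans[OF norm_sum] sum_mono simp: norm_mult)
  then obtain B where B: "\<And>i x. \<bar>?u x $ i\<bar> \<le> B i" unfolding norm_of_real by metis
  have B0: "0 \<le> B i" for i using B[where x=0 and i=i] by linarith
  have sq: "sqint (?f i j)" for i j
    by (rule sqint_bounded[of _ "B i * B j"])
       (use mu B B0 in \<open>auto simp: norm_mult intro!: mult_mono borel_measurable_times\<close>)
  have inj: "inj_on uminus L" by auto
  have "4 * pi^2 * (\<Sum>l\<in>L. (cmod (fcs (?f i j) (- l)))^2) \<le> (\<integral>x. (cmod (?f i j x))^2 \<partial>torus)" for i j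
    using bessel[OF finite_imageI[OF L, of uminus] sq[of i j]] by (simp add: sum.reindex[OF inj])
  then have "(\<Sum>i\<in>UNIV. \<Sum>j\<in>UNIV. 4 * pi^2 * (\<Sum>l\<in>L. (cmod (fcs (?f i j) (- l)))^2))
      \<le> (\<Sum>i\<in>UNIV. \<Sum>j\<in>UNIV. (\<integral>x. (cmod (?f i j x))^2 \<partial>torus))"
    by (intro sum_mono)
  also have "\<dots> = (\<integral>x. (\<Sum>i\<in>UNIV. \<Sum>j\<in>UNIV. (cmod (?f i j x))^2) \<partial>torus)"
    using sq by (simp add: sum_2 sqint_def)
  also have "\<dots> = (\<integral>x. (norm (?u x))^4 \<partial>torus)"
  proof (intro Bochner_Integration.integral_cong refl)
    fix x
    have "(norm (?u x))^4 = ((norm (?u x))^2)^2" by simp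
    also have "\<dots> = (\<Sum>i\<in>UNIV. \<Sum>j\<in>UNIV. (cmod (?f i j x))^2)"
      by (simp only: norm_real2_sq norm_of_real power2_abs sum_2) (simp add: power_mult_distrib power2_eq_square algebra_simps)
    finally show "(\<Sum>i\<in>UNIV. \<Sum>j\<in>UNIV. (cmod (?f i j x))^2) = (norm (?u x))^4" by simp
  qed
  also have "\<dots> = (L4norm ?u)^4"
  proof -
    have "0 \<le> (\<integral>x. (norm (?u x))^4 \<partial>torus)" by simp
    then show ?thesis
      unfolding L4norm_def set_integral_torus
      by (cases "(\<integral>x. (norm (?u x))^4 \<partial>torus) = 0") (simp_all add: powr_power)
  qed
  also have "(\<Sum>i\<in>UNIV. \<Sum>j\<in>UNIV. 4 * pi^2 * (\<Sum>l\<in>L. (cmod (fcs (?f i j) (- l)))^2))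
      = 4 * pi^2 * (\<Sum>l\<in>L. \<Sum>i\<in>UNIV. \<Sum>j\<in>UNIV. (cmod (fcs (?f i j) (- l)))^2)"
    by (simp add: sum_2 sum.distrib distrib_left)
  finally show ?thesis .
qed

text \<open>Collecting the pairs \<open>(m, n)\<close> by their difference \<open>l\<close> turns
  the sum into a pairing of the gradient of \<open>b\<close> with the Fourier coefficients of the
  tensor product. Cauchy-Schwarz in \<open>l\<close> leaves the tensor in \<ell>2, where Bessel and
  the constant \<open>C\<close> apply.\<close>

lemma trig_field_tri_bound:
  assumes CL: "CL_const C" and aH: "inH1 a" and b: "ell2 (\<lambda>k. sqrt (ksq k) * norm (b k))" and C: "0 \<le> C"
  shows "\<bar>\<Sum>(m,n)\<in>S\<times>S. triterm a b a (m, n - m)\<bar> \<le> 2 * pi * C * seq_H1 a * seq_L2 a * seq_H1 b"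
proof -
  let ?u = "trig_field S a"
  define \<tau> where "\<tau> i j l = fcs (\<lambda>x. complex_of_real (?u x $ i * ?u x $ j)) (- l)" for i j l
  define L where "L = (\<lambda>(m,n). n - m) ` (S \<times> S)"
  have L: "finite L" using S(1) by (simp add: L_def)
  have tt: "triterm a b a (m, n - m) = Re (\<i> * (\<Sum>i\<in>UNIV. \<Sum>j\<in>UNIV. kc (n - m) $ i * b (n - m) $ j * (a m $ i * cnj (a n $ j))))" for m n
    by (simp add: triterm_def inner_vec_def sum_2 inner_complex_def dotk_def algebra_simps)
  have "(\<Sum>(m,n)\<in>S\<times>S. triterm a b a (m, n - m))
      = Re (\<i> * (\<Sum>p\<in>S\<times>S. \<Sum>i\<in>UNIV. \<Sum>j\<in>UNIV. kc (snd p - fst p) $ i * b (snd p - fst p) $ j * (a (fst p) $ i * cnj (a (snd p) $ j))))"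
    unfolding tt split_beta sum_distrib_left Re_sum ..
  also have "(\<Sum>p\<in>S\<times>S. \<Sum>i\<in>UNIV. \<Sum>j\<in>UNIV. kc (snd p - fst p) $ i * b (snd p - fst p) $ j * (a (fst p) $ i * cnj (a (snd p) $ j)))
      = (\<Sum>p\<in>S\<times>S. \<Sum>l\<in>L. \<Sum>i\<in>UNIV. \<Sum>j\<in>UNIV. kc l $ i * b l $ j * (if snd p - fst p = l then a (fst p) $ i * cnj (a (snd p) $ j) else 0))"
  proof (intro sum.cong refl)
    fix p assume p: "p \<in> S \<times> S"
    then have pL: "snd p - fst p \<in> L" by (force simp: L_def)
    have "(\<Sum>l\<in>L. \<Sum>i\<in>UNIV. \<Sum>j\<in>UNIV. kc l $ i * b l $ j * (if snd p - fst p = l then a (fst p) $ i * cnj (a (snd p) $ j) else 0))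
      = (\<Sum>l\<in>L. if snd p - fst p = l then \<Sum>i\<in>UNIV. \<Sum>j\<in>UNIV. kc l $ i * b l $ j * (a (fst p) $ i * cnj (a (snd p) $ j)) else 0)"
      by (intro sum.cong refl) auto
    also have "\<dots> = (\<Sum>i\<in>UNIV. \<Sum>j\<in>UNIV. kc (snd p - fst p) $ i * b (snd p - fst p) $ j * (a (fst p) $ i * cnj (a (snd p) $ j)))"
      using pL L by (simp add: sum.delta')
    finally show "(\<Sum>i\<in>UNIV. \<Sum>j\<in>UNIV. kc (snd p - fst p) $ i * b (snd p - fst p) $ j * (a (fst p) $ i * cnj (a (snd p) $ j)))
      = (\<Sum>l\<in>L. \<Sum>i\<in>UNIV. \<Sum>j\<in>UNIV. kc l $ i * b l $ j * (if snd p - fst p = l then a (fst p) $ i * cnj (a (snd p) $ j) else 0))" ..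
  qed
  also have "\<dots> = (\<Sum>l\<in>L. \<Sum>i\<in>UNIV. \<Sum>j\<in>UNIV. kc l $ i * b l $ j * \<tau> i j l)"
  proof -
    have t: "\<tau> i j l = (\<Sum>p\<in>S\<times>S. if snd p - fst p = l then a (fst p) $ i * cnj (a (snd p) $ j) else 0)" for i j l
      unfolding \<tau>_def fcs_tensor by (simp add: split_beta)
    show ?thesis
      unfolding t sum_distrib_left
      by (subst sum.swap) (simp only: sum_2 sum.distrib)
  qed
  finally have e: "(\<Sum>(m,n)\<in>S\<times>S. triterm a b a (m, n - m)) = Re (\<i> * (\<Sum>l\<in>L. \<Sum>i\<in>UNIV. \<Sum>j\<in>UNIV. kc l $ i * b l $ j * \<tau> i j l))" .
  define T where "T l = sqrt (\<Sum>i\<in>UNIV. \<Sum>j\<in>UNIV. (cmod (\<tau> i j l))^2)" for l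
  have "\<bar>\<Sum>(m,n)\<in>S\<times>S. triterm a b a (m, n - m)\<bar> \<le> cmod (\<i> * (\<Sum>l\<in>L. \<Sum>i\<in>UNIV. \<Sum>j\<in>UNIV. kc l $ i * b l $ j * \<tau> i j l))"
    unfolding e by (rule abs_Re_le_cmod)
  also have "\<dots> \<le> (\<Sum>l\<in>L. norm (kc l) * norm (b l) * T l)"
    unfolding norm_mult T_def by (simp add: sum_norm_le[OF tensor_pairing_bound])
  also have "\<dots> = (\<Sum>l\<in>L. \<bar>sqrt (ksq l) * norm (b l)\<bar> * \<bar>T l\<bar>)"
    unfolding T_def by (simp add: norm_kc sum_nonneg)
  also have "\<dots> \<le> L2_set (\<lambda>l. sqrt (ksq l) * norm (b l)) L * L2_set T L"
    by (rule L2_set_mult_ineq)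
  also have "\<dots> \<le> seq_H1 b * (2 * pi * C * seq_H1 a * seq_L2 a)"
  proof (intro mult_mono)
    show "L2_set (\<lambda>l. sqrt (ksq l) * norm (b l)) L \<le> seq_H1 b"
      unfolding seq_H1_def by (rule L2_set_le_nrm2[OF b L])
    show "L2_set T L \<le> 2 * pi * C * seq_H1 a * seq_L2 a"
    proof -
      have V: "Vnorm ?u \<le> 2 * pi * seq_H1 a"
        unfolding Vnorm_eq_seq_H1 seq_H1_def using aH unfolding inH1_def
        by (intro mult_left_mono nrm2_mono(2)) (auto simp: fc_trig_field)
      have H: "Hnorm ?u \<le> 2 * pi * seq_L2 a"
        unfolding Hnorm_eq_seq_L2(2)[OF inL2_trig_field] seq_L2_def using inH1_ell2(1)[OF aH]
        by (intro mult_left_mono nrm2_mono(2)) (auto simp: fc_trig_field)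
      have "(L4norm ?u)^2 \<le> C * Vnorm ?u * Hnorm ?u"
        using CL inV_trig_field unfolding CL_const_def by blast
      also have "\<dots> \<le> C * (2 * pi * seq_H1 a) * (2 * pi * seq_L2 a)"
        using V H C by (intro mult_mono mult_left_mono) (auto simp: Hnorm_torus(2) seq_H1_def seq_L2_def)
      finally have L4: "(L4norm ?u)^2 \<le> C * (2 * pi * seq_H1 a) * (2 * pi * seq_L2 a)" .
      \<comment> \<open>The right-hand side is the square of
        \<open>4 * pi^2 * C * seq_H1 a * seq_L2 a\<close>; dividing by \<open>4 * pi^2\<close> and
        taking the root leaves the factor \<open>2 * pi\<close> of the statement.\<close>
      have "4 * pi^2 * (\<Sum>l\<in>L. (T l)^2) \<le> ((L4norm ?u)^2)^2"
        using tensor_bessel[OF L] unfolding T_def \<tau>_def by (simp add: sum_nonneg)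
      also have "\<dots> \<le> (C * (2 * pi * seq_H1 a) * (2 * pi * seq_L2 a))^2"
        using L4 by (intro power_mono) auto
      also have "\<dots> = 4 * pi^2 * (2 * pi * C * seq_H1 a * seq_L2 a)^2"
        by (simp add: power2_eq_square)
      finally have "(\<Sum>l\<in>L. (T l)^2) \<le> (2 * pi * C * seq_H1 a * seq_L2 a)^2" by simp
      then show ?thesis unfolding L2_set_def
        using C by (intro real_le_lsqrt) (auto simp: sum_nonneg seq_H1_def seq_L2_def)
    qed
  qed (auto simp: seq_H1_def)
  finally show ?thesis by (simp add: mult_ac)
qed

end

text \<open>The bound for truncations is uniform in the set of modes, so it passes to the absolutely
  convergent sum.\<close>

lemma tri_ladyzhenskaya:
  assumes CL: "CL_const C" and a: "wiener_H1 a" and b: "wiener_H1 b" and C: "0 \<le> C"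
  shows "\<bar>tri a b a\<bar> \<le> 2 * pi * C * seq_H1 a * seq_L2 a * seq_H1 b"
proof (rule field_le_epsilon)
  fix e :: real assume e: "0 < e"
  have "((\<lambda>F. sum (triterm a b a) F) \<longlongrightarrow> tri a b a) (finite_subsets_at_top UNIV)"
    unfolding tri_def by (rule infsum_tendsto[OF triterm_summable[OF a b a]])
  then have "\<forall>\<^sub>F F in finite_subsets_at_top UNIV. dist (sum (triterm a b a) F) (tri a b a) < e"
    using e by (rule tendstoD)
  then obtain F where F: "finite F" "\<And>G. finite G \<Longrightarrow> F \<subseteq> G \<Longrightarrow> dist (sum (triterm a b a) G) (tri a b a) < e"
    unfolding eventually_finite_subsets_at_top by auto
  \<comment> \<open>The truncation has to contain both outer wavenumbers, \<open>m\<close> and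
    \<open>m + l\<close>, of every pair in \<open>F\<close>; the reflected modes are then added for
    symmetry.\<close>
  define S0 where "S0 = fst ` F \<union> (\<lambda>(m,l). m + l) ` F"
  define S where "S = S0 \<union> uminus ` S0"
  have "finite S0" using F(1) by (simp add: S0_def)
  then have S: "finite S" "\<And>k. k \<in> S \<Longrightarrow> - k \<in> S" by (auto simp: S_def)
  define G where "G = (\<lambda>(m,n). (m, n - m)) ` (S \<times> S)"
  have G: "finite G" using S by (simp add: G_def)
  have "F \<subseteq> G"
  proof
    fix p assume p: "p \<in> F"
    then have "fst p \<in> S" "fst p + snd p \<in> S" by (force simp: S_def S0_def)+
    then have "(\<lambda>(m,n). (m, n - m)) (fst p, fst p + snd p) \<in> G" unfolding G_def by blast
    then show "p \<in> G" by simp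
  qed
  then have d: "dist (sum (triterm a b a) G) (tri a b a) < e" using F(2) G by blast
  have "sum (triterm a b a) G = (\<Sum>(m,n)\<in>S\<times>S. triterm a b a (m, n - m))"
    unfolding G_def by (subst sum.reindex) (auto simp: inj_on_def split_beta)
  then have "\<bar>sum (triterm a b a) G\<bar> \<le> 2 * pi * C * seq_H1 a * seq_L2 a * seq_H1 b"
    using trig_field_tri_bound[OF S _ CL _ _ C, of a b] a b by (simp add: wiener_H1_def inH1_def)
  then show "\<bar>tri a b a\<bar> \<le> 2 * pi * C * seq_H1 a * seq_L2 a * seq_H1 b + e"
    using d by (simp add: dist_real_def)
qed

section \<open>Energy balances\<close>

text \<open>A sequence cofinal among the finite sets of modes. It replaces the filter of finite
  subsets, so that dominated convergence along a sequence applies.\<close>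

definition mode_box :: "nat \<Rightarrow> (int \<times> int) set" where
  "mode_box n = {- int n..int n} \<times> {- int n..int n}"

lemma filterlim_mode_box: "filterlim mode_box (finite_subsets_at_top UNIV) sequentially"
  unfolding filterlim_finite_subsets_at_top
proof (intro allI impI)
  fix X :: "(int \<times> int) set" assume X: "finite X \<and> X \<subseteq> UNIV"
  define f where "f k = nat (max \<bar>fst k\<bar> \<bar>snd k\<bar>)" for k :: "int \<times> int"
  have "X \<subseteq> mode_box n" if "n \<ge> Max (insert 0 (f ` X))" for n
  proof
    fix k assume "k \<in> X"
    then have "f k \<le> n" using X that by simp
    then show "k \<in> mode_box n" by (cases k) (auto simp: f_def mode_box_def)
  qed
  then show "\<forall>\<^sub>F n in sequentially. finite (mode_box n) \<and> X \<subseteq> mode_box n \<and> mode_box n \<subseteq> UNIV"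
    unfolding eventually_sequentially by (auto simp: mode_box_def)
qed

lemma mode_box_sum_tendsto:
  fixes f :: "int \<times> int \<Rightarrow> real"
  assumes "f summable_on UNIV"
  shows "(\<lambda>n. sum f (mode_box n)) \<longlonglongrightarrow> infsum f UNIV"
  by (rule filterlim_compose[OF infsum_tendsto[OF assms] filterlim_mode_box])

lemma finite_mode_box [simp]: "finite (mode_box n)"
  by (simp add: mode_box_def)

lemma primitive_from_norm_sq:
  fixes x f :: "real \<Rightarrow> complex^2"
  assumes "\<And>t. 0 \<le> t \<Longrightarrow> set_integrable lborel {0..t} f"
    and "\<And>t. 0 \<le> t \<Longrightarrow> x t = x 0 + (LINT s:{0..t}|lborel. f s)"
  shows "primitive_from 0 (\<lambda>t. (norm (x t))^2) (\<lambda>t. 2 * (x t \<bullet> f t))"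
proof -
  have p: "primitive_from 0 (\<lambda>t. x t \<bullet> b) (\<lambda>t. f t \<bullet> b)" for b
    unfolding primitive_from_def
  proof (intro allI impI conjI)
    fix t :: real assume t: "0 \<le> t"
    have i: "integrable lborel (\<lambda>s. indicator {0..t} s *\<^sub>R f s)"
      using assms(1)[OF t] by (simp add: set_integrable_def)
    show "set_integrable lborel {0..t} (\<lambda>t. f t \<bullet> b)"
      using integrable_inner_left[OF i, of b] by (simp add: set_integrable_def)
    show "x t \<bullet> b = x 0 \<bullet> b + (LINT s:{0..t}|lborel. f s \<bullet> b)"
      using integral_inner_left[OF i, of b] unfolding assms(2)[OF t]
      by (simp add: set_lebesgue_integral_def inner_add_left)
  qed
  have "primitive_from 0 (\<lambda>t. \<Sum>b\<in>Basis. (x t \<bullet> b) * (x t \<bullet> b))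
      (\<lambda>t. \<Sum>b\<in>Basis. (f t \<bullet> b) * (x t \<bullet> b) + (f t \<bullet> b) * (x t \<bullet> b))"
    by (rule primitive_from_sum) (simp, rule primitive_from_mult[OF p p])
  moreover have "(\<Sum>b\<in>Basis. (x t \<bullet> b) * (x t \<bullet> b)) = (norm (x t))^2" for t
    by (simp add: euclidean_inner[of "x t" "x t"] power2_norm_eq_inner)
  moreover have "(\<Sum>b\<in>Basis. (f t \<bullet> b) * (x t \<bullet> b) + (f t \<bullet> b) * (x t \<bullet> b)) = 2 * (x t \<bullet> f t)" for t
    by (simp add: euclidean_inner[of "x t" "f t"] sum_distrib_left mult.commute)
  ultimately show ?thesis by simp
qed

text \<open>Each mode is absolutely continuous in time, which gives the balance on every finite box.
  The dominating function carries it to the limit; it may depend on \<open>T\<close> because the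
  solution is controlled only on bounded intervals.\<close>

lemma energy_identity:
  fixes x f :: "real \<Rightarrow> cseq"
  assumes int: "\<And>t k. 0 \<le> t \<Longrightarrow> set_integrable lborel {0..t} (\<lambda>s. f s k)"
    and eq: "\<And>t k. 0 \<le> t \<Longrightarrow> x t k = x 0 k + (LINT s:{0..t}|lborel. f s k)"
    and x: "\<And>t. 0 \<le> t \<Longrightarrow> ell2 (\<lambda>k. norm (x t k))"
    and D: "\<And>T. 0 \<le> T \<Longrightarrow> set_integrable lborel {0..T} (D T)"
    and dom: "\<And>T. 0 \<le> T \<Longrightarrow> AE s in lborel. s \<in> {0..T} \<longrightarrow>
        (\<lambda>k. \<bar>x s k \<bullet> f s k\<bar>) summable_on UNIV \<and> (\<Sum>\<^sub>\<infinity>k. \<bar>x s k \<bullet> f s k\<bar>) \<le> D T s"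
  shows "\<exists>h. primitive_from 0 (\<lambda>t. (seq_L2 (x t))^2) h \<and>
      (AE t in lborel. 0 \<le> t \<longrightarrow> h t = 2 * (\<Sum>\<^sub>\<infinity>k. x t k \<bullet> f t k))"
proof -
  define g where "g n t = (\<Sum>k\<in>mode_box n. 2 * (x t k \<bullet> f t k))" for n t
  \<comment> \<open>Defining the density as a limit at every time makes it measurable; its value is
    identified with the infinite sum only almost everywhere.\<close>
  define h where "h t = lim (\<lambda>n. g n t)" for t
  have pk: "primitive_from 0 (\<lambda>t. (norm (x t k))^2) (\<lambda>t. 2 * (x t k \<bullet> f t k))" for k
    by (rule primitive_from_norm_sq[OF int eq])
  have pg: "primitive_from 0 (\<lambda>t. \<Sum>k\<in>mode_box n. (norm (x t k))^2) (g n)" for n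
    unfolding g_def by (rule primitive_from_sum) (simp_all add: pk)
  have lim: "g n t \<le> 2 * D T t" "- g n t \<le> 2 * D T t" "(\<lambda>n. g n t) \<longlonglongrightarrow> h t" "h t = 2 * (\<Sum>\<^sub>\<infinity>k. x t k \<bullet> f t k)"
    if s: "(\<lambda>k. \<bar>x t k \<bullet> f t k\<bar>) summable_on UNIV" "(\<Sum>\<^sub>\<infinity>k. \<bar>x t k \<bullet> f t k\<bar>) \<le> D T t" for n t T
  proof -
    have "\<bar>g n t\<bar> \<le> 2 * (\<Sum>k\<in>mode_box n. \<bar>x t k \<bullet> f t k\<bar>)"
      unfolding g_def sum_distrib_left by (rule order_trans[OF sum_abs]) (simp add: abs_mult)
    also have "(\<Sum>k\<in>mode_box n. \<bar>x t k \<bullet> f t k\<bar>) \<le> (\<Sum>\<^sub>\<infinity>k. \<bar>x t k \<bullet> f t k\<bar>)"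
      using s(1) by (intro finite_sum_le_infsum) auto
    finally show "g n t \<le> 2 * D T t" "- g n t \<le> 2 * D T t" using s(2) by linarith+
    have "(\<lambda>k. x t k \<bullet> f t k) summable_on UNIV"
      using s(1) summable_on_iff_abs_summable_on_real[of "\<lambda>k. x t k \<bullet> f t k" UNIV] by simp
    from tendsto_mult_left[OF mode_box_sum_tendsto[OF this], of 2]
    have c: "(\<lambda>n. g n t) \<longlonglongrightarrow> 2 * (\<Sum>\<^sub>\<infinity>k. x t k \<bullet> f t k)"
      unfolding g_def sum_distrib_left .
    then show e: "h t = 2 * (\<Sum>\<^sub>\<infinity>k. x t k \<bullet> f t k)" unfolding h_def by (rule limI)
    show "(\<lambda>n. g n t) \<longlonglongrightarrow> h t" using c e by simp
  qed
  have hAE: "AE t in lborel. 0 \<le> t \<longrightarrow> h t = 2 * (\<Sum>\<^sub>\<infinity>k. x t k \<bullet> f t k)"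
  proof -
    \<comment> \<open>The domination holds almost everywhere on each bounded interval, so countably
      many intervals are combined.\<close>
    have "AE t in lborel. \<forall>m::nat. t \<in> {0..real m} \<longrightarrow> h t = 2 * (\<Sum>\<^sub>\<infinity>k. x t k \<bullet> f t k)"
      unfolding AE_all_countable
    proof
      fix m :: nat
      show "AE t in lborel. t \<in> {0..real m} \<longrightarrow> h t = 2 * (\<Sum>\<^sub>\<infinity>k. x t k \<bullet> f t k)"
        using dom[of "real m", OF of_nat_0_le_iff] by eventually_elim (use lim(4) in blast)
    qed
    then show ?thesis
    proof eventually_elim
      case (elim t)
      obtain m :: nat where "t \<le> real m" using real_arch_simple by blast
      then show ?case using elim by auto
    qed
  qed
  have "primitive_from 0 (\<lambda>t. (seq_L2 (x t))^2) h"
    unfolding primitive_from_def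
  proof (intro allI impI)
    fix T :: real assume T: "0 \<le> T"
    have gi: "integrable lborel (\<lambda>t. indicator {0..T} t *\<^sub>R g n t)" for n
      using primitive_fromD(1)[OF pg T] by (simp add: set_integrable_def)
    have "(\<lambda>t. lim (\<lambda>n. indicator {0..T} t *\<^sub>R g n t)) \<in> borel_measurable lborel"
      by (rule borel_measurable_lim_metric) (use gi in auto)
    moreover have "lim (\<lambda>n. indicator {0..T} t *\<^sub>R g n t) = indicator {0..T} t *\<^sub>R h t" for t
      by (cases "t \<in> {0..T}") (auto simp: h_def)
    ultimately have hm: "(\<lambda>t. indicator {0..T} t *\<^sub>R h t) \<in> borel_measurable lborel" by simp
    have Di: "integrable lborel (\<lambda>t. 2 * (indicator {0..T} t *\<^sub>R D T t))"
      using D[OF T] by (intro integrable_mult_right) (simp add: set_integrable_def)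
    have A: "AE t in lborel. (\<lambda>n. indicator {0..T} t *\<^sub>R g n t) \<longlonglongrightarrow> indicator {0..T} t *\<^sub>R h t"
      using dom[OF T]
    proof eventually_elim
      case (elim t)
      show ?case
      proof (cases "t \<in> {0..T}")
        case True
        then show ?thesis using lim(3)[of t T] elim by simp
      qed simp
    qed
    have B: "AE t in lborel. norm (indicator {0..T} t *\<^sub>R g n t) \<le> 2 * (indicator {0..T} t *\<^sub>R D T t)" for n
      using dom[OF T]
    proof eventually_elim
      case (elim t)
      show ?case
      proof (cases "t \<in> {0..T}")
        case True
        then show ?thesis using lim(1,2)[of t T n] elim by simp
      qed simp
    qed
    note dc = integrable_dominated_convergence[OF hm borel_measurable_integrable[OF gi] Di A B]
      integral_dominated_convergence[OF hm borel_measurable_integrable[OF gi] Di A B]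
    show "set_integrable lborel {0..T} h \<and> (seq_L2 (x T))^2 = (seq_L2 (x 0))^2 + (LINT s:{0..T}|lborel. h s)"
    proof
      show "set_integrable lborel {0..T} h" using dc(1) by (simp add: set_integrable_def)
      have c: "(\<lambda>n. \<Sum>k\<in>mode_box n. (norm (x t k))^2) \<longlonglongrightarrow> (seq_L2 (x t))^2" if "0 \<le> t" for t
        unfolding seq_L2_def nrm2_sq by (rule mode_box_sum_tendsto) (use x[OF that] in \<open>simp add: ell2_def\<close>)
      have "(\<lambda>n. (\<Sum>k\<in>mode_box n. (norm (x 0 k))^2) + (LINT s:{0..T}|lborel. g n s))
          \<longlonglongrightarrow> (seq_L2 (x 0))^2 + (LINT s:{0..T}|lborel. h s)"
        using dc(2) c[of 0] unfolding set_lebesgue_integral_def by (intro tendsto_add) auto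
      then have "(\<lambda>n. \<Sum>k\<in>mode_box n. (norm (x T k))^2) \<longlonglongrightarrow> (seq_L2 (x 0))^2 + (LINT s:{0..T}|lborel. h s)"
        unfolding primitive_fromD(2)[OF pg T, symmetric] .
      then show "(seq_L2 (x T))^2 = (seq_L2 (x 0))^2 + (LINT s:{0..T}|lborel. h s)"
        using c[OF T] LIMSEQ_unique by blast
    qed
  qed
  with hAE show ?thesis by blast
qed

section \<open>Linear combinations and restrictions to sets of modes\<close>

lemma seq_H1_lincomb:
  assumes "ell2 (\<lambda>k. sqrt (ksq k) * norm (a k))" "ell2 (\<lambda>k. sqrt (ksq k) * norm (b k))"
    and "\<And>k. norm (c k) \<le> \<bar>r\<bar> * norm (a k) + \<bar>s\<bar> * norm (b k)"
  shows "ell2 (\<lambda>k. sqrt (ksq k) * norm (c k))" "seq_H1 c \<le> \<bar>r\<bar> * seq_H1 a + \<bar>s\<bar> * seq_H1 b"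
proof -
  have *: "\<bar>sqrt (ksq k) * norm (c k)\<bar>
      \<le> \<bar>\<bar>r\<bar> * (sqrt (ksq k) * norm (a k))\<bar> + \<bar>\<bar>s\<bar> * (sqrt (ksq k) * norm (b k))\<bar>" for k
    using mult_left_mono[OF assms(3), of "sqrt (ksq k)" k] by (simp add: abs_mult algebra_simps)
  note t = nrm2_triangle[OF nrm2_cmult(1)[OF assms(1), of "\<bar>r\<bar>"] nrm2_cmult(1)[OF assms(2), of "\<bar>s\<bar>"] *]
  show "ell2 (\<lambda>k. sqrt (ksq k) * norm (c k))" by (rule t(1))
  show "seq_H1 c \<le> \<bar>r\<bar> * seq_H1 a + \<bar>s\<bar> * seq_H1 b"
    using t(2) by (simp add: seq_H1_def nrm2_cmult(2)[OF assms(1)] nrm2_cmult(2)[OF assms(2)])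
qed

lemma seq_L2_lincomb:
  assumes "ell2 (\<lambda>k. norm (a k))" "ell2 (\<lambda>k. norm (b k))"
    and "\<And>k. norm (c k) \<le> \<bar>r\<bar> * norm (a k) + \<bar>s\<bar> * norm (b k)"
  shows "ell2 (\<lambda>k. norm (c k))" "seq_L2 c \<le> \<bar>r\<bar> * seq_L2 a + \<bar>s\<bar> * seq_L2 b"
proof -
  have *: "\<bar>norm (c k)\<bar> \<le> \<bar>\<bar>r\<bar> * norm (a k)\<bar> + \<bar>\<bar>s\<bar> * norm (b k)\<bar>" for k
    using assms(3) by (simp add: abs_mult)
  note t = nrm2_triangle[OF nrm2_cmult(1)[OF assms(1), of "\<bar>r\<bar>"] nrm2_cmult(1)[OF assms(2), of "\<bar>s\<bar>"] *]
  show "ell2 (\<lambda>k. norm (c k))" by (rule t(1))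
  show "seq_L2 c \<le> \<bar>r\<bar> * seq_L2 a + \<bar>s\<bar> * seq_L2 b"
    using t(2) by (simp add: seq_L2_def nrm2_cmult(2)[OF assms(1)] nrm2_cmult(2)[OF assms(2)])
qed

lemma norm_lincomb: "norm (r *\<^sub>R x + s *\<^sub>R y) \<le> \<bar>r\<bar> * norm x + \<bar>s\<bar> * norm y"
  by (rule order_trans[OF norm_triangle_ineq]) simp

lemma inH1_lincomb:
  assumes "inH1 a" "inH1 b"
  shows "inH1 (\<lambda>k. r *\<^sub>R a k + s *\<^sub>R b k)" "seq_H1 (\<lambda>k. r *\<^sub>R a k + s *\<^sub>R b k) \<le> \<bar>r\<bar> * seq_H1 a + \<bar>s\<bar> * seq_H1 b"
proof -
  have e: "ell2 (\<lambda>k. sqrt (ksq k) * norm (a k))" "ell2 (\<lambda>k. sqrt (ksq k) * norm (b k))"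
    using assms by (auto simp: inH1_def)
  note l = seq_H1_lincomb[OF e norm_lincomb[of r "a _" s "b _"]]
  show "seq_H1 (\<lambda>k. r *\<^sub>R a k + s *\<^sub>R b k) \<le> \<bar>r\<bar> * seq_H1 a + \<bar>s\<bar> * seq_H1 b" by (rule l(2))
  show "inH1 (\<lambda>k. r *\<^sub>R a k + s *\<^sub>R b k)"
    using assms l(1) by (auto simp: inH1_def solenoidal_def dotk_add dotk_scaleR)
qed

lemma wiener_H1_lincomb:
  assumes "wiener_H1 a" "wiener_H1 b" shows "wiener_H1 (\<lambda>k. r *\<^sub>R a k + s *\<^sub>R b k)"
  by (rule wiener_H1_add[OF wiener_H1_scaleR[OF assms(1)] wiener_H1_scaleR[OF assms(2)]])

definition restrict_modes :: "(int \<times> int \<Rightarrow> bool) \<Rightarrow> cseq \<Rightarrow> cseq" where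
  "restrict_modes K a k = (if K k then a k else 0)"

lemma restrict_modes_inH1:
  assumes "inH1 a" "\<And>k. K (- k) = K k"
  shows "inH1 (restrict_modes K a)" "seq_H1 (restrict_modes K a) \<le> seq_H1 a"
proof -
  have "ell2 (\<lambda>k. sqrt (ksq k) * norm (a k))" using assms by (simp add: inH1_def)
  note m = nrm2_mono[OF this, of "\<lambda>k. sqrt (ksq k) * norm (restrict_modes K a k)"]
  show "seq_H1 (restrict_modes K a) \<le> seq_H1 a" unfolding seq_H1_def by (rule m(2)) (simp add: restrict_modes_def)
  have "solenoidal (restrict_modes K a)"
    unfolding solenoidal_def
  proof (intro conjI allI)
    have a: "solenoidal a" using assms(1) by (simp add: inH1_def)
    show "restrict_modes K a 0 = 0" using solenoidal_0[OF a] by (simp add: restrict_modes_def)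
    show "dotk (restrict_modes K a k) k = 0" for k
      using solenoidal_dotk[OF a, of k] by (simp add: restrict_modes_def) (simp add: dotk_def)
    show "restrict_modes K a (- k) $ i = cnj (restrict_modes K a k $ i)" for k i
      using solenoidal_cnj[OF a, of k i] assms(2)[of k] by (simp add: restrict_modes_def)
  qed
  then show "inH1 (restrict_modes K a)"
    unfolding inH1_def using m(1) by (simp add: restrict_modes_def)
qed

lemma restrict_modes_wiener_H1:
  assumes "wiener_H1 a" "\<And>k. K (- k) = K k"
  shows "wiener_H1 (restrict_modes K a)"
proof -
  have "(\<lambda>k. norm (restrict_modes K a k)) summable_on UNIV"
    by (rule summable_on_comparison_test[of "\<lambda>k. norm (a k)"])
       (use assms in \<open>auto simp: wiener_H1_def restrict_modes_def\<close>)
  then show ?thesis using assms restrict_modes_inH1(1)[of a K] by (simp add: wiener_H1_def)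
qed

lemma h1_has_sum:
  assumes "inH1 a" shows "((\<lambda>k. ksq k * (norm (a k))^2) has_sum (seq_H1 a)^2) UNIV"
  using assms unfolding inH1_def seq_H1_def nrm2_sq ell2_def
  by (simp add: power_mult_distrib has_sum_infsum)

lemma inner_ell2:
  assumes "ell2 (\<lambda>k. norm (x k))" "ell2 (\<lambda>k. norm (y k))"
  shows "(\<lambda>k. x k \<bullet> y k) summable_on UNIV" "(\<lambda>k. \<bar>x k \<bullet> y k\<bar>) summable_on UNIV"
    "(\<Sum>\<^sub>\<infinity>k. \<bar>x k \<bullet> y k\<bar>) \<le> seq_L2 x * seq_L2 y" "\<bar>\<Sum>\<^sub>\<infinity>k. x k \<bullet> y k\<bar> \<le> seq_L2 x * seq_L2 y"
proof -
  note cs = cauchy_schwarz_ell2[OF assms, simplified]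
  show s: "(\<lambda>k. \<bar>x k \<bullet> y k\<bar>) summable_on UNIV"
    by (rule summable_on_comparison_test[OF cs(1)]) (auto simp: Cauchy_Schwarz_ineq2)
  then show "(\<lambda>k. x k \<bullet> y k) summable_on UNIV"
    using summable_on_iff_abs_summable_on_real[of "\<lambda>k. x k \<bullet> y k" UNIV] by simp
  have "(\<Sum>\<^sub>\<infinity>k. \<bar>x k \<bullet> y k\<bar>) \<le> (\<Sum>\<^sub>\<infinity>k. norm (x k) * norm (y k))"
    by (rule infsum_mono[OF s cs(1)]) (rule Cauchy_Schwarz_ineq2)
  also have "\<dots> \<le> seq_L2 x * seq_L2 y" using cs(2) by (simp add: seq_L2_def)
  finally show b: "(\<Sum>\<^sub>\<infinity>k. \<bar>x k \<bullet> y k\<bar>) \<le> seq_L2 x * seq_L2 y" .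
  have "\<bar>\<Sum>\<^sub>\<infinity>k. x k \<bullet> y k\<bar> \<le> (\<Sum>\<^sub>\<infinity>k. \<bar>x k \<bullet> y k\<bar>)"
    using norm_infsum_bound[of "\<lambda>k. x k \<bullet> y k" UNIV] s by simp
  then show "\<bar>\<Sum>\<^sub>\<infinity>k. x k \<bullet> y k\<bar> \<le> seq_L2 x * seq_L2 y" using b by linarith
qed

text \<open>The \<ell>1 norm of the advecting coefficients is at most a constant times
  \<open>Anorm u\<close>, and this is replaced by \<open>1 + (Anorm u)^2\<close> because it is the
  square that is integrable in time.\<close>

lemma Bc_inner_sums:
  assumes u: "inV u" "inDA u" and x: "wiener_H1 x"
  shows "((\<lambda>k. Bc u u k \<bullet> x k) has_sum tri (fc u) (fc u) x) UNIV"
    "(\<lambda>k. \<bar>Bc u u k \<bullet> x k\<bar>) summable_on UNIV"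
    "(\<Sum>\<^sub>\<infinity>k. \<bar>Bc u u k \<bullet> x k\<bar>) \<le> nrm2 (\<lambda>k. 1 / ksq k) * (1 + (Anorm u)^2) * (seq_H1 (fc u) * seq_L2 x)"
proof -
  have e: "Bc u u k \<bullet> x k = conv (fc u) (fc u) k \<bullet> x k" for k
    using x by (intro Bc_inner) (simp add: wiener_H1_def inH1_def)
  note a = inDA_wiener_H1[OF u]
  note c = conv_inner[OF a(1) a(1) x]
  show "((\<lambda>k. Bc u u k \<bullet> x k) has_sum tri (fc u) (fc u) x) UNIV"
    using c(1,2) unfolding e by (metis has_sum_infsum)
  show "(\<lambda>k. \<bar>Bc u u k \<bullet> x k\<bar>) summable_on UNIV" unfolding e by (rule c(3))
  have "Anorm u \<le> 1 + (Anorm u)^2"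
  proof -
    have "2 * Anorm u \<le> 1 + (Anorm u)^2"
      using zero_le_power2[of "Anorm u - 1"] by (simp add: power2_diff)
    then show ?thesis using zero_le_power2[of "Anorm u"] by linarith
  qed
  then have "seq_l1 (fc u) \<le> nrm2 (\<lambda>k. 1 / ksq k) * (1 + (Anorm u)^2)"
    using a(2) mult_left_mono[of "Anorm u" "1 + (Anorm u)^2" "nrm2 (\<lambda>k. 1 / ksq k)"] by simp
  then have "seq_l1 (fc u) * (seq_H1 (fc u) * seq_L2 x) \<le> nrm2 (\<lambda>k. 1 / ksq k) * (1 + (Anorm u)^2) * (seq_H1 (fc u) * seq_L2 x)"
    by (intro mult_right_mono) (auto simp: seq_H1_def seq_L2_def)
  then show "(\<Sum>\<^sub>\<infinity>k. \<bar>Bc u u k \<bullet> x k\<bar>) \<le> nrm2 (\<lambda>k. 1 / ksq k) * (1 + (Anorm u)^2) * (seq_H1 (fc u) * seq_L2 x)"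
    unfolding e using c(4) by linarith
qed

section \<open>Balances along a pair of strong trajectories\<close>

locale flow_pair =
  fixes \<nu> :: real and v1 v2 :: "real \<Rightarrow> field"
  assumes \<nu>: "\<nu> > 0" and reg1: "strong_reg v1" and reg2: "strong_reg v2"
begin

abbreviation "a1 t \<equiv> fc (v1 t)"
abbreviation "a2 t \<equiv> fc (v2 t)"

lemma inV1: "0 \<le> t \<Longrightarrow> inV (v1 t)" and inV2: "0 \<le> t \<Longrightarrow> inV (v2 t)"
  using reg1 reg2 by (auto simp: strong_reg_def)

lemma inH1_a1: "0 \<le> t \<Longrightarrow> inH1 (a1 t)" and inH1_a2: "0 \<le> t \<Longrightarrow> inH1 (a2 t)"
  by (simp_all add: inV_inH1 inV1 inV2)

lemma inL2_v1: "0 \<le> t \<Longrightarrow> inL2 (v1 t)" and inL2_v2: "0 \<le> t \<Longrightarrow> inL2 (v2 t)"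
  using inV1 inV2 by (auto simp: inV_def inH_def)

lemma AE_inDA: "AE t in lborel. 0 \<le> t \<longrightarrow> inDA (v1 t) \<and> inDA (v2 t)"
proof -
  have "AE t in lborel. 0 \<le> t \<longrightarrow> inDA (v1 t)" "AE t in lborel. 0 \<le> t \<longrightarrow> inDA (v2 t)"
    using reg1 reg2 by (simp_all add: strong_reg_def)
  then show ?thesis by eventually_elim blast
qed

text \<open>The triangle inequality in both directions transfers the continuity in V. It yields
  bounds on compact time intervals and the local integrability of the enstrophy of V.\<close>

lemma continuous_seq_H1:
  "continuous_on {0..} (\<lambda>t. seq_H1 (\<lambda>k. r *\<^sub>R a1 t k + s *\<^sub>R a2 t k))"
  unfolding continuous_on_def
proof
  fix t :: real assume t: "t \<in> {0..}"
  let ?x = "\<lambda>t k. r *\<^sub>R a1 t k + s *\<^sub>R a2 t k"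
  let ?b = "\<lambda>u. \<bar>r\<bar> * (Vnorm (v1 u - v1 t) / (2 * pi)) + \<bar>s\<bar> * (Vnorm (v2 u - v2 t) / (2 * pi))"
  have lim: "((\<lambda>u. Vnorm (v1 u - v1 t)) \<longlongrightarrow> 0) (at t within {0..})"
    "((\<lambda>u. Vnorm (v2 u - v2 t)) \<longlongrightarrow> 0) (at t within {0..})"
    using reg1 reg2 t by (auto simp: strong_reg_def)
  have b0: "(?b \<longlongrightarrow> \<bar>r\<bar> * (0 / (2 * pi)) + \<bar>s\<bar> * (0 / (2 * pi))) (at t within {0..})"
    by (intro tendsto_intros lim) auto
  have "\<bar>seq_H1 (?x u) - seq_H1 (?x t)\<bar> \<le> ?b u" if u: "0 \<le> u" for u
  proof -
    have t0: "0 \<le> t" using t by simp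
    have D1: "fc (v1 u - v1 t) = (\<lambda>k. 1 *\<^sub>R a1 u k + (-1) *\<^sub>R a1 t k)"
      using fc_diff(2)[OF inL2_v1[OF u] inL2_v1[OF t0]] by (auto simp: fun_eq_iff)
    have D2: "fc (v2 u - v2 t) = (\<lambda>k. 1 *\<^sub>R a2 u k + (-1) *\<^sub>R a2 t k)"
      using fc_diff(2)[OF inL2_v2[OF u] inL2_v2[OF t0]] by (auto simp: fun_eq_iff)
    have i1: "inH1 (fc (v1 u - v1 t))" unfolding D1 by (intro inH1_lincomb inH1_a1 u t0)
    have i2: "inH1 (fc (v2 u - v2 t))" unfolding D2 by (intro inH1_lincomb inH1_a2 u t0)
    have x: "inH1 (?x u)" "inH1 (?x t)" by (intro inH1_lincomb inH1_a1 inH1_a2 u t0)+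
    note d = inH1_lincomb[OF i1 i2, of r s]
    have e: "?x u = (\<lambda>k. 1 *\<^sub>R ?x t k + 1 *\<^sub>R (r *\<^sub>R fc (v1 u - v1 t) k + s *\<^sub>R fc (v2 u - v2 t) k))"
      unfolding D1 D2 by (auto simp: algebra_simps)
    have e': "?x t = (\<lambda>k. 1 *\<^sub>R ?x u k + (-1) *\<^sub>R (r *\<^sub>R fc (v1 u - v1 t) k + s *\<^sub>R fc (v2 u - v2 t) k))"
      unfolding D1 D2 by (auto simp: algebra_simps)
    have "seq_H1 (?x u) \<le> seq_H1 (?x t) + seq_H1 (\<lambda>k. r *\<^sub>R fc (v1 u - v1 t) k + s *\<^sub>R fc (v2 u - v2 t) k)"
      by (subst e) (use inH1_lincomb(2)[OF x(2) d(1), of 1 1] in simp)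
    moreover have "seq_H1 (?x t) \<le> seq_H1 (?x u) + seq_H1 (\<lambda>k. r *\<^sub>R fc (v1 u - v1 t) k + s *\<^sub>R fc (v2 u - v2 t) k)"
      by (subst e') (use inH1_lincomb(2)[OF x(1) d(1), of 1 "-1"] in simp)
    ultimately show ?thesis using d(2) by (simp add: Vnorm_eq_seq_H1)
  qed
  then have "((\<lambda>u. seq_H1 (?x u) - seq_H1 (?x t)) \<longlongrightarrow> 0) (at t within {0..})"
    by (intro Lim_null_comparison[OF _ b0[simplified]])
       (auto simp: eventually_at_topological real_norm_def)
  then show "((\<lambda>u. seq_H1 (?x u)) \<longlongrightarrow> seq_H1 (?x t)) (at t within {0..})"
    by (rule LIM_zero_cancel)
qed

lemma seq_H1_locally_bounded: "\<exists>M\<ge>0. \<forall>t\<in>{0..T}. seq_H1 (a1 t) + seq_H1 (a2 t) \<le> M"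
proof -
  have "continuous_on {0..T} (\<lambda>t. seq_H1 (a1 t) + seq_H1 (a2 t))"
    using continuous_seq_H1[of 1 0] continuous_seq_H1[of 0 1]
    by (intro continuous_on_add) (auto elim: continuous_on_subset)
  then have "bounded ((\<lambda>t. seq_H1 (a1 t) + seq_H1 (a2 t)) ` {0..T})"
    by (intro compact_imp_bounded compact_continuous_image) auto
  then obtain M where "\<forall>y\<in>(\<lambda>t. seq_H1 (a1 t) + seq_H1 (a2 t)) ` {0..T}. norm y \<le> M"
    unfolding bounded_iff by blast
  then have "\<forall>t\<in>{0..T}. seq_H1 (a1 t) + seq_H1 (a2 t) \<le> max 0 M" by (force simp: real_norm_def)
  then show ?thesis by (intro exI[of _ "max 0 M"]) simp
qed

text \<open>One balance for V, P and Q: they differ in the coefficients \<open>c1\<close>,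
  \<open>c2\<close> of the two nonlinearities and in the forcing \<open>el\<close>. Only the pairing
  \<open>x s k \<bullet> f s k\<close> is prescribed, which lets restrictions to sets of modes and
  the cancellation by the coupling be settled mode by mode.\<close>

lemma energy_balance:
  fixes x el f :: "real \<Rightarrow> cseq"
  assumes int: "\<And>t k. 0 \<le> t \<Longrightarrow> set_integrable lborel {0..t} (\<lambda>s. f s k)"
    and eq: "\<And>t k. 0 \<le> t \<Longrightarrow> x t k = x 0 k + (LINT s:{0..t}|lborel. f s k)"
    and x: "\<And>t. 0 \<le> t \<Longrightarrow> inH1 (x t)"
    and xadm: "\<And>t. 0 \<le> t \<Longrightarrow> wiener_H1 (a1 t) \<Longrightarrow> wiener_H1 (a2 t) \<Longrightarrow> wiener_H1 (x t)"
    and xb: "\<And>t. 0 \<le> t \<Longrightarrow> seq_H1 (x t) \<le> seq_H1 (a1 t) + seq_H1 (a2 t)"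
    and el: "\<And>t. 0 \<le> t \<Longrightarrow> ell2 (\<lambda>k. norm (el t k))" "\<And>t. 0 \<le> t \<Longrightarrow> seq_L2 (el t) \<le> B"
    and f: "\<And>s k. 0 \<le> s \<Longrightarrow> x s k \<bullet> f s k = - \<nu> * (ksq k * (norm (x s k))^2) + x s k \<bullet> el s k
      - (c1 * (Bc (v1 s) (v1 s) k \<bullet> x s k) + c2 * (Bc (v2 s) (v2 s) k \<bullet> x s k))"
  shows "\<exists>h. primitive_from 0 (\<lambda>t. (seq_L2 (x t))^2) h \<and>
    (AE t in lborel. 0 \<le> t \<longrightarrow> h t = - 2 * \<nu> * (seq_H1 (x t))^2 + 2 * (\<Sum>\<^sub>\<infinity>k. x t k \<bullet> el t k)
      - 2 * (c1 * tri (a1 t) (a1 t) (x t) + c2 * tri (a2 t) (a2 t) (x t)))"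
proof -
  define \<kappa> where "\<kappa> = nrm2 (\<lambda>k. 1 / ksq k)"
  have \<kappa>: "0 \<le> \<kappa>" by (simp add: \<kappa>_def)
  define M where "M T = (SOME M. M \<ge> 0 \<and> (\<forall>t\<in>{0..T}. seq_H1 (a1 t) + seq_H1 (a2 t) \<le> M))" for T
  have M: "M T \<ge> 0" "\<And>t. 0 \<le> t \<Longrightarrow> t \<le> T \<Longrightarrow> seq_H1 (a1 t) + seq_H1 (a2 t) \<le> M T" for T
    using someI_ex[OF seq_H1_locally_bounded[of T]] unfolding M_def by auto
  have B: "0 \<le> B" using el(2)[of 0] nrm2_nonneg[of "\<lambda>k. norm (el 0 k)"] unfolding seq_L2_def by linarith
  \<comment> \<open>On \<open>[0, T]\<close> all H1 norms are at most \<open>M T\<close>; the time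
    dependence sits in the squares of \<open>Anorm\<close>, which are integrable there.\<close>
  define D where "D T s = \<nu> * (M T)^2 + M T * B
      + (\<bar>c1\<bar> * (\<kappa> * (1 + (Anorm (v1 s))^2) * (M T * M T)) + \<bar>c2\<bar> * (\<kappa> * (1 + (Anorm (v2 s))^2) * (M T * M T)))" for T s
  have Di: "set_integrable lborel {0..T} (D T)" if "0 \<le> T" for T
  proof -
    have "set_integrable lborel {0..T+1} (\<lambda>t. (Anorm (v1 t))^2)" "set_integrable lborel {0..T+1} (\<lambda>t. (Anorm (v2 t))^2)"
      using reg1 reg2 that by (auto simp: strong_reg_def)
    then have A: "set_integrable lborel {0..T} (\<lambda>t. (Anorm (v1 t))^2)" "set_integrable lborel {0..T} (\<lambda>t. (Anorm (v2 t))^2)"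
      by (auto elim: set_integrable_subset)
    have c: "set_integrable lborel {0..T} (\<lambda>t. c)" for c :: real
      by (intro borel_integrable_atLeastAtMost' continuous_intros)
    show ?thesis unfolding D_def[abs_def]
      by (intro set_integral_add(1) set_integrable_mult_right set_integrable_mult_left c A)
  qed
  have main: "(\<lambda>k. \<bar>x s k \<bullet> f s k\<bar>) summable_on UNIV \<and> (\<Sum>\<^sub>\<infinity>k. \<bar>x s k \<bullet> f s k\<bar>) \<le> D T s \<and>
      (\<Sum>\<^sub>\<infinity>k. x s k \<bullet> f s k) = - \<nu> * (seq_H1 (x s))^2 + (\<Sum>\<^sub>\<infinity>k. x s k \<bullet> el s k)
        - (c1 * tri (a1 s) (a1 s) (x s) + c2 * tri (a2 s) (a2 s) (x s))"
    if s: "0 \<le> s" "s \<le> T" and DA: "inDA (v1 s)" "inDA (v2 s)" for s T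
  proof -
    have xs: "wiener_H1 (x s)" using xadm[OF s(1)] inDA_wiener_H1(1) inV1 inV2 s DA by blast
    note b1 = Bc_inner_sums[OF inV1[OF s(1)] DA(1) xs, folded \<kappa>_def]
    note b2 = Bc_inner_sums[OF inV2[OF s(1)] DA(2) xs, folded \<kappa>_def]
    note xe = inner_ell2[OF inH1_ell2(1)[OF x[OF s(1)]] el(1)[OF s(1)]]
    note h1 = h1_has_sum[OF x[OF s(1)]]
    have pos: "0 \<le> seq_H1 (a1 s)" "0 \<le> seq_H1 (a2 s)" "0 \<le> seq_H1 (x s)" "0 \<le> seq_L2 (x s)" "0 \<le> seq_L2 (el s)"
      by (simp_all add: seq_H1_def seq_L2_def)
    have bd: "seq_H1 (a1 s) \<le> M T" "seq_H1 (a2 s) \<le> M T" "seq_H1 (x s) \<le> M T" "seq_L2 (x s) \<le> M T"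
      using M(2)[OF s] xb[OF s(1)] inH1_ell2(2)[OF x[OF s(1)]] pos by linarith+
    have HS: "((\<lambda>k. - \<nu> * (ksq k * (norm (x s k))^2) + x s k \<bullet> el s k
        - (c1 * (Bc (v1 s) (v1 s) k \<bullet> x s k) + c2 * (Bc (v2 s) (v2 s) k \<bullet> x s k))) has_sum
        (- \<nu> * (seq_H1 (x s))^2 + (\<Sum>\<^sub>\<infinity>k. x s k \<bullet> el s k)
        - (c1 * tri (a1 s) (a1 s) (x s) + c2 * tri (a2 s) (a2 s) (x s)))) UNIV"
    proof -
      have "((\<lambda>k. c1 * (Bc (v1 s) (v1 s) k \<bullet> x s k) + c2 * (Bc (v2 s) (v2 s) k \<bullet> x s k)) has_sum
          (c1 * tri (a1 s) (a1 s) (x s) + c2 * tri (a2 s) (a2 s) (x s))) UNIV"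
        by (intro has_sum_add has_sum_cmult_right b1(1) b2(1))
      then have "((\<lambda>k. - (c1 * (Bc (v1 s) (v1 s) k \<bullet> x s k) + c2 * (Bc (v2 s) (v2 s) k \<bullet> x s k))) has_sum
          - (c1 * tri (a1 s) (a1 s) (x s) + c2 * tri (a2 s) (a2 s) (x s))) UNIV"
        unfolding has_sum_uminus by (simp only: minus_minus)
      then show ?thesis
        unfolding diff_conv_add_uminus
        by (intro has_sum_add has_sum_cmult_right h1 has_sum_infsum xe(1))
    qed
    define u where "u k = \<nu> * (ksq k * (norm (x s k))^2) + \<bar>x s k \<bullet> el s k\<bar>
        + (\<bar>c1\<bar> * \<bar>Bc (v1 s) (v1 s) k \<bullet> x s k\<bar> + \<bar>c2\<bar> * \<bar>Bc (v2 s) (v2 s) k \<bullet> x s k\<bar>)" for k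
    have HU: "(u has_sum (\<nu> * (seq_H1 (x s))^2 + (\<Sum>\<^sub>\<infinity>k. \<bar>x s k \<bullet> el s k\<bar>)
        + (\<bar>c1\<bar> * (\<Sum>\<^sub>\<infinity>k. \<bar>Bc (v1 s) (v1 s) k \<bullet> x s k\<bar>) + \<bar>c2\<bar> * (\<Sum>\<^sub>\<infinity>k. \<bar>Bc (v2 s) (v2 s) k \<bullet> x s k\<bar>)))) UNIV"
      unfolding u_def[abs_def]
      by (intro has_sum_add has_sum_cmult_right h1 has_sum_infsum b1(2) b2(2) xe(2))
    have le: "\<bar>x s k \<bullet> f s k\<bar> \<le> u k" for k
    proof -
      have "\<bar>x s k \<bullet> f s k\<bar> \<le> \<bar>- \<nu> * (ksq k * (norm (x s k))^2)\<bar> + \<bar>x s k \<bullet> el s k\<bar>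
          + (\<bar>c1 * (Bc (v1 s) (v1 s) k \<bullet> x s k)\<bar> + \<bar>c2 * (Bc (v2 s) (v2 s) k \<bullet> x s k)\<bar>)"
        unfolding f[OF s(1)] by linarith
      then show ?thesis using \<nu> by (simp add: u_def abs_mult)
    qed
    have S: "(\<lambda>k. \<bar>x s k \<bullet> f s k\<bar>) summable_on UNIV"
      by (rule summable_on_comparison_test[OF has_sum_imp_summable[OF HU]]) (use le in auto)
    have "(\<Sum>\<^sub>\<infinity>k. \<bar>x s k \<bullet> f s k\<bar>) \<le> infsum u UNIV"
      by (rule infsum_mono[OF S has_sum_imp_summable[OF HU]]) (rule le)
    also have "\<dots> = \<nu> * (seq_H1 (x s))^2 + (\<Sum>\<^sub>\<infinity>k. \<bar>x s k \<bullet> el s k\<bar>)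
        + (\<bar>c1\<bar> * (\<Sum>\<^sub>\<infinity>k. \<bar>Bc (v1 s) (v1 s) k \<bullet> x s k\<bar>) + \<bar>c2\<bar> * (\<Sum>\<^sub>\<infinity>k. \<bar>Bc (v2 s) (v2 s) k \<bullet> x s k\<bar>))"
      by (rule infsumI[OF HU])
    also have "\<dots> \<le> D T s"
      unfolding D_def
    proof (intro add_mono mult_left_mono)
      show "(seq_H1 (x s))^2 \<le> (M T)^2" using bd pos by (intro power_mono) auto
      show "(\<Sum>\<^sub>\<infinity>k. \<bar>x s k \<bullet> el s k\<bar>) \<le> M T * B"
        using xe(3) mult_mono[OF bd(4) el(2)[OF s(1)] M(1) pos(5)] by linarith
      show "(\<Sum>\<^sub>\<infinity>k. \<bar>Bc (v1 s) (v1 s) k \<bullet> x s k\<bar>) \<le> \<kappa> * (1 + (Anorm (v1 s))^2) * (M T * M T)"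
        by (rule order_trans[OF b1(3)]) (intro mult_left_mono mult_mono bd M(1) pos mult_nonneg_nonneg \<kappa>; simp)
      show "(\<Sum>\<^sub>\<infinity>k. \<bar>Bc (v2 s) (v2 s) k \<bullet> x s k\<bar>) \<le> \<kappa> * (1 + (Anorm (v2 s))^2) * (M T * M T)"
        by (rule order_trans[OF b2(3)]) (intro mult_left_mono mult_mono bd M(1) pos mult_nonneg_nonneg \<kappa>; simp)
    qed (use \<nu> in auto)
    finally show ?thesis using S infsumI[OF HS] by (simp add: f[OF s(1)])
  qed
  have "\<exists>h. primitive_from 0 (\<lambda>t. (seq_L2 (x t))^2) h \<and>
      (AE t in lborel. 0 \<le> t \<longrightarrow> h t = 2 * (\<Sum>\<^sub>\<infinity>k. x t k \<bullet> f t k))"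
  proof (rule energy_identity[OF int eq _ Di])
    show "ell2 (\<lambda>k. norm (x t k))" if "0 \<le> t" for t using x[OF that] by (rule inH1_ell2(1))
    show "AE s in lborel. s \<in> {0..T} \<longrightarrow>
        (\<lambda>k. \<bar>x s k \<bullet> f s k\<bar>) summable_on UNIV \<and> (\<Sum>\<^sub>\<infinity>k. \<bar>x s k \<bullet> f s k\<bar>) \<le> D T s" for T
      using AE_inDA
    proof eventually_elim
      case (elim s)
      then show ?case using main[of s T] by auto
    qed
  qed auto
  then obtain h where h: "primitive_from 0 (\<lambda>t. (seq_L2 (x t))^2) h"
    "AE t in lborel. 0 \<le> t \<longrightarrow> h t = 2 * (\<Sum>\<^sub>\<infinity>k. x t k \<bullet> f t k)" by blast
  have "AE t in lborel. 0 \<le> t \<longrightarrow> h t = - 2 * \<nu> * (seq_H1 (x t))^2 + 2 * (\<Sum>\<^sub>\<infinity>k. x t k \<bullet> el t k)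
      - 2 * (c1 * tri (a1 t) (a1 t) (x t) + c2 * tri (a2 t) (a2 t) (x t))"
    using h(2) AE_inDA
  proof eventually_elim
    case (elim t)
    show ?case
    proof
      assume t: "0 \<le> t"
      then have "h t = 2 * (\<Sum>\<^sub>\<infinity>k. x t k \<bullet> f t k)" using elim by blast
      also have "(\<Sum>\<^sub>\<infinity>k. x t k \<bullet> f t k) = - \<nu> * (seq_H1 (x t))^2 + (\<Sum>\<^sub>\<infinity>k. x t k \<bullet> el t k)
        - (c1 * tri (a1 t) (a1 t) (x t) + c2 * tri (a2 t) (a2 t) (x t))"
        using main[of t t] elim t by blast
      finally show "h t = - 2 * \<nu> * (seq_H1 (x t))^2 + 2 * (\<Sum>\<^sub>\<infinity>k. x t k \<bullet> el t k)
        - 2 * (c1 * tri (a1 t) (a1 t) (x t) + c2 * tri (a2 t) (a2 t) (x t))" by (simp add: algebra_simps)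
    qed
  qed
  with h(1) show ?thesis by blast
qed

end

section \<open>Synchronization\<close>

lemma lint_const: "r \<le> t \<Longrightarrow> (LINT s:{r..t}|lborel. (c::real)) = c * (t - r)"
  "set_integrable lborel {r..t} (\<lambda>_. c :: real)"
proof -
  show i: "set_integrable lborel {r..t} (\<lambda>_. c)"
    by (intro borel_integrable_atLeastAtMost' continuous_intros)
  show "r \<le> t \<Longrightarrow> (LINT s:{r..t}|lborel. c) = c * (t - r)"
    using set_borel_integral_eq_integral(2)[OF i] by simp
qed

lemma lint_singleton:
  fixes f :: "real \<Rightarrow> 'a::{banach,second_countable_topology}"
  shows "(LINT s:{a..a}|lborel. f s) = 0"
  unfolding set_lebesgue_integral_def
  by (rule integral_eq_zero_AE) (use AE_lborel_singleton[of a] in \<open>auto elim!: eventually_mono\<close>)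

section \<open>Algebra and estimates of the coupled trilinear terms\<close>

lemma tri_quadratic:
  assumes "wiener_H1 V" "wiener_H1 W" "wiener_H1 c"
  shows "tri (\<lambda>k. V k + r *\<^sub>R W k) (\<lambda>k. V k + r *\<^sub>R W k) c
    = tri V V c + r * (tri V W c + tri W V c) + r^2 * tri W W c"
proof -
  note rW = wiener_H1_scaleR[OF assms(2), of r]
  have "tri (\<lambda>k. V k + r *\<^sub>R W k) (\<lambda>k. V k + r *\<^sub>R W k) c
      = tri V (\<lambda>k. V k + r *\<^sub>R W k) c + tri (\<lambda>k. r *\<^sub>R W k) (\<lambda>k. V k + r *\<^sub>R W k) c"
    by (rule tri_add(1)[OF assms(1) wiener_H1_add[OF assms(1) rW] assms(3) rW])
  also have "tri V (\<lambda>k. V k + r *\<^sub>R W k) c = tri V V c + tri V (\<lambda>k. r *\<^sub>R W k) c"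
    by (rule tri_add(2)[OF assms(1,1,3) rW])
  also have "tri (\<lambda>k. r *\<^sub>R W k) (\<lambda>k. V k + r *\<^sub>R W k) c
      = tri (\<lambda>k. r *\<^sub>R W k) V c + tri (\<lambda>k. r *\<^sub>R W k) (\<lambda>k. r *\<^sub>R W k) c"
    by (rule tri_add(2)[OF rW assms(1,3) rW])
  finally show ?thesis by (simp add: tri_scaleR power2_eq_square algebra_simps)
qed

text \<open>The term \<open>tri Q V Q\<close> enters the balance of \<open>Q\<close> and, multiplied by \<open>\<theta>1 * \<theta>2\<close> and with
  the opposite sign, the balance of \<open>V\<close>; every other term contains the low modes \<open>P\<close>.\<close>

lemma tri_split:
  assumes V: "wiener_H1 V" and P: "wiener_H1 P" and Q: "wiener_H1 Q" and th: "\<theta>1 + \<theta>2 = (1::real)"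
    and W: "W = (\<lambda>k. P k + Q k)"
    and A1: "A1 = (\<lambda>k. V k + \<theta>1 *\<^sub>R W k)" and A2: "A2 = (\<lambda>k. V k + (- \<theta>2) *\<^sub>R W k)"
  shows "tri A1 A1 Q - tri A2 A2 Q = tri Q V Q + (tri V P Q + tri P V Q + (\<theta>1 - \<theta>2) * (tri P P Q + tri Q P Q))"
    "\<theta>2 * tri A1 A1 V + \<theta>1 * tri A2 A2 V = \<theta>1 * \<theta>2 * (tri P P V - tri P V Q + tri Q P V - tri Q V Q)"
proof -
  have aW: "wiener_H1 W" unfolding W by (rule wiener_H1_add[OF P Q])
  have s1: "tri W b c = tri P b c + tri Q b c" if "wiener_H1 b" "wiener_H1 c" for b c
    unfolding W by (rule tri_add(1)[OF P that Q])
  have s2: "tri a W c = tri a P c + tri a Q c" if "wiener_H1 a" "wiener_H1 c" for a c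
    unfolding W by (rule tri_add(2)[OF that(1) P that(2) Q])
  have th2: "\<theta>2 = 1 - \<theta>1" using th by simp
  have e: "\<theta>1^2 - \<theta>2^2 = \<theta>1 - \<theta>2" unfolding th2 by (simp add: power2_eq_square algebra_simps)
  have "tri A1 A1 Q - tri A2 A2 Q = (\<theta>1 + \<theta>2) * (tri V W Q + tri W V Q) + (\<theta>1^2 - \<theta>2^2) * tri W W Q"
    unfolding A1 A2 tri_quadratic[OF V aW Q] by (simp add: algebra_simps)
  \<comment> \<open>Inserting \<open>W = P + Q\<close>, the terms \<open>tri V Q Q\<close>,
    \<open>tri P Q Q\<close> and \<open>tri Q Q Q\<close> vanish by antisymmetry. The
    self-interaction of Q, whatever its weight, is therefore invisible here.\<close>
  then show "tri A1 A1 Q - tri A2 A2 Q = tri Q V Q + (tri V P Q + tri P V Q + (\<theta>1 - \<theta>2) * (tri P P Q + tri Q P Q))"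
    unfolding e th by (simp add: s1 s2 V P Q aW tri_same)
  \<comment> \<open>\<open>tri V V V\<close> vanishes, the terms linear in W have weight
    \<open>\<theta>2 * \<theta>1 - \<theta>1 * \<theta>2 = 0\<close>, and the quadratic term has
    weight \<open>\<theta>2 * \<theta>1^2 + \<theta>1 * \<theta>2^2\<close>.\<close>
  have "\<theta>2 * tri A1 A1 V + \<theta>1 * tri A2 A2 V = (\<theta>1 * \<theta>2 * (\<theta>1 + \<theta>2)) * tri W W V"
    unfolding A1 A2 tri_quadratic[OF V aW V] tri_same[OF V V] by (simp add: power2_eq_square algebra_simps)
  also have "tri W W V = tri P P V + tri P Q V + (tri Q P V + tri Q Q V)"
    by (simp add: s1 s2 V P Q aW)
  also have "tri P Q V = - tri P V Q" by (rule tri_antisym[OF P Q V])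
  also have "tri Q Q V = - tri Q V Q" by (rule tri_antisym[OF Q Q V])
  finally show "\<theta>2 * tri A1 A1 V + \<theta>1 * tri A2 A2 V = \<theta>1 * \<theta>2 * (tri P P V - tri P V Q + tri Q P V - tri Q V Q)"
    unfolding th by (simp add: algebra_simps)
qed

text \<open>On finitely many modes all norms are equivalent. \<open>K\<close> is a crude common
  constant that dominates \<open>N\<close>, the square root of the number of modes, and their
  product.\<close>

lemma low_mode_norms:
  assumes P: "inH1 P" and M: "finite M" "\<And>k. k \<notin> M \<Longrightarrow> P k = 0" and N: "\<And>k. k \<in> M \<Longrightarrow> ksq k \<le> N^2" "0 \<le> N"
  defines "K \<equiv> (1 + N) * (1 + sqrt (card M))"
  shows "seq_l1 P \<le> K * seq_L2 P" "seq_H1 P \<le> K * seq_L2 P" "(\<lambda>k. sqrt (ksq k) * norm (P k)) summable_on UNIV"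
    "(\<Sum>\<^sub>\<infinity>k. sqrt (ksq k) * norm (P k)) \<le> K * seq_L2 P"
proof -
  have sq: "sqrt (ksq k) \<le> N" if "k \<in> M" for k
    using N(1)[OF that] N(2) by (intro real_le_lsqrt) auto
  have le: "sqrt (ksq k) * norm (P k) \<le> N * norm (P k)" for k
    using sq[of k] M(2)[of k] by (cases "k \<in> M") (auto intro: mult_right_mono)
  have e0: "ell2 (\<lambda>k. norm (P k))" by (rule inH1_ell2(1)[OF P])
  have n00: "0 \<le> seq_L2 P" by (simp add: seq_L2_def)
  have "(\<Sum>k\<in>M. norm (P k)) = (\<Sum>k\<in>M. \<bar>1\<bar> * \<bar>norm (P k)\<bar>)" by simp
  also have "\<dots> \<le> L2_set (\<lambda>_. 1) M * L2_set (\<lambda>k. norm (P k)) M" by (rule L2_set_mult_ineq)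
  also have "\<dots> \<le> sqrt (card M) * seq_L2 P"
    unfolding seq_L2_def by (intro mult_mono L2_set_le_nrm2 e0 M) (auto simp: L2_set_def sum_nonneg)
  finally have sM: "(\<Sum>k\<in>M. norm (P k)) \<le> sqrt (card M) * seq_L2 P" .
  have l: "seq_l1 P = (\<Sum>k\<in>M. norm (P k))"
    unfolding seq_l1_def using M by (subst infsum_cong_neutral[where T=M and g="\<lambda>k. norm (P k)"]) auto
  have "sqrt (card M) * seq_L2 P \<le> K * seq_L2 P"
    unfolding K_def using N(2) n00 by (intro mult_right_mono) (auto simp: algebra_simps intro: add_nonneg_nonneg)
  then show "seq_l1 P \<le> K * seq_L2 P" unfolding l using sM by linarith
  have "seq_H1 P \<le> nrm2 (\<lambda>k. N * norm (P k))"
    unfolding seq_H1_def by (rule nrm2_mono(2)[OF nrm2_cmult(1)[OF e0]]) (use le N in \<open>simp add: abs_mult\<close>)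
  also have "\<dots> = N * seq_L2 P" using nrm2_cmult(2)[OF e0, of N] N by (simp add: seq_L2_def)
  also have "\<dots> \<le> K * seq_L2 P"
    unfolding K_def using N(2) n00 by (intro mult_right_mono) (auto simp: algebra_simps intro: add_nonneg_nonneg)
  finally show "seq_H1 P \<le> K * seq_L2 P" .
  show s: "(\<lambda>k. sqrt (ksq k) * norm (P k)) summable_on UNIV"
    by (rule finite_nonzero_values_imp_summable_on, rule finite_subset[OF _ M(1)]) (use M(2) in auto)
  have "(\<Sum>\<^sub>\<infinity>k. sqrt (ksq k) * norm (P k)) = (\<Sum>k\<in>M. sqrt (ksq k) * norm (P k))"
    using M by (subst infsum_cong_neutral[where T=M and g="\<lambda>k. sqrt (ksq k) * norm (P k)"]) auto
  also have "\<dots> \<le> (\<Sum>k\<in>M. N * norm (P k))" by (intro sum_mono le)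
  also have "\<dots> = N * (\<Sum>k\<in>M. norm (P k))" by (simp add: sum_distrib_left)
  also have "\<dots> \<le> N * (sqrt (card M) * seq_L2 P)" using sM N(2) by (intro mult_left_mono)
  also have "\<dots> \<le> K * seq_L2 P"
    unfolding K_def mult.assoc[symmetric] using N(2) n00
    by (intro mult_right_mono) (auto simp: algebra_simps intro: add_nonneg_nonneg)
  finally show "(\<Sum>\<^sub>\<infinity>k. sqrt (ksq k) * norm (P k)) \<le> K * seq_L2 P" .
qed

text \<open>In each case P takes the \<ell>1 slot of Young's inequality, so the two other factors
  appear at most in \<open>seq_L2\<close> and \<open>seq_H1\<close>. Every such term vanishes with P
  and never needs the Ladyzhenskaya inequality.\<close>

lemma low_tri_bounds:
  assumes P: "wiener_H1 P" and b: "wiener_H1 b" and c: "wiener_H1 c"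
    and \<delta>: "seq_l1 P \<le> \<delta>" "seq_H1 P \<le> \<delta>" "(\<lambda>k. sqrt (ksq k) * norm (P k)) summable_on UNIV"
      "(\<Sum>\<^sub>\<infinity>k. sqrt (ksq k) * norm (P k)) \<le> \<delta>"
  shows "\<bar>tri b P c\<bar> \<le> \<delta> * (seq_L2 b * seq_L2 c)" "\<bar>tri P b c\<bar> \<le> \<delta> * (seq_H1 b * seq_L2 c)" "\<bar>tri P P c\<bar> \<le> \<delta> * (\<delta> * seq_L2 c)"
proof -
  have pos: "0 \<le> seq_L2 b" "0 \<le> seq_L2 c" "0 \<le> seq_H1 b" "0 \<le> seq_H1 P" "0 \<le> seq_l1 P"
    by (auto simp: seq_L2_def seq_H1_def seq_l1_def intro: infsum_nonneg)
  have e: "ell2 (\<lambda>k. norm (b k))" "ell2 (\<lambda>k. norm (c k))" "ell2 (\<lambda>k. sqrt (ksq k) * norm (b k))"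
    "ell2 (\<lambda>k. sqrt (ksq k) * norm (P k))" "(\<lambda>k. norm (P k)) summable_on UNIV"
    using P b c inH1_ell2(1) by (auto simp: wiener_H1_def inH1_def)
  have "\<bar>tri b P c\<bar> \<le> (\<Sum>\<^sub>\<infinity>k. sqrt (ksq k) * norm (P k)) * (seq_L2 b * seq_L2 c)"
    by (rule tri_bound_seq_l1'[OF e(1) \<delta>(3) e(2)])
  also have "\<dots> \<le> \<delta> * (seq_L2 b * seq_L2 c)" by (intro mult_right_mono \<delta> mult_nonneg_nonneg pos)
  finally show "\<bar>tri b P c\<bar> \<le> \<delta> * (seq_L2 b * seq_L2 c)" .
  have "\<bar>tri P b c\<bar> \<le> seq_l1 P * (seq_H1 b * seq_L2 c)" by (rule tri_bound_seq_l1(2)[OF e(5,3,2)])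
  also have "\<dots> \<le> \<delta> * (seq_H1 b * seq_L2 c)" by (intro mult_right_mono \<delta> mult_nonneg_nonneg pos)
  finally show "\<bar>tri P b c\<bar> \<le> \<delta> * (seq_H1 b * seq_L2 c)" .
  have "\<bar>tri P P c\<bar> \<le> seq_l1 P * (seq_H1 P * seq_L2 c)" by (rule tri_bound_seq_l1(2)[OF e(5,4,2)])
  also have "\<dots> \<le> \<delta> * (\<delta> * seq_L2 c)"
    using \<delta> pos by (intro mult_mono mult_right_mono mult_nonneg_nonneg) auto
  finally show "\<bar>tri P P c\<bar> \<le> \<delta> * (\<delta> * seq_L2 c)" .
qed

lemma young_product: "0 < (\<nu>::real) \<Longrightarrow> 2 * (a * b) \<le> \<nu> * a^2 + b^2 / \<nu>"
proof -
  assume \<nu>: "0 < \<nu>"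
  have "0 \<le> (\<nu> * a - b)^2 / \<nu>" using \<nu> by simp
  also have "\<dots> = \<nu> * a^2 - 2 * (a * b) + b^2 / \<nu>" using \<nu> by (simp add: power2_eq_square field_simps)
  finally show ?thesis by simp
qed

text \<open>The left-hand side below is the time derivative of \<open>|V|\<^sup>2 + \<mu> |Q|\<^sup>2\<close>.\<close>

lemma coupled_energy_estimate:
  fixes \<nu> g \<delta> \<epsilon> \<mu> V0 V1 Q0 Q1 S1 S2 Z :: real
  assumes "0 < \<nu>" "0 \<le> \<delta>" "\<delta> \<le> 1" "0 \<le> \<epsilon>" "0 \<le> \<mu>" "\<mu> \<le> 1" "0 \<le> V0" "V0 \<le> V1" "0 \<le> Q0" "0 \<le> g"
    and S1: "S1 \<le> V0 * g" and S2: "S2 \<le> Q0 * \<epsilon>"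
    and Z: "Z \<le> \<mu> * (\<delta> * (\<delta> * V0) + 2 * (\<delta> * (V0 * Q0)) + \<delta> * (\<delta> * Q0) + \<delta> * (Q0 * Q0))"
  shows "- 2 * \<nu> * V1^2 + 2 * S1 + \<mu> * (- 2 * \<nu> * Q1^2 + 2 * S2) + 2 * Z
    \<le> - \<nu> * V1^2 - 2 * \<nu> * \<mu> * Q1^2 + g^2 / \<nu> + (6 * \<delta> + \<epsilon>) * (1 + (V0^2 + \<mu> * Q0^2))"
proof -
  have s1: "2 * S1 \<le> \<nu> * V1^2 + g^2 / \<nu>"
  proof -
    have "2 * S1 \<le> 2 * (V0 * g)" using S1 by simp
    also have "\<dots> \<le> 2 * (V1 * g)" using assms by (intro mult_left_mono mult_right_mono) auto
    also have "\<dots> \<le> \<nu> * V1^2 + g^2 / \<nu>" using assms(1) by (rule young_product)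
    finally show ?thesis .
  qed
  have s2: "\<mu> * (2 * S2) \<le> \<epsilon> * (1 + \<mu> * Q0^2)"
  proof -
    have "\<mu> * (2 * S2) \<le> \<mu> * (\<epsilon> * (2 * 1 * Q0))" using S2 assms by (intro mult_left_mono) (auto simp: mult_ac)
    also have "\<dots> \<le> \<mu> * (\<epsilon> * (1^2 + Q0^2))" using assms by (intro mult_left_mono sum_squares_bound) auto
    also have "\<dots> = \<epsilon> * (\<mu> + \<mu> * Q0^2)" by (simp add: algebra_simps)
    also have "\<dots> \<le> \<epsilon> * (1 + \<mu> * Q0^2)" using assms by (intro mult_left_mono) auto
    finally show ?thesis .
  qed
  \<comment> \<open>The assumption \<open>\<delta> \<le> 1\<close> serves to make every error linear
    in \<open>\<delta>\<close>.\<close>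
  have dd: "\<delta> * (\<delta> * x) \<le> \<delta> * x" if "0 \<le> x" for x
    using assms that by (intro mult_left_mono) (auto intro: mult_left_le_one_le)
  have b1: "\<mu> * (\<delta> * (\<delta> * V0)) \<le> \<delta> * (1 + V0^2)"
  proof -
    have "\<mu> * (\<delta> * (\<delta> * V0)) \<le> 1 * (\<delta> * (\<delta> * V0))" using assms by (intro mult_right_mono) auto
    also have "\<dots> \<le> 1 * (\<delta> * V0)" using dd[of V0] assms by simp
    also have "\<delta> * V0 \<le> \<delta> * (1 + V0^2)"
      using assms sum_squares_bound[of 1 V0] by (intro mult_left_mono) auto
    finally show ?thesis by simp
  qed
  have b2: "\<mu> * (2 * (\<delta> * (V0 * Q0))) \<le> \<delta> * (V0^2 + \<mu> * Q0^2)"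
  proof -
    have "\<mu> * (2 * (\<delta> * (V0 * Q0))) = \<delta> * (\<mu> * (2 * V0 * Q0))" by simp
    also have "\<dots> \<le> \<delta> * (\<mu> * (V0^2 + Q0^2))" using assms by (intro mult_left_mono sum_squares_bound) auto
    also have "\<dots> \<le> \<delta> * (V0^2 + \<mu> * Q0^2)"
      using assms mult_right_mono[of \<mu> 1 "V0^2"] by (intro mult_left_mono) (auto simp: distrib_left)
    finally show ?thesis .
  qed
  have b3: "\<mu> * (\<delta> * (\<delta> * Q0)) \<le> \<delta> * (1 + \<mu> * Q0^2)"
  proof -
    have "\<mu> * (\<delta> * (\<delta> * Q0)) \<le> \<mu> * (\<delta> * Q0)" by (rule mult_left_mono[OF dd]) (use assms in auto)
    also have "\<dots> \<le> \<mu> * (\<delta> * (1 + Q0^2))"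
      using assms sum_squares_bound[of 1 Q0] by (intro mult_left_mono) auto
    also have "\<dots> = \<delta> * (\<mu> + \<mu> * Q0^2)" by (simp add: algebra_simps)
    also have "\<dots> \<le> \<delta> * (1 + \<mu> * Q0^2)" using assms by (intro mult_left_mono) auto
    finally show ?thesis .
  qed
  have b4: "\<mu> * (\<delta> * (Q0 * Q0)) = \<delta> * (\<mu> * Q0^2)" by (simp add: power2_eq_square)
  have "Z \<le> \<delta> * (1 + V0^2) + \<delta> * (V0^2 + \<mu> * Q0^2) + \<delta> * (1 + \<mu> * Q0^2) + \<delta> * (\<mu> * Q0^2)"
    using Z b1 b2 b3 b4 by (simp add: distrib_left)
  \<comment> \<open>The four bounds contain the constant twice, \<open>V0^2\<close> twice and
    \<open>\<mu> * Q0^2\<close> three times; hence 3 here and 6 after doubling.\<close>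
  also have "\<dots> \<le> 3 * \<delta> * (1 + (V0^2 + \<mu> * Q0^2))"
    using assms by (simp add: algebra_simps)
  finally have z: "2 * Z \<le> 6 * \<delta> * (1 + (V0^2 + \<mu> * Q0^2))" by simp
  have "\<epsilon> * (1 + \<mu> * Q0^2) \<le> \<epsilon> * (1 + (V0^2 + \<mu> * Q0^2))" using assms by (intro mult_left_mono) auto
  then show ?thesis using s1 s2 z by (simp add: algebra_simps)
qed

text \<open>Half of the dissipation \<open>2 * \<nu> * Q1^2\<close> absorbs the factor
  \<open>Q1\<close> of the Ladyzhenskaya term, the other half becomes decay through
  \<open>\<kappa>2\<close>. Products with \<open>\<delta>\<close> or \<open>\<epsilon>\<close> are
  split by 2x \<le> 1 + x^2 into a change of the rate and an inhomogeneity, both of which vanish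
  with \<open>\<delta>\<close> and \<open>\<epsilon>\<close>.\<close>

lemma high_mode_estimate:
  fixes \<nu> c \<delta> \<epsilon> V0 V1 Q0 Q1 S2 X Y \<kappa>2 :: real
  assumes "0 < \<nu>" "0 \<le> \<delta>" "\<delta> \<le> 1" "0 \<le> \<epsilon>" "0 \<le> V0" "V0 \<le> V1" "0 \<le> Q0" "0 \<le> Q1"
    and \<kappa>: "\<kappa>2 * Q0^2 \<le> Q1^2"
    and S2: "S2 \<le> Q0 * \<epsilon>" and Y: "Y \<le> c * Q1 * Q0 * V1"
    and X: "X \<le> \<delta> * (V0 * Q0) + \<delta> * (V1 * Q0) + (\<delta> * (\<delta> * Q0) + \<delta> * (Q0 * Q0))"
  shows "- 2 * \<nu> * Q1^2 + 2 * S2 + 2 * (X + Y)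
    \<le> - (\<nu> * \<kappa>2 - (c^2 / \<nu> + 2 * \<delta>) * V1^2 - (3 * \<delta> + \<epsilon>)) * Q0^2 + (3 * \<delta> + \<epsilon>)"
proof -
  have y: "2 * Y \<le> \<nu> * Q1^2 + c^2 / \<nu> * V1^2 * Q0^2"
  proof -
    have "2 * Y \<le> 2 * (Q1 * (c * Q0 * V1))" using Y by (simp add: mult_ac)
    also have "\<dots> \<le> \<nu> * Q1^2 + (c * Q0 * V1)^2 / \<nu>" using assms(1) by (rule young_product)
    finally show ?thesis by (simp add: power_mult_distrib mult_ac)
  qed
  have k: "\<nu> * (\<kappa>2 * Q0^2) \<le> \<nu> * Q1^2" using \<kappa> assms(1) by (intro mult_left_mono) auto
  have s: "2 * S2 \<le> \<epsilon> * (1 + Q0^2)"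
  proof -
    have "2 * S2 \<le> \<epsilon> * (2 * 1 * Q0)" using S2 by (simp add: mult_ac)
    also have "\<dots> \<le> \<epsilon> * (1^2 + Q0^2)" using assms by (intro mult_left_mono sum_squares_bound) auto
    finally show ?thesis by simp
  qed
  have x1: "\<delta> * (V0 * Q0) \<le> \<delta> * (V1 * Q0)" using assms by (intro mult_left_mono mult_right_mono) auto
  have x2: "4 * (\<delta> * (V1 * Q0)) \<le> 2 * \<delta> * (1 + V1^2 * Q0^2)"
  proof -
    have "4 * (\<delta> * (V1 * Q0)) = 2 * \<delta> * (2 * 1 * (V1 * Q0))" by simp
    also have "\<dots> \<le> 2 * \<delta> * (1^2 + (V1 * Q0)^2)" using assms by (intro mult_left_mono sum_squares_bound) auto
    finally show ?thesis by (simp add: power_mult_distrib)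
  qed
  have x3: "2 * (\<delta> * (\<delta> * Q0)) \<le> \<delta> * (1 + Q0^2)"
  proof -
    have "\<delta> * (\<delta> * Q0) \<le> \<delta> * Q0"
      using assms by (intro mult_left_mono) (auto intro: mult_left_le_one_le)
    then have "2 * (\<delta> * (\<delta> * Q0)) \<le> \<delta> * (2 * 1 * Q0)" by simp
    also have "\<dots> \<le> \<delta> * (1^2 + Q0^2)" using assms by (intro mult_left_mono sum_squares_bound) auto
    finally show ?thesis by simp
  qed
  have x4: "\<delta> * (Q0 * Q0) = \<delta> * Q0^2" by (simp add: power2_eq_square)
  have "2 * X \<le> 2 * \<delta> * (1 + V1^2 * Q0^2) + \<delta> * (1 + Q0^2) + 2 * (\<delta> * Q0^2)"
    using X x1 x2 x3 x4 by linarith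
  then show ?thesis using y k s by (simp add: algebra_simps)
qed

section \<open>The coupled system in Fourier coefficients\<close>

lemma mode_eqD:
  assumes "mode_eq \<nu> F v v0" "0 \<le> t"
  shows "set_integrable lborel {0..t} (\<lambda>s. - complex_of_real (\<nu> * ksq k) *s fc (v s) k + F s k)"
    "fc (v t) k = fc (v 0) k + (LINT s:{0..t}|lborel. - complex_of_real (\<nu> * ksq k) *s fc (v s) k + F s k)"
proof -
  have *: "fc (v t) k = fc v0 k + (LINT s:{0..t}|lborel. - complex_of_real (\<nu> * ksq k) *s fc (v s) k + F s k)"
    if "0 \<le> t" for t
    using assms(1) that unfolding mode_eq_def by blast
  show "set_integrable lborel {0..t} (\<lambda>s. - complex_of_real (\<nu> * ksq k) *s fc (v s) k + F s k)"
    using assms unfolding mode_eq_def by blast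
  have "fc (v 0) k = fc v0 k" using *[OF order_refl] unfolding lint_singleton by simp
  then show "fc (v t) k = fc (v 0) k + (LINT s:{0..t}|lborel. - complex_of_real (\<nu> * ksq k) *s fc (v s) k + F s k)"
    using *[OF assms(2)] by simp
qed

text \<open>\<open>g\<close> bounds the averaged forcing in \<open>seq_L2\<close>, hence without the
  factor \<open>2 * pi\<close>. In \<open>gap\<close> the left side is the growth coefficient
  \<open>(2 * pi * C)^2 / \<nu>\<close> times \<open>g^2 / \<nu>^2\<close>, the bound for the time
  average of the squared H1 norm of V; the right side is the decay rate of the high modes.\<close>

locale mutual_sync = flow_pair \<nu> v1 v2 for \<nu> :: real and v1 v2 :: "real \<Rightarrow> field" +
  fixes N \<theta>1 \<theta>2 C g :: real and g1 g2 :: "real \<Rightarrow> field" and v01 v02 :: field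
  assumes N: "0 < N" and th: "0 \<le> \<theta>1" "0 \<le> \<theta>2" "\<theta>1 + \<theta>2 = 1"
    and C: "0 \<le> C" "CL_const C"
    and forcing1: "forcing g1" and forcing2: "forcing g2"
    and eq1: "mode_eq \<nu> (\<lambda>s k. - Bc (v1 s) (v1 s) k + fc (g1 s) k +
        complex_of_real \<theta>1 *s PNc N k (Bc (v1 s) (v1 s) k - Bc (v2 s) (v2 s) k)) v1 v01"
    and eq2: "mode_eq \<nu> (\<lambda>s k. - Bc (v2 s) (v2 s) k + fc (g2 s) k +
        complex_of_real \<theta>2 *s PNc N k (Bc (v2 s) (v2 s) k - Bc (v1 s) (v1 s) k)) v2 v02"
    and forcing_diff: "((\<lambda>t. Hnorm (g1 t - g2 t)) \<longlongrightarrow> 0) at_top"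
    and forcing_bound: "\<And>t. 0 \<le> t \<Longrightarrow> seq_L2 (\<lambda>k. \<theta>2 *\<^sub>R fc (g1 t) k + \<theta>1 *\<^sub>R fc (g2 t) k) \<le> g"
    and gap: "(2 * pi * C)^2 * g^2 / \<nu>^3 < \<nu> * max 1 (N^2)"
begin

definition F1 :: "real \<Rightarrow> cseq" where
  "F1 s k = - complex_of_real (\<nu> * ksq k) *s a1 s k + (- Bc (v1 s) (v1 s) k + fc (g1 s) k +
     complex_of_real \<theta>1 *s PNc N k (Bc (v1 s) (v1 s) k - Bc (v2 s) (v2 s) k))"

definition F2 :: "real \<Rightarrow> cseq" where
  "F2 s k = - complex_of_real (\<nu> * ksq k) *s a2 s k + (- Bc (v2 s) (v2 s) k + fc (g2 s) k +
     complex_of_real \<theta>2 *s PNc N k (Bc (v2 s) (v2 s) k - Bc (v1 s) (v1 s) k))"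

lemma real_vector_smult: "complex_of_real c *s (w :: complex^2) = c *\<^sub>R w"
  by (simp add: vec_eq_iff complex_eq_iff)

lemmas modes_1 = mode_eqD[OF eq1, folded F1_def]
lemmas modes_2 = mode_eqD[OF eq2, folded F2_def]

lemma modes_lincomb:
  assumes t: "0 \<le> t"
  shows "set_integrable lborel {0..t} (\<lambda>s. r *\<^sub>R F1 s k + r' *\<^sub>R F2 s k)"
    "r *\<^sub>R a1 t k + r' *\<^sub>R a2 t k = (r *\<^sub>R a1 0 k + r' *\<^sub>R a2 0 k)
      + (LINT s:{0..t}|lborel. r *\<^sub>R F1 s k + r' *\<^sub>R F2 s k)"
proof -
  have i: "set_integrable lborel {0..t} (\<lambda>s. r *\<^sub>R F1 s k)" "set_integrable lborel {0..t} (\<lambda>s. r' *\<^sub>R F2 s k)"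
    using modes_1(1)[OF t] modes_2(1)[OF t] by (intro set_integrable_scaleR_right; simp)+
  show "set_integrable lborel {0..t} (\<lambda>s. r *\<^sub>R F1 s k + r' *\<^sub>R F2 s k)"
    by (rule set_integral_add(1)[OF i])
  show "r *\<^sub>R a1 t k + r' *\<^sub>R a2 t k = (r *\<^sub>R a1 0 k + r' *\<^sub>R a2 0 k)
      + (LINT s:{0..t}|lborel. r *\<^sub>R F1 s k + r' *\<^sub>R F2 s k)"
    unfolding set_integral_add(2)[OF i] set_integral_scaleR_right
    by (subst modes_1(2)[OF t], subst modes_2(2)[OF t]) (simp add: scaleR_add_right)
qed

definition W :: "real \<Rightarrow> cseq" where "W t k = 1 *\<^sub>R a1 t k + (-1) *\<^sub>R a2 t k"
definition V :: "real \<Rightarrow> cseq" where "V t k = \<theta>2 *\<^sub>R a1 t k + \<theta>1 *\<^sub>R a2 t k"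
text \<open>In contrast to the support of \<open>PNc\<close> this includes the zero mode. Nothing
  changes, because W vanishes there, and \<open>P + Q = W\<close> holds for all modes.\<close>

definition low :: "int \<times> int \<Rightarrow> bool" where "low k \<longleftrightarrow> ksq k \<le> N^2"
definition P :: "real \<Rightarrow> cseq" where "P t = restrict_modes low (W t)"
definition Q :: "real \<Rightarrow> cseq" where "Q t = restrict_modes (\<lambda>k. \<not> low k) (W t)"
definition G :: "real \<Rightarrow> cseq" where "G t k = \<theta>2 *\<^sub>R fc (g1 t) k + \<theta>1 *\<^sub>R fc (g2 t) k"
definition d :: "real \<Rightarrow> cseq" where "d t k = 1 *\<^sub>R fc (g1 t) k + (-1) *\<^sub>R fc (g2 t) k"
definition \<mu> :: real where "\<mu> = \<theta>1 * \<theta>2"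

abbreviation "fluxV t \<equiv> \<theta>2 * tri (a1 t) (a1 t) (V t) + \<theta>1 * tri (a2 t) (a2 t) (V t)"
abbreviation "fluxQ t \<equiv> tri (a1 t) (a1 t) (Q t) - tri (a2 t) (a2 t) (Q t)"

lemma low_minus: "low (- k) = low k" by (simp add: low_def)

lemma \<mu>: "0 \<le> \<mu>" "\<mu> \<le> 1"
proof -
  have "\<theta>1 \<le> 1" "\<theta>2 \<le> 1" using th by auto
  then show "0 \<le> \<mu>" "\<mu> \<le> 1" using th by (auto simp: \<mu>_def mult_le_one)
qed

lemma inH1_V: "0 \<le> t \<Longrightarrow> inH1 (V t)" and inH1_W: "0 \<le> t \<Longrightarrow> inH1 (W t)"
  unfolding V_def[abs_def] W_def[abs_def] by (intro inH1_lincomb(1) inH1_a1 inH1_a2; assumption)+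

lemma seq_H1_pos: "0 \<le> seq_H1 x" and seq_L2_pos: "0 \<le> seq_L2 x"
  by (simp_all add: seq_H1_def seq_L2_def)

lemma seq_H1_V_le: assumes "0 \<le> t" shows "seq_H1 (V t) \<le> seq_H1 (a1 t) + seq_H1 (a2 t)"
proof -
  have "seq_H1 (V t) \<le> \<bar>\<theta>2\<bar> * seq_H1 (a1 t) + \<bar>\<theta>1\<bar> * seq_H1 (a2 t)"
    unfolding V_def[abs_def] by (intro inH1_lincomb(2) inH1_a1 inH1_a2 assms)
  also have "\<dots> \<le> 1 * seq_H1 (a1 t) + 1 * seq_H1 (a2 t)"
    using th by (intro add_mono mult_right_mono seq_H1_pos) auto
  finally show ?thesis by simp
qed

lemma seq_H1_W_le: assumes "0 \<le> t" shows "seq_H1 (W t) \<le> seq_H1 (a1 t) + seq_H1 (a2 t)"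
  using inH1_lincomb(2)[OF inH1_a1[OF assms] inH1_a2[OF assms], of 1 "-1"] unfolding W_def[abs_def] by simp

lemma inH1_P: "0 \<le> t \<Longrightarrow> inH1 (P t)" and inH1_Q: "0 \<le> t \<Longrightarrow> inH1 (Q t)"
  unfolding P_def Q_def by (intro restrict_modes_inH1(1) inH1_W; simp add: low_minus)+

lemma wiener_H1_all:
  assumes "wiener_H1 (a1 t)" "wiener_H1 (a2 t)" shows "wiener_H1 (V t)" "wiener_H1 (P t)" "wiener_H1 (Q t)"
proof -
  have W: "wiener_H1 (W t)" unfolding W_def[abs_def] by (rule wiener_H1_lincomb[OF assms])
  show "wiener_H1 (V t)" unfolding V_def[abs_def] by (rule wiener_H1_lincomb[OF assms])
  show "wiener_H1 (P t)" "wiener_H1 (Q t)"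
    unfolding P_def Q_def by (intro restrict_modes_wiener_H1 W; simp add: low_minus)+
qed

lemma inL2_forcing: "0 \<le> t \<Longrightarrow> inL2 (g1 t)" "0 \<le> t \<Longrightarrow> inL2 (g2 t)"
  using forcing1 forcing2 by (auto simp: forcing_def inH_def)

lemma ell2_forcing:
  assumes "0 \<le> t" shows "ell2 (\<lambda>k. norm (G t k))" "ell2 (\<lambda>k. norm (d t k))"
  unfolding G_def d_def
  by (rule seq_L2_lincomb(1)[OF Hnorm_eq_seq_L2(1)[OF inL2_forcing(1)] Hnorm_eq_seq_L2(1)[OF inL2_forcing(2)] norm_lincomb, OF assms assms])+

lemma seq_L2_d: "0 \<le> t \<Longrightarrow> seq_L2 (d t) = Hnorm (g1 t - g2 t) / (2 * pi)"
proof -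
  assume t: "0 \<le> t"
  note D = fc_diff[OF inL2_forcing[OF t]]
  have "fc (g1 t - g2 t) = d t" unfolding d_def[abs_def] using D(2) by (auto simp: fun_eq_iff)
  then show ?thesis using Hnorm_eq_seq_L2(2)[OF D(1)] by simp
qed

lemma seq_L2_d_bounded: "\<exists>B. \<forall>t\<ge>0. seq_L2 (d t) \<le> B"
proof -
  obtain M1 M2 where M: "\<And>t. 0 \<le> t \<Longrightarrow> Hnorm (g1 t) \<le> M1" "\<And>t. 0 \<le> t \<Longrightarrow> Hnorm (g2 t) \<le> M2"
    using forcing1 forcing2 unfolding forcing_def by blast
  have "seq_L2 (d t) \<le> M1 / (2 * pi) + M2 / (2 * pi)" if t: "0 \<le> t" for t
  proof -
    note e = Hnorm_eq_seq_L2[OF inL2_forcing(1)[OF t]] Hnorm_eq_seq_L2[OF inL2_forcing(2)[OF t]]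
    have "seq_L2 (d t) \<le> seq_L2 (fc (g1 t)) + seq_L2 (fc (g2 t))"
      using seq_L2_lincomb(2)[OF e(1) e(3) norm_lincomb, of 1 "-1"] by (simp add: d_def[abs_def])
    moreover have "seq_L2 (fc (g1 t)) \<le> M1 / (2 * pi)" "seq_L2 (fc (g2 t)) \<le> M2 / (2 * pi)"
      using M[OF t] unfolding e(2) e(4) by (simp_all add: pos_le_divide_eq mult.commute)
    ultimately show ?thesis by linarith
  qed
  then show ?thesis by blast
qed

lemma seq_L2_d_tendsto: "((\<lambda>t. seq_L2 (d t)) \<longlongrightarrow> 0) at_top"
proof (rule Lim_transform_eventually)
  show "((\<lambda>t. Hnorm (g1 t - g2 t) / (2 * pi)) \<longlongrightarrow> 0) at_top"
    using tendsto_divide[OF forcing_diff tendsto_const, of "2 * pi"] by simp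
  show "\<forall>\<^sub>F t in at_top. Hnorm (g1 t - g2 t) / (2 * pi) = seq_L2 (d t)"
    using eventually_ge_at_top[of 0] by eventually_elim (simp add: seq_L2_d)
qed

lemma PNc_minus: "PNc N k (x - y) = - PNc N k (y - x)"
  by (simp add: PNc_def)

text \<open>Because \<open>\<theta>1 + \<theta>2 = 1\<close> the two coupling terms add up to the
  projection of the whole difference of the nonlinearities, with weight exactly 1.\<close>

lemma F_difference: "1 *\<^sub>R F1 s k + (-1) *\<^sub>R F2 s k
  = - (\<nu> * ksq k) *\<^sub>R W s k + d s k - (Bc (v1 s) (v1 s) k - Bc (v2 s) (v2 s) k)
    + PNc N k (Bc (v1 s) (v1 s) k - Bc (v2 s) (v2 s) k)"
proof -
  have "\<theta>1 *\<^sub>R z + \<theta>2 *\<^sub>R z = z" for z :: "complex^2"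
    using th(3) by (simp flip: scaleR_add_left)
  note z = this[of "PNc N k (Bc (v1 s) (v1 s) k - Bc (v2 s) (v2 s) k)", symmetric]
  show ?thesis
    unfolding F1_def F2_def of_real_minus[symmetric] real_vector_smult W_def d_def PNc_minus[of k "Bc (v2 s) (v2 s) k"]
    by (subst (2) z) (simp add: algebra_simps)
qed

text \<open>With exchanged weights the coupling terms carry the factors
  \<open>\<theta>2 * \<theta>1\<close> and \<open>- \<theta>1 * \<theta>2\<close>, so no projection
  remains.\<close>

lemma F_average: "\<theta>2 *\<^sub>R F1 s k + \<theta>1 *\<^sub>R F2 s k
  = - (\<nu> * ksq k) *\<^sub>R V s k + G s k - (\<theta>2 *\<^sub>R Bc (v1 s) (v1 s) k + \<theta>1 *\<^sub>R Bc (v2 s) (v2 s) k)"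
  unfolding F1_def F2_def of_real_minus[symmetric] real_vector_smult V_def G_def PNc_minus[of k "Bc (v2 s) (v2 s) k"]
  by (simp add: algebra_simps)

lemma balance_V:
  "\<exists>h. primitive_from 0 (\<lambda>t. (seq_L2 (V t))^2) h \<and>
    (AE t in lborel. 0 \<le> t \<longrightarrow> h t = - 2 * \<nu> * (seq_H1 (V t))^2 + 2 * (\<Sum>\<^sub>\<infinity>k. V t k \<bullet> G t k)
      - 2 * fluxV t)"
proof (rule energy_balance[where f="\<lambda>s k. \<theta>2 *\<^sub>R F1 s k + \<theta>1 *\<^sub>R F2 s k" and B=g])
  show "V s k \<bullet> (\<theta>2 *\<^sub>R F1 s k + \<theta>1 *\<^sub>R F2 s k) = - \<nu> * (ksq k * (norm (V s k))^2) + V s k \<bullet> G s k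
      - (\<theta>2 * (Bc (v1 s) (v1 s) k \<bullet> V s k) + \<theta>1 * (Bc (v2 s) (v2 s) k \<bullet> V s k))" for s k
    unfolding F_average by (simp add: inner_diff_right inner_add_right power2_norm_eq_inner inner_commute)
  show "seq_L2 (G t) \<le> g" if "0 \<le> t" for t using forcing_bound[OF that] by (simp add: G_def[abs_def])
  show "set_integrable lborel {0..t} (\<lambda>s. \<theta>2 *\<^sub>R F1 s k + \<theta>1 *\<^sub>R F2 s k)" if "0 \<le> t" for t k
    by (rule modes_lincomb(1)[OF that])
  show "V t k = V 0 k + (LINT s:{0..t}|lborel. \<theta>2 *\<^sub>R F1 s k + \<theta>1 *\<^sub>R F2 s k)" if "0 \<le> t" for t k
    unfolding V_def by (rule modes_lincomb(2)[OF that])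
qed (intro inH1_V wiener_H1_all seq_H1_V_le ell2_forcing; assumption)+

lemma restricted_modes:
  assumes t: "0 \<le> t"
  shows "set_integrable lborel {0..t} (\<lambda>s. if K k then 1 *\<^sub>R F1 s k + (-1) *\<^sub>R F2 s k else 0)"
    "restrict_modes K (W t) k = restrict_modes K (W 0) k
      + (LINT s:{0..t}|lborel. if K k then 1 *\<^sub>R F1 s k + (-1) *\<^sub>R F2 s k else 0)"
proof -
  note m = modes_lincomb[OF t, where r=1 and k=k and r'="-1"]
  show "set_integrable lborel {0..t} (\<lambda>s. if K k then 1 *\<^sub>R F1 s k + (-1) *\<^sub>R F2 s k else 0)"
  proof (cases "K k")
    case True
    then show ?thesis using m(1) by (simp only: if_True)
  qed (simp add: set_integrable_def)
  show "restrict_modes K (W t) k = restrict_modes K (W 0) k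
      + (LINT s:{0..t}|lborel. if K k then 1 *\<^sub>R F1 s k + (-1) *\<^sub>R F2 s k else 0)"
  proof (cases "K k")
    case True
    then show ?thesis unfolding restrict_modes_def W_def using m(2) by (simp only: if_True)
  qed (simp add: restrict_modes_def set_lebesgue_integral_def)
qed

text \<open>\<open>c\<close> is the fraction of the nonlinear difference that the coupling leaves on
  the chosen modes: 0 on the low ones, 1 on the high ones. The zero mode is exempt because
  \<open>x\<close> vanishes there.\<close>

lemma balance_restricted:
  assumes K: "\<And>k. K (- k) = K k"
    and c: "\<And>k z. K k \<Longrightarrow> k \<noteq> 0 \<Longrightarrow> PNc N k z = (1 - c) *\<^sub>R z"
    and x: "x = (\<lambda>t. restrict_modes K (W t))"
  shows "\<exists>h. primitive_from 0 (\<lambda>t. (seq_L2 (x t))^2) h \<and>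
    (AE t in lborel. 0 \<le> t \<longrightarrow> h t = - 2 * \<nu> * (seq_H1 (x t))^2 + 2 * (\<Sum>\<^sub>\<infinity>k. x t k \<bullet> d t k)
      - 2 * (c * tri (a1 t) (a1 t) (x t) + (- c) * tri (a2 t) (a2 t) (x t)))"
proof -
  obtain B where B: "\<And>t. 0 \<le> t \<Longrightarrow> seq_L2 (d t) \<le> B" using seq_L2_d_bounded by blast
  have H: "inH1 (x t)" if "0 \<le> t" for t unfolding x by (intro restrict_modes_inH1(1) inH1_W that K)
  show ?thesis
  proof (rule energy_balance[where f="\<lambda>s k. if K k then 1 *\<^sub>R F1 s k + (-1) *\<^sub>R F2 s k else 0" and B=B])
    fix s :: real and k assume s: "0 \<le> s"
    have x0: "x s 0 = 0" using H[OF s] by (simp add: inH1_def solenoidal_0)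
    show "x s k \<bullet> (if K k then 1 *\<^sub>R F1 s k + (-1) *\<^sub>R F2 s k else 0)
      = - \<nu> * (ksq k * (norm (x s k))^2) + x s k \<bullet> d s k
      - (c * (Bc (v1 s) (v1 s) k \<bullet> x s k) + (- c) * (Bc (v2 s) (v2 s) k \<bullet> x s k))"
    proof (cases "K k \<and> k \<noteq> 0")
      case True
      moreover have "x s k = W s k" using True by (simp add: x restrict_modes_def)
      ultimately show ?thesis unfolding F_difference
        by (simp add: c algebra_simps inner_diff_left inner_diff_right inner_add_right power2_norm_eq_inner inner_commute)
    next
      case False
      then have "x s k = 0" using x0 by (auto simp: x restrict_modes_def)
      then show ?thesis by simp
    qed
  next
    show "seq_H1 (x t) \<le> seq_H1 (a1 t) + seq_H1 (a2 t)" if "0 \<le> t" for t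
      using restrict_modes_inH1(2)[where K=K, OF inH1_W[OF that] K] seq_H1_W_le[OF that] by (simp add: x)
    show "wiener_H1 (x t)" if "wiener_H1 (a1 t)" "wiener_H1 (a2 t)" for t
      unfolding x W_def[abs_def] by (intro restrict_modes_wiener_H1 wiener_H1_lincomb that K)
  next
    fix t :: real and k assume t: "0 \<le> t"
    show "set_integrable lborel {0..t} (\<lambda>s. if K k then 1 *\<^sub>R F1 s k + (-1) *\<^sub>R F2 s k else 0)"
      by (rule restricted_modes(1)[OF t])
    show "x t k = x 0 k + (LINT s:{0..t}|lborel. if K k then 1 *\<^sub>R F1 s k + (-1) *\<^sub>R F2 s k else 0)"
      unfolding x by (rule restricted_modes(2)[OF t])
  qed (intro H ell2_forcing B; assumption)+
qed

lemma balance_P: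
  "\<exists>h. primitive_from 0 (\<lambda>t. (seq_L2 (P t))^2) h \<and>
    (AE t in lborel. 0 \<le> t \<longrightarrow> h t = - 2 * \<nu> * (seq_H1 (P t))^2 + 2 * (\<Sum>\<^sub>\<infinity>k. P t k \<bullet> d t k))"
proof -
  have "PNc N k z = (1 - 0) *\<^sub>R z" if "low k" "k \<noteq> 0" for k z
    using that ksq_ge_1[of k] by (simp add: PNc_def low_def)
  from balance_restricted[where x=P and K=low and c=0, OF low_minus this] show ?thesis by (simp add: P_def[abs_def])
qed

lemma balance_Q:
  "\<exists>h. primitive_from 0 (\<lambda>t. (seq_L2 (Q t))^2) h \<and>
    (AE t in lborel. 0 \<le> t \<longrightarrow> h t = - 2 * \<nu> * (seq_H1 (Q t))^2 + 2 * (\<Sum>\<^sub>\<infinity>k. Q t k \<bullet> d t k) - 2 * fluxQ t)"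
proof -
  have "PNc N k z = (1 - 1) *\<^sub>R z" if "\<not> low k" for k z
    using that by (simp add: PNc_def low_def)
  from balance_restricted[where x=Q and K="\<lambda>k. \<not> low k" and c=1, OF _ this] show ?thesis
    by (simp add: Q_def[abs_def] low_minus)
qed

lemma finite_low: "finite {k. low k}"
proof (rule finite_subset)
  show "{k. low k} \<subseteq> mode_box (nat \<lceil>N\<rceil>)"
  proof
    fix k assume "k \<in> {k. low k}"
    then have k: "(real_of_int (fst k))^2 + (real_of_int (snd k))^2 \<le> N^2" by (simp add: low_def ksq_def)
    then have "(real_of_int (fst k))^2 \<le> N^2" "(real_of_int (snd k))^2 \<le> N^2"
      using zero_le_power2[of "real_of_int (fst k)"] zero_le_power2[of "real_of_int (snd k)"] by linarith+
    then have "\<bar>real_of_int (fst k)\<bar> \<le> N" "\<bar>real_of_int (snd k)\<bar> \<le> N"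
      using N by (simp_all add: abs_le_square_iff[symmetric])
    then show "k \<in> mode_box (nat \<lceil>N\<rceil>)"
      by (cases k) (auto simp: mode_box_def abs_le_iff; linarith)
  qed
qed simp

definition K :: real where "K = (1 + N) * (1 + sqrt (card {k. low k}))"
text \<open>The constant \<open>K\<close> makes this a common bound for all norms of P that enter
  the trilinear terms; the only thing used about it later is that it is nonnegative and tends to
  0.\<close>

definition \<delta> :: "real \<Rightarrow> real" where "\<delta> t = K * seq_L2 (P t)"
definition \<epsilon> :: "real \<Rightarrow> real" where "\<epsilon> t = seq_L2 (d t)"

lemma K_pos: "0 \<le> K" unfolding K_def using N by (intro mult_nonneg_nonneg) auto
lemma \<delta>_pos: "0 \<le> \<delta> t" unfolding \<delta>_def using K_pos seq_L2_pos by simp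
lemma \<epsilon>_pos: "0 \<le> \<epsilon> t" unfolding \<epsilon>_def by (rule seq_L2_pos)

lemma P_norms:
  assumes t: "0 \<le> t"
  shows "seq_l1 (P t) \<le> \<delta> t" "seq_H1 (P t) \<le> \<delta> t" "(\<lambda>k. sqrt (ksq k) * norm (P t k)) summable_on UNIV"
    "(\<Sum>\<^sub>\<infinity>k. sqrt (ksq k) * norm (P t k)) \<le> \<delta> t"
  unfolding \<delta>_def K_def
  by (rule low_mode_norms[OF inH1_P[OF t] finite_low, of N]; use N in \<open>auto simp: P_def restrict_modes_def low_def\<close>)+

text \<open>In a forced heat equation, Poincare turns the dissipation into the damping rate
  \<open>2 * \<nu>\<close>; half of it pays for the forcing by Young's inequality and the other half
  is the rate \<open>\<nu>\<close> given to Gronwall.\<close>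

lemma P_tendsto: "((\<lambda>t. seq_L2 (P t)) \<longlongrightarrow> 0) at_top"
proof -
  obtain h where h: "primitive_from 0 (\<lambda>t. (seq_L2 (P t))^2) h"
    "AE t in lborel. 0 \<le> t \<longrightarrow> h t = - 2 * \<nu> * (seq_H1 (P t))^2 + 2 * (\<Sum>\<^sub>\<infinity>k. P t k \<bullet> d t k)"
    using balance_P by blast
  have "((\<lambda>t. (seq_L2 (P t))^2) \<longlongrightarrow> 0) at_top"
  proof (rule gronwall_tendsto_0[OF h(1), where b="\<lambda>_. \<nu>" and \<alpha>=\<nu> and K=0 and \<gamma>="\<lambda>t. (\<epsilon> t)^2 / \<nu>"])
    show "AE r in lborel. 0 \<le> r \<longrightarrow> h r \<le> - \<nu> * (seq_L2 (P r))^2 + (\<epsilon> r)^2 / \<nu>"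
      using h(2)
    proof eventually_elim
      case (elim t)
      show ?case
      proof
        assume t: "0 \<le> t"
        have "(seq_L2 (P t))^2 \<le> (seq_H1 (P t))^2"
          using inH1_ell2(2)[OF inH1_P[OF t]] by (intro power_mono seq_L2_pos)
        then have "\<nu> * (seq_L2 (P t))^2 \<le> \<nu> * (seq_H1 (P t))^2" using \<nu> by (intro mult_left_mono) auto
        moreover have "(\<Sum>\<^sub>\<infinity>k. P t k \<bullet> d t k) \<le> seq_L2 (P t) * \<epsilon> t"
          using inner_ell2(4)[OF inH1_ell2(1)[OF inH1_P[OF t]] ell2_forcing(2)[OF t]] by (simp add: \<epsilon>_def)
        moreover have "2 * (seq_L2 (P t) * \<epsilon> t) \<le> \<nu> * (seq_L2 (P t))^2 + (\<epsilon> t)^2 / \<nu>" by (rule young_product[OF \<nu>])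
        moreover have "h t = - 2 * \<nu> * (seq_H1 (P t))^2 + 2 * (\<Sum>\<^sub>\<infinity>k. P t k \<bullet> d t k)" using elim t by blast
        ultimately show "h t \<le> - \<nu> * (seq_L2 (P t))^2 + (\<epsilon> t)^2 / \<nu>" by simp
      qed
    qed
    have "((\<lambda>t. (seq_L2 (d t))^2 / \<nu>) \<longlongrightarrow> 0^2 / \<nu>) at_top" using \<nu> by (intro tendsto_intros seq_L2_d_tendsto) auto
    then show "((\<lambda>t. (\<epsilon> t)^2 / \<nu>) \<longlongrightarrow> 0) at_top" by (simp add: \<epsilon>_def)
  qed (use \<nu> lint_const in auto)
  then have "((\<lambda>t. sqrt ((seq_L2 (P t))^2)) \<longlongrightarrow> sqrt 0) at_top" by (intro tendsto_real_sqrt)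
  then show ?thesis by (simp add: seq_L2_pos)
qed

lemma \<delta>_tendsto: "(\<delta> \<longlongrightarrow> 0) at_top"
  using tendsto_mult_left[OF P_tendsto, of K] by (simp add: \<delta>_def[abs_def])

lemma \<epsilon>_tendsto: "(\<epsilon> \<longlongrightarrow> 0) at_top"
  using seq_L2_d_tendsto by (simp add: \<epsilon>_def[abs_def])

lemma g_pos: "0 \<le> g"
  using forcing_bound[of 0] seq_L2_pos order_trans by blast

text \<open>The first bound keeps \<open>tri Q V Q\<close> and estimates it by Ladyzhenskaya. In the
  second the weight \<open>\<mu>\<close> makes it cancel against the same term from the balance of
  V, so that every remaining term contains P.\<close>

lemma trilinear_at:
  assumes t: "0 \<le> t" and DA: "inDA (v1 t)" "inDA (v2 t)"
  defines "q \<equiv> seq_L2 (Q t)" and "v \<equiv> seq_L2 (V t)"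
  shows "- fluxQ t
      \<le> (\<delta> t * (v * q) + \<delta> t * (seq_H1 (V t) * q) + (\<delta> t * (\<delta> t * q) + \<delta> t * (q * q))) + 2 * pi * C * seq_H1 (Q t) * q * seq_H1 (V t)"
    "- fluxV t
      - \<mu> * fluxQ t
      \<le> \<mu> * (\<delta> t * (\<delta> t * v) + 2 * (\<delta> t * (v * q)) + \<delta> t * (\<delta> t * q) + \<delta> t * (q * q))"
proof -
  have A: "wiener_H1 (a1 t)" "wiener_H1 (a2 t)" using inDA_wiener_H1(1) inV1 inV2 t DA by blast+
  note ad = wiener_H1_all[OF A]
  have W: "W t = (\<lambda>k. P t k + Q t k)" by (auto simp: P_def Q_def restrict_modes_def)
  have "V t k + \<theta>1 *\<^sub>R W t k = (\<theta>1 + \<theta>2) *\<^sub>R a1 t k" for k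
    by (simp add: V_def W_def algebra_simps)
  then have A1: "a1 t = (\<lambda>k. V t k + \<theta>1 *\<^sub>R W t k)" by (simp add: th)
  have "V t k + (- \<theta>2) *\<^sub>R W t k = (\<theta>1 + \<theta>2) *\<^sub>R a2 t k" for k
    by (simp add: V_def W_def algebra_simps)
  then have A2: "a2 t = (\<lambda>k. V t k + (- \<theta>2) *\<^sub>R W t k)" by (simp only: th scaleR_one)
  note S = tri_split[OF ad(1,2,3) th(3) W A1 A2]
  note bV = low_tri_bounds[OF ad(2) ad(1) ad(3) P_norms[OF t]]
  note bQ = low_tri_bounds[OF ad(2) ad(3) ad(3) P_norms[OF t]]
  note bQV = low_tri_bounds[OF ad(2) ad(3) ad(1) P_norms[OF t]]
  have lad: "\<bar>tri (Q t) (V t) (Q t)\<bar> \<le> 2 * pi * C * seq_H1 (Q t) * q * seq_H1 (V t)"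
    unfolding q_def by (rule tri_ladyzhenskaya[OF C(2) ad(3) ad(1) C(1)])
  have ab: "\<bar>\<theta>1 - \<theta>2\<bar> \<le> 1" using th by auto
  have Y: "\<bar>(\<theta>1 - \<theta>2) * (tri (P t) (P t) (Q t) + tri (Q t) (P t) (Q t))\<bar> \<le> \<delta> t * (\<delta> t * q) + \<delta> t * (q * q)"
  proof -
    have "\<bar>(\<theta>1 - \<theta>2) * (tri (P t) (P t) (Q t) + tri (Q t) (P t) (Q t))\<bar>
        \<le> 1 * \<bar>tri (P t) (P t) (Q t) + tri (Q t) (P t) (Q t)\<bar>"
      unfolding abs_mult by (intro mult_right_mono ab) auto
    also have "\<dots> \<le> \<delta> t * (\<delta> t * q) + \<delta> t * (q * q)"
    proof -
      have "1 * \<bar>x + y\<bar> \<le> a + b" if "\<bar>x\<bar> \<le> a" "\<bar>y\<bar> \<le> b" for x y a b :: real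
        using that unfolding mult_1 by linarith
      then show ?thesis unfolding q_def using bQ(3) bQ(1) by blast
    qed
    finally show ?thesis .
  qed
  show "- fluxQ t
      \<le> (\<delta> t * (v * q) + \<delta> t * (seq_H1 (V t) * q) + (\<delta> t * (\<delta> t * q) + \<delta> t * (q * q))) + 2 * pi * C * seq_H1 (Q t) * q * seq_H1 (V t)"
  proof -
    have "- (A - B) \<le> (b1 + b2 + b3) + b0"
      if "A - B = T + (x1 + x2 + y)" "\<bar>T\<bar> \<le> b0" "\<bar>x1\<bar> \<le> b1" "\<bar>x2\<bar> \<le> b2" "\<bar>y\<bar> \<le> b3"
      for A B T x1 x2 y b0 b1 b2 b3 :: real
      using that by linarith
    from this[OF S(1) lad bV(1)[folded q_def v_def] bV(2)[folded q_def] Y] show ?thesis .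
  qed
  have "- fluxV t
      - \<mu> * fluxQ t
      = \<mu> * (- tri (P t) (P t) (V t) - tri (Q t) (P t) (V t) - tri (V t) (P t) (Q t)
         - (\<theta>1 - \<theta>2) * (tri (P t) (P t) (Q t) + tri (Q t) (P t) (Q t)))"
    unfolding S \<mu>_def by (simp add: algebra_simps)
  also have "\<dots> \<le> \<mu> * (\<delta> t * (\<delta> t * v) + 2 * (\<delta> t * (v * q)) + \<delta> t * (\<delta> t * q) + \<delta> t * (q * q))"
  proof (intro mult_left_mono \<mu>)
    have "- x1 - x2 - x3 - y \<le> b1 + 2 * b2 + b3 + b4"
      if "\<bar>x1\<bar> \<le> b1" "\<bar>x2\<bar> \<le> b2" "\<bar>x3\<bar> \<le> b2" "\<bar>y\<bar> \<le> b3 + b4"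
      for x1 x2 x3 y b1 b2 b3 b4 :: real
      using that by linarith
    from this[OF bQV(3)[folded v_def] bQV(1)[folded q_def v_def, unfolded mult.commute[of q v]] bV(1)[folded q_def v_def] Y]
    show "- tri (P t) (P t) (V t) - tri (Q t) (P t) (V t) - tri (V t) (P t) (Q t)
         - (\<theta>1 - \<theta>2) * (tri (P t) (P t) (Q t) + tri (Q t) (P t) (Q t))
      \<le> \<delta> t * (\<delta> t * v) + 2 * (\<delta> t * (v * q)) + \<delta> t * (\<delta> t * q) + \<delta> t * (q * q)" .
  qed
  finally show "- fluxV t
      - \<mu> * fluxQ t
      \<le> \<mu> * (\<delta> t * (\<delta> t * v) + 2 * (\<delta> t * (v * q)) + \<delta> t * (\<delta> t * q) + \<delta> t * (q * q))" .
qed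

section \<open>Long-time averages and decay of the high modes\<close>

definition E :: "real \<Rightarrow> real" where "E t = (seq_L2 (V t))^2 + \<mu> * (seq_L2 (Q t))^2"

definition rateE :: "real \<Rightarrow> real" where
  "rateE t = - \<nu> * (seq_H1 (V t))^2 - 2 * \<nu> * \<mu> * (seq_H1 (Q t))^2 + g^2 / \<nu> + (6 * \<delta> t + \<epsilon> t) * (1 + E t)"

definition rateQ :: "real \<Rightarrow> real" where
  "rateQ t = - (\<nu> * max 1 (N^2) - ((2 * pi * C)^2 / \<nu> + 2 * \<delta> t) * (seq_H1 (V t))^2 - (3 * \<delta> t + \<epsilon> t)) * (seq_L2 (Q t))^2
      + (3 * \<delta> t + \<epsilon> t)"

lemma E_pos: "0 \<le> E t" using \<mu> by (simp add: E_def)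

text \<open>No term cubic in V and Q survives in this combination, so the estimate needs no
  smallness of the data. For \<open>\<mu> = 0\<close> it is the energy estimate of the uncoupled
  solution, and Q is then controlled by its own balance only. The restriction
  \<open>\<delta> t \<le> 1\<close> holds from some time on.\<close>

lemma energy_E:
  "\<exists>h. primitive_from 0 E h \<and> (AE t in lborel. 0 \<le> t \<longrightarrow> \<delta> t \<le> 1 \<longrightarrow>
    h t \<le> rateE t)"
proof -
  obtain hV where hV: "primitive_from 0 (\<lambda>t. (seq_L2 (V t))^2) hV"
    "AE t in lborel. 0 \<le> t \<longrightarrow> hV t = - 2 * \<nu> * (seq_H1 (V t))^2 + 2 * (\<Sum>\<^sub>\<infinity>k. V t k \<bullet> G t k)
      - 2 * fluxV t"
    using balance_V by blast
  obtain hQ where hQ: "primitive_from 0 (\<lambda>t. (seq_L2 (Q t))^2) hQ"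
    "AE t in lborel. 0 \<le> t \<longrightarrow> hQ t = - 2 * \<nu> * (seq_H1 (Q t))^2 + 2 * (\<Sum>\<^sub>\<infinity>k. Q t k \<bullet> d t k)
      - 2 * fluxQ t"
    using balance_Q by blast
  have "primitive_from 0 E (\<lambda>t. hV t + \<mu> * hQ t)"
    unfolding E_def[abs_def] by (rule primitive_from_add[OF hV(1) primitive_from_cmult[OF hQ(1)]])
  moreover have "AE t in lborel. 0 \<le> t \<longrightarrow> \<delta> t \<le> 1 \<longrightarrow> hV t + \<mu> * hQ t
      \<le> rateE t"
    using hV(2) hQ(2) AE_inDA
  proof eventually_elim
    case (elim t)
    show ?case
    proof (intro impI)
      assume t: "0 \<le> t" and \<delta>1: "\<delta> t \<le> 1"
      have DA: "inDA (v1 t)" "inDA (v2 t)" using elim t by blast+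
      define Z where "Z = - fluxV t
        - \<mu> * fluxQ t"
      have S1: "(\<Sum>\<^sub>\<infinity>k. V t k \<bullet> G t k) \<le> seq_L2 (V t) * g"
      proof -
        have "(\<Sum>\<^sub>\<infinity>k. V t k \<bullet> G t k) \<le> seq_L2 (V t) * seq_L2 (G t)"
          using inner_ell2(4)[OF inH1_ell2(1)[OF inH1_V[OF t]] ell2_forcing(1)[OF t]] by simp
        also have "\<dots> \<le> seq_L2 (V t) * g"
          using forcing_bound[OF t] seq_L2_pos by (intro mult_left_mono) (auto simp: G_def[abs_def])
        finally show ?thesis .
      qed
      have S2: "(\<Sum>\<^sub>\<infinity>k. Q t k \<bullet> d t k) \<le> seq_L2 (Q t) * \<epsilon> t"
        using inner_ell2(4)[OF inH1_ell2(1)[OF inH1_Q[OF t]] ell2_forcing(2)[OF t]] by (simp add: \<epsilon>_def)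
      have e1: "hV t = - 2 * \<nu> * (seq_H1 (V t))^2 + 2 * (\<Sum>\<^sub>\<infinity>k. V t k \<bullet> G t k)
        - 2 * fluxV t" using elim t by blast
      have e2: "hQ t = - 2 * \<nu> * (seq_H1 (Q t))^2 + 2 * (\<Sum>\<^sub>\<infinity>k. Q t k \<bullet> d t k)
        - 2 * fluxQ t" using elim t by blast
      have "hV t + \<mu> * hQ t = - 2 * \<nu> * (seq_H1 (V t))^2 + 2 * (\<Sum>\<^sub>\<infinity>k. V t k \<bullet> G t k)
        + \<mu> * (- 2 * \<nu> * (seq_H1 (Q t))^2 + 2 * (\<Sum>\<^sub>\<infinity>k. Q t k \<bullet> d t k)) + 2 * Z"
      proof -
        have "s - 2 * A + \<mu> * (s' - 2 * B) = s + \<mu> * s' + 2 * (- A - \<mu> * B)" for s s' A B :: real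
          by (simp add: algebra_simps)
        then show ?thesis unfolding e1 e2 Z_def .
      qed
      also have "\<dots> \<le> - \<nu> * (seq_H1 (V t))^2 - 2 * \<nu> * \<mu> * (seq_H1 (Q t))^2 + g^2 / \<nu>
        + (6 * \<delta> t + \<epsilon> t) * (1 + ((seq_L2 (V t))^2 + \<mu> * (seq_L2 (Q t))^2))"
        by (rule coupled_energy_estimate[OF \<nu> \<delta>_pos \<delta>1 \<epsilon>_pos \<mu> seq_L2_pos inH1_ell2(2)[OF inH1_V[OF t]] seq_L2_pos g_pos S1 S2
              trilinear_at(2)[OF t DA, folded Z_def]])
      finally show "hV t + \<mu> * hQ t
        \<le> rateE t"
        by (simp add: E_def rateE_def)
    qed
  qed
  ultimately show ?thesis by blast
qed

text \<open>A mode outside \<open>low\<close> satisfies \<open>ksq k > N^2\<close> and is nonzero,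
  hence also \<open>ksq k \<ge> 1\<close>. The second bound is the stronger one for
  \<open>N < 1\<close>.\<close>

lemma high_modes_poincare: assumes "0 \<le> t" shows "max 1 (N^2) * (seq_L2 (Q t))^2 \<le> (seq_H1 (Q t))^2"
proof -
  have e: "(\<lambda>k. (norm (Q t k))^2) summable_on UNIV" using inH1_ell2(1)[OF inH1_Q[OF assms]] by (simp add: ell2_def)
  note h = h1_has_sum[OF inH1_Q[OF assms]]
  have "max 1 (N^2) * (seq_L2 (Q t))^2 = (\<Sum>\<^sub>\<infinity>k. max 1 (N^2) * (norm (Q t k))^2)"
    by (simp add: seq_L2_def nrm2_sq infsum_cmult_right')
  also have "\<dots> \<le> (\<Sum>\<^sub>\<infinity>k. ksq k * (norm (Q t k))^2)"
  proof (rule infsum_mono)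
    show "(\<lambda>k. max 1 (N^2) * (norm (Q t k))^2) summable_on UNIV" using e by (rule summable_on_cmult_right)
    show "(\<lambda>k. ksq k * (norm (Q t k))^2) summable_on UNIV" by (rule has_sum_imp_summable[OF h])
    show "max 1 (N^2) * (norm (Q t k))^2 \<le> ksq k * (norm (Q t k))^2" for k
    proof (cases "low k")
      case False
      then have "N^2 \<le> ksq k" "k \<noteq> 0" by (auto simp: low_def)
      then show ?thesis using ksq_ge_1[of k] by (intro mult_right_mono) auto
    qed (simp add: Q_def restrict_modes_def)
  qed
  also have "\<dots> = (seq_H1 (Q t))^2" by (rule infsumI[OF h])
  finally show ?thesis .
qed

lemma energy_Q:
  "\<exists>h. primitive_from 0 (\<lambda>t. (seq_L2 (Q t))^2) h \<and> (AE t in lborel. 0 \<le> t \<longrightarrow> \<delta> t \<le> 1 \<longrightarrow>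
    h t \<le> rateQ t)"
proof -
  obtain hQ where hQ: "primitive_from 0 (\<lambda>t. (seq_L2 (Q t))^2) hQ"
    "AE t in lborel. 0 \<le> t \<longrightarrow> hQ t = - 2 * \<nu> * (seq_H1 (Q t))^2 + 2 * (\<Sum>\<^sub>\<infinity>k. Q t k \<bullet> d t k)
      - 2 * fluxQ t"
    using balance_Q by blast
  have "AE t in lborel. 0 \<le> t \<longrightarrow> \<delta> t \<le> 1 \<longrightarrow>
    hQ t \<le> rateQ t"
    using hQ(2) AE_inDA
  proof eventually_elim
    case (elim t)
    show ?case
    proof (intro impI)
      assume t: "0 \<le> t" and \<delta>1: "\<delta> t \<le> 1"
      have DA: "inDA (v1 t)" "inDA (v2 t)" using elim t by blast+
      have S2: "(\<Sum>\<^sub>\<infinity>k. Q t k \<bullet> d t k) \<le> seq_L2 (Q t) * \<epsilon> t"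
        using inner_ell2(4)[OF inH1_ell2(1)[OF inH1_Q[OF t]] ell2_forcing(2)[OF t]] by (simp add: \<epsilon>_def)
      have "hQ t = - 2 * \<nu> * (seq_H1 (Q t))^2 + 2 * (\<Sum>\<^sub>\<infinity>k. Q t k \<bullet> d t k)
        - 2 * fluxQ t" using elim t by blast
      also have "\<dots> \<le> - 2 * \<nu> * (seq_H1 (Q t))^2 + 2 * (\<Sum>\<^sub>\<infinity>k. Q t k \<bullet> d t k)
        + 2 * ((\<delta> t * (seq_L2 (V t) * seq_L2 (Q t)) + \<delta> t * (seq_H1 (V t) * seq_L2 (Q t))
            + (\<delta> t * (\<delta> t * seq_L2 (Q t)) + \<delta> t * (seq_L2 (Q t) * seq_L2 (Q t)))) + 2 * pi * C * seq_H1 (Q t) * seq_L2 (Q t) * seq_H1 (V t))"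
      proof -
        have "s - 2 * A \<le> s + 2 * B" if "- A \<le> B" for s A B :: real using that by linarith
        from this[OF trilinear_at(1)[OF t DA]] show ?thesis .
      qed
      also have "\<dots> \<le> rateQ t"
        unfolding rateQ_def by (rule high_mode_estimate[OF \<nu> \<delta>_pos \<delta>1 \<epsilon>_pos seq_L2_pos inH1_ell2(2)[OF inH1_V[OF t]] seq_L2_pos seq_H1_pos
              high_modes_poincare[OF t] S2 order_refl order_refl])
      finally show "hQ t \<le> rateQ t" .
    qed
  qed
  with hQ(1) show ?thesis by blast
qed

lemma eventually_ge_bound:
  fixes f :: "real \<Rightarrow> real"
  assumes "(f \<longlongrightarrow> (0::real)) at_top" "0 < e"
  shows "\<exists>t1\<ge>t0. \<forall>t\<ge>t1. f t \<le> e"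
proof -
  obtain t2 where "\<And>t. t \<ge> t2 \<Longrightarrow> f t < e"
    using order_tendstoD(2)[OF assms] unfolding eventually_at_top_linorder by blast
  then show ?thesis by (intro exI[of _ "max t0 t2"]) (auto intro: less_imp_le)
qed

lemma integrable_seq_H1_V: assumes "0 \<le> r" shows "set_integrable lborel {r..t} (\<lambda>s. (seq_H1 (V s))^2)"
proof -
  have "continuous_on {r..t} (\<lambda>s. seq_H1 (V s))"
    using continuous_on_subset[OF continuous_seq_H1[of \<theta>2 \<theta>1], of "{r..t}"] assms by (auto simp: V_def[abs_def])
  then show ?thesis by (intro borel_integrable_atLeastAtMost' continuous_intros)
qed

text \<open>The error depends on E itself, so there are two rounds: half of the damping absorbs it
  and bounds E, after which the now bounded E makes the error smaller than any \<open>e0\<close>. It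
  matters that \<open>M\<close> does not depend on \<open>r\<close> and \<open>t\<close>: it becomes
  the defect in the Gronwall estimate of Q.\<close>

lemma dissipation_bound:
  assumes e0: "0 < e0"
  shows "\<exists>t1\<ge>0. \<exists>M\<ge>0. \<forall>r\<ge>t1. \<forall>t\<ge>r. \<nu> * (LINT s:{r..t}|lborel. (seq_H1 (V s))^2) \<le> M + (g^2 / \<nu> + e0) * (t - r)"
proof -
  obtain h where h: "primitive_from 0 E h" "AE t in lborel. 0 \<le> t \<longrightarrow> \<delta> t \<le> 1 \<longrightarrow>
    h t \<le> rateE t"
    using energy_E by blast
  have \<eta>0: "((\<lambda>t. 6 * \<delta> t + \<epsilon> t) \<longlongrightarrow> 0) at_top"
    using tendsto_add[OF tendsto_mult_left[OF \<delta>_tendsto, of 6] \<epsilon>_tendsto] by simp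
  obtain ta where ta: "ta \<ge> 0" "\<And>t. t \<ge> ta \<Longrightarrow> \<delta> t \<le> 1"
    using eventually_ge_bound[OF \<delta>_tendsto, of 1 0] by auto
  obtain t0 where t0: "t0 \<ge> ta" "\<And>t. t \<ge> t0 \<Longrightarrow> 6 * \<delta> t + \<epsilon> t \<le> \<nu> / 2"
    using eventually_ge_bound[OF \<eta>0, of "\<nu> / 2" ta] \<nu> by auto
  have t00: "0 \<le> t0" using ta t0 by linarith
  \<comment> \<open>The bound of \<open>gronwall_bound\<close> with rate \<open>\<nu> / 2\<close>:
    the damping \<open>\<nu>\<close> minus the part \<open>\<nu> / 2\<close> spent on the error,
    which also contributes the summand \<open>\<nu> / 2\<close> to the inhomogeneity.\<close>
  define Em where "Em = E t0 + (g^2 / \<nu> + \<nu> / 2) / (\<nu> / 2)"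
  have Emp: "0 \<le> Em" unfolding Em_def using E_pos \<nu> by (intro add_nonneg_nonneg divide_nonneg_nonneg) auto
  have E_le: "E t \<le> Em" if t: "t \<ge> t0" for t
  proof -
    have "E t \<le> exp 0 * (E t0 * exp (- (\<nu> / 2) * (t - t0)) + (g^2 / \<nu> + \<nu> / 2) / (\<nu> / 2))"
    proof (rule gronwall_bound[where b="\<lambda>_. \<nu> / 2"])
      show "primitive_from t0 E h" by (rule primitive_from_later[OF h(1) t00])
      show "AE r in lborel. t0 \<le> r \<longrightarrow> h r \<le> - (\<nu> / 2) * E r + (g^2 / \<nu> + \<nu> / 2)"
        using h(2)
      proof eventually_elim
        case (elim r)
        show ?case
        proof
          assume r: "t0 \<le> r"
          then have r0: "0 \<le> r" "\<delta> r \<le> 1" using t00 ta(2) t0(1) by auto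
          have "(seq_L2 (V r))^2 \<le> (seq_H1 (V r))^2" "(seq_L2 (Q r))^2 \<le> (seq_H1 (Q r))^2"
            using inH1_ell2(2)[OF inH1_V[OF r0(1)]] inH1_ell2(2)[OF inH1_Q[OF r0(1)]] by (auto intro: power_mono seq_L2_pos)
          then have "\<nu> * (seq_L2 (V r))^2 \<le> \<nu> * (seq_H1 (V r))^2" "\<nu> * (\<mu> * (seq_L2 (Q r))^2) \<le> \<nu> * (\<mu> * (seq_H1 (Q r))^2)"
            using \<nu> \<mu> by (auto intro!: mult_left_mono)
          moreover have "0 \<le> \<nu> * (\<mu> * (seq_H1 (Q r))^2)" using \<nu> \<mu> by simp
          moreover have "\<nu> * E r = \<nu> * (seq_L2 (V r))^2 + \<nu> * (\<mu> * (seq_L2 (Q r))^2)" by (simp add: E_def distrib_left)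
          moreover have "(6 * \<delta> r + \<epsilon> r) * (1 + E r) \<le> \<nu> / 2 + \<nu> * E r / 2"
            using mult_right_mono[OF t0(2)[OF r], of "1 + E r"] E_pos[of r] by (simp add: algebra_simps)
          moreover have "h r \<le> - (\<nu> * (seq_H1 (V r))^2) - 2 * (\<nu> * (\<mu> * (seq_H1 (Q r))^2)) + g^2 / \<nu> + (6 * \<delta> r + \<epsilon> r) * (1 + E r)"
            using elim r0 by (simp add: rateE_def mult.assoc)
          moreover have "x \<le> - (\<nu> / 2) * E r + (g^2 / \<nu> + \<nu> / 2)"
            if "a0 \<le> a" "b0 \<le> b" "0 \<le> b" "\<nu> * E r = a0 + b0" "X \<le> \<nu> / 2 + \<nu> * E r / 2" "x \<le> - a - 2 * b + g^2 / \<nu> + X"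
            for a a0 b b0 x X :: real
          proof -
            have "- (\<nu> / 2) * E r = - (\<nu> * E r / 2)" by simp
            then show ?thesis using that by linarith
          qed
          ultimately show "h r \<le> - (\<nu> / 2) * E r + (g^2 / \<nu> + \<nu> / 2)" by blast
        qed
      qed
      show "\<nu> / 2 * (t - r) - 0 \<le> (LINT s:{r..t}|lborel. \<nu> / 2)" if "r \<le> t" for r t
        using lint_const(1)[OF that, of "\<nu> / 2"] by simp
      show "0 \<le> g^2 / \<nu> + \<nu> / 2" using \<nu> by simp
    qed (use \<nu> t E_pos lint_const(2) in auto)
    also have "\<dots> \<le> 1 * (E t0 * 1 + (g^2 / \<nu> + \<nu> / 2) / (\<nu> / 2))"
      using \<nu> t E_pos[of t0] by (simp add: mult_left_le)
    finally show ?thesis by (simp add: Em_def)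
  qed
  \<comment> \<open>Second round: beyond this time the error is at most
    \<open>e0 / (1 + Em) * (1 + Em) = e0\<close>.\<close>
  obtain t1 where t1: "t1 \<ge> t0" "\<And>t. t \<ge> t1 \<Longrightarrow> 6 * \<delta> t + \<epsilon> t \<le> e0 / (1 + Em)"
    using eventually_ge_bound[OF \<eta>0, of "e0 / (1 + Em)" t0] e0 Emp by auto
  have "\<nu> * (LINT s:{r..t}|lborel. (seq_H1 (V s))^2) \<le> Em + (g^2 / \<nu> + e0) * (t - r)" if r: "r \<ge> t1" and t: "t \<ge> r" for r t
  proof -
    have r0: "0 \<le> r" using r t1 t00 by linarith
    note p = primitive_from_diff[OF h(1) r0 t]
    have "E t - E r = (LINT s:{r..t}|lborel. h s)" by (rule p(2))
    also have "\<dots> \<le> (LINT s:{r..t}|lborel. (g^2 / \<nu> + e0) - \<nu> * (seq_H1 (V s))^2)"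
      unfolding set_lebesgue_integral_def
    proof (rule integral_mono_AE)
      show "integrable lborel (\<lambda>s. indicator {r..t} s *\<^sub>R h s)" using p(1) by (simp add: set_integrable_def)
      have "set_integrable lborel {r..t} (\<lambda>s. (g^2 / \<nu> + e0) - \<nu> * (seq_H1 (V s))^2)"
        by (intro set_integral_diff(1) lint_const(2) set_integrable_mult_right integrable_seq_H1_V r0)
      then show "integrable lborel (\<lambda>s. indicator {r..t} s *\<^sub>R ((g^2 / \<nu> + e0) - \<nu> * (seq_H1 (V s))^2))"
        by (simp add: set_integrable_def)
      show "AE s in lborel. indicator {r..t} s *\<^sub>R h s \<le> indicator {r..t} s *\<^sub>R ((g^2 / \<nu> + e0) - \<nu> * (seq_H1 (V s))^2)"
        using h(2)
      proof eventually_elim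
        case (elim s)
        show ?case
        proof (cases "s \<in> {r..t}")
          case True
          then have s: "0 \<le> s" "s \<ge> t0" "s \<ge> t1" "\<delta> s \<le> 1" using r0 r t1 ta(2) t0(1) by auto
          have "(6 * \<delta> s + \<epsilon> s) * (1 + E s) \<le> e0 / (1 + Em) * (1 + Em)"
            using t1(2)[OF s(3)] E_le[OF s(2)] E_pos[of s] e0 Emp by (intro mult_mono) auto
          also have "\<dots> = e0" using Emp by simp
          finally have "(6 * \<delta> s + \<epsilon> s) * (1 + E s) \<le> e0" .
          moreover have "0 \<le> 2 * \<nu> * \<mu> * (seq_H1 (Q s))^2" using \<nu> \<mu> by simp
          moreover have "h s \<le> rateE s"
            using elim s by blast
          ultimately show ?thesis using True by (simp add: rateE_def)
        qed simp
      qed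
    qed
    also have "\<dots> = (LINT s:{r..t}|lborel. g^2 / \<nu> + e0) - (LINT s:{r..t}|lborel. \<nu> * (seq_H1 (V s))^2)"
      by (intro set_integral_diff(2) lint_const(2) set_integrable_mult_right integrable_seq_H1_V r0)
    also have "\<dots> = (g^2 / \<nu> + e0) * (t - r) - \<nu> * (LINT s:{r..t}|lborel. (seq_H1 (V s))^2)"
      using lint_const(1)[OF t] by simp
    finally show ?thesis using E_pos[of t] E_le[of r] r t1(1) by simp
  qed
  then show ?thesis using t1 t00 Emp by (intro exI[of _ t1] conjI exI[of _ Em]) auto
qed

text \<open>The rate is negative on average but perhaps not at each time. The dissipation bound is
  exactly the lower bound on its integrals that \<open>gronwall_tendsto_0\<close> requires. The
  slack in \<open>gap\<close> is shared out among the perturbations, and half of it remains as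
  decay.\<close>

lemma Q_tendsto: "((\<lambda>t. seq_L2 (Q t)) \<longlongrightarrow> 0) at_top"
proof -
  define c2 where "c2 = (2 * pi * C)^2"
  have c2: "0 \<le> c2" by (simp add: c2_def)
  \<comment> \<open>The slack of \<open>gap\<close>. Losses of at most \<open>m / 8\<close>,
    \<open>m / 8\<close> and \<open>m / 4\<close> are allowed below.\<close>
  define m where "m = \<nu> * max 1 (N^2) - c2 * g^2 / \<nu>^3"
  have m: "0 < m" using gap by (simp add: m_def c2_def)
  \<comment> \<open>The excess in the average of the dissipation, multiplied by the growth
    coefficient \<open>c2 / \<nu>\<close>, costs at most \<open>m / 8\<close>. The denominator has
    \<open>c2 + 1\<close> because \<open>c2\<close> may be 0.\<close>
  define e0 where "e0 = m * \<nu>^2 / (8 * (c2 + 1))"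
  have e0: "0 < e0" unfolding e0_def using m \<nu> c2 by (intro divide_pos_pos mult_pos_pos) auto
  have ce0: "c2 / \<nu> * e0 / \<nu> \<le> m / 8"
  proof -
    have "c2 / \<nu> * (m * \<nu>^2 / (8 * D)) / \<nu> = m / 8 * (c2 / D)" if "D \<noteq> 0" for D
      using \<nu> that by (simp add: field_simps power2_eq_square)
    from this[of "c2 + 1"] have "c2 / \<nu> * e0 / \<nu> = m / 8 * (c2 / (c2 + 1))"
      unfolding e0_def using c2 by linarith
    also have "\<dots> \<le> m / 8 * 1" using m c2 by (intro mult_left_mono) auto
    finally show ?thesis by simp
  qed
  define S where "S = g^2 / \<nu> + e0"
  have S: "0 < S" unfolding S_def using e0 \<nu> by (intro add_nonneg_pos) auto
  \<comment> \<open>The allowance for \<open>2 * \<delta>\<close> in the growth coefficient: against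
    the average \<open>S / \<nu>\<close> of the enstrophy it costs \<open>m / 8\<close>.\<close>
  define d0 where "d0 = m * \<nu> / (8 * S)"
  have d0: "0 < d0" unfolding d0_def using m \<nu> S by simp
  have dS: "d0 * S / \<nu> = m / 8" unfolding d0_def using \<nu> S by simp
  obtain t1 M where t1: "t1 \<ge> 0" "M \<ge> 0"
    and diss: "\<And>r t. r \<ge> t1 \<Longrightarrow> t \<ge> r \<Longrightarrow> \<nu> * (LINT s:{r..t}|lborel. (seq_H1 (V s))^2) \<le> M + S * (t - r)"
    using dissipation_bound[OF e0] unfolding S_def by blast
  have \<gamma>: "((\<lambda>t. 3 * \<delta> t + \<epsilon> t) \<longlongrightarrow> 0) at_top"
    using tendsto_add[OF tendsto_mult_left[OF \<delta>_tendsto, of 3] \<epsilon>_tendsto] by simp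
  obtain t2 where t2: "t2 \<ge> t1" "\<And>t. t \<ge> t2 \<Longrightarrow> \<delta> t \<le> min 1 (d0 / 2)"
    using eventually_ge_bound[OF \<delta>_tendsto, of "min 1 (d0 / 2)" t1] d0 by auto
  obtain t3 where t3: "t3 \<ge> t2" "\<And>t. t \<ge> t3 \<Longrightarrow> 3 * \<delta> t + \<epsilon> t \<le> m / 4"
    using eventually_ge_bound[OF \<gamma>, of "m / 4" t2] m by auto
  have t30: "0 \<le> t3" using t1 t2 t3 by linarith
  obtain h where h: "primitive_from 0 (\<lambda>t. (seq_L2 (Q t))^2) h" "AE t in lborel. 0 \<le> t \<longrightarrow> \<delta> t \<le> 1 \<longrightarrow>
    h t \<le> - (\<nu> * max 1 (N^2) - (c2 / \<nu> + 2 * \<delta> t) * (seq_H1 (V t))^2 - (3 * \<delta> t + \<epsilon> t)) * (seq_L2 (Q t))^2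
      + (3 * \<delta> t + \<epsilon> t)"
    using energy_Q unfolding rateQ_def c2_def by blast
  \<comment> \<open>The decay rate of the high modes after the late-time bound \<open>m / 4\<close>
    on \<open>3 * \<delta> t + \<epsilon> t\<close> is subtracted.\<close>
  define a where "a = \<nu> * max 1 (N^2) - m / 4"
  define B where "B = c2 / \<nu> + d0"
  have B: "0 \<le> B" unfolding B_def using c2 \<nu> d0 by simp
  have BS: "B * S / \<nu> \<le> c2 * g^2 / \<nu>^3 + m / 4"
  proof -
    have "B * S / \<nu> = c2 * g^2 / \<nu>^3 + c2 / \<nu> * e0 / \<nu> + d0 * S / \<nu>"
      using \<nu> by (simp add: B_def S_def field_simps power2_eq_square power3_eq_cube)
    then show ?thesis using ce0 dS by simp
  qed
  have "((\<lambda>t. (seq_L2 (Q t))^2) \<longlongrightarrow> 0) at_top"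
  proof (rule gronwall_tendsto_0[OF primitive_from_later[OF h(1) t30], where b="\<lambda>t. a - B * (seq_H1 (V t))^2"
      and \<alpha>="m / 2" and K="B * M / \<nu>" and \<gamma>="\<lambda>t. 3 * \<delta> t + \<epsilon> t"])
    show "set_integrable lborel {t3..t} (\<lambda>t. a - B * (seq_H1 (V t))^2)" for t
      by (intro set_integral_diff(1) lint_const(2) set_integrable_mult_right integrable_seq_H1_V t30)
    show "AE r in lborel. t3 \<le> r \<longrightarrow> h r \<le> - (a - B * (seq_H1 (V r))^2) * (seq_L2 (Q r))^2 + (3 * \<delta> r + \<epsilon> r)"
      using h(2)
    proof eventually_elim
      case (elim r)
      show ?case
      proof
        assume r: "t3 \<le> r"
        then have r0: "0 \<le> r" "\<delta> r \<le> 1" "2 * \<delta> r \<le> d0" "3 * \<delta> r + \<epsilon> r \<le> m / 4"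
          using t30 t2(2)[of r] t3 by auto
        have "(c2 / \<nu> + 2 * \<delta> r) * (seq_H1 (V r))^2 \<le> B * (seq_H1 (V r))^2"
          unfolding B_def using r0 by (intro mult_right_mono) auto
        then have "- (\<nu> * max 1 (N^2) - (c2 / \<nu> + 2 * \<delta> r) * (seq_H1 (V r))^2 - (3 * \<delta> r + \<epsilon> r)) \<le> - (a - B * (seq_H1 (V r))^2)"
          unfolding a_def using r0 by linarith
        then have "- (\<nu> * max 1 (N^2) - (c2 / \<nu> + 2 * \<delta> r) * (seq_H1 (V r))^2 - (3 * \<delta> r + \<epsilon> r)) * (seq_L2 (Q r))^2
            \<le> - (a - B * (seq_H1 (V r))^2) * (seq_L2 (Q r))^2"
          by (rule mult_right_mono) simp
        then show "h r \<le> - (a - B * (seq_H1 (V r))^2) * (seq_L2 (Q r))^2 + (3 * \<delta> r + \<epsilon> r)"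
          using elim r0 by fastforce
      qed
    qed
    show "m / 2 * (t - r) - B * M / \<nu> \<le> (LINT s:{r..t}|lborel. a - B * (seq_H1 (V s))^2)" if r: "t3 \<le> r" and t: "r \<le> t" for r t
    proof -
      have r0: "0 \<le> r" "r \<ge> t1" using r t30 t2 t3 by auto
      define I where "I = (LINT s:{r..t}|lborel. (seq_H1 (V s))^2)"
      have "(LINT s:{r..t}|lborel. a - B * (seq_H1 (V s))^2)
          = (LINT s:{r..t}|lborel. a) - (LINT s:{r..t}|lborel. B * (seq_H1 (V s))^2)"
        by (intro set_integral_diff(2) lint_const(2) set_integrable_mult_right integrable_seq_H1_V r0)
      also have "\<dots> = a * (t - r) - B * I" using lint_const(1)[OF t] by (simp add: I_def)
      finally have e: "(LINT s:{r..t}|lborel. a - B * (seq_H1 (V s))^2) = a * (t - r) - B * I" .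
      \<comment> \<open>The dissipation bound controls the enstrophy integral. Its constant part
        becomes the defect \<open>B * M / \<nu>\<close>, while its linear part stays below
        \<open>a\<close> by \<open>m / 2\<close>.\<close>
      have "B * I = B / \<nu> * (\<nu> * I)" using \<nu> by simp
      also have "\<dots> \<le> B / \<nu> * (M + S * (t - r))"
        unfolding I_def using diss[OF r0(2) t] B \<nu> by (intro mult_left_mono) auto
      also have "\<dots> = B * M / \<nu> + B * S / \<nu> * (t - r)" by (simp add: distrib_left)
      also have "\<dots> \<le> B * M / \<nu> + (c2 * g^2 / \<nu>^3 + m / 4) * (t - r)"
        using BS t by (intro add_left_mono mult_right_mono) auto
      also have "c2 * g^2 / \<nu>^3 + m / 4 = a - m / 2" unfolding a_def using m_def by linarith
      finally show ?thesis unfolding e by (simp add: algebra_simps)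
    qed
    show "((\<lambda>t. 3 * \<delta> t + \<epsilon> t) \<longlongrightarrow> 0) at_top" by (rule \<gamma>)
  qed (use m in auto)
  then have "((\<lambda>t. sqrt ((seq_L2 (Q t))^2)) \<longlongrightarrow> sqrt 0) at_top" by (intro tendsto_real_sqrt)
  then show ?thesis by (simp add: seq_L2_pos)
qed

lemma synchronization: "((\<lambda>t. Hnorm (v1 t - v2 t)) \<longlongrightarrow> 0) at_top"
proof (rule tendsto_sandwich[where f="\<lambda>_. 0" and h="\<lambda>t. 2 * pi * (seq_L2 (P t) + seq_L2 (Q t))"])
  show "((\<lambda>t. 2 * pi * (seq_L2 (P t) + seq_L2 (Q t))) \<longlongrightarrow> 0) at_top"
    using tendsto_mult_left[OF tendsto_add[OF P_tendsto Q_tendsto], of "2 * pi"] by simp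
  show "\<forall>\<^sub>F t in at_top. Hnorm (v1 t - v2 t) \<le> 2 * pi * (seq_L2 (P t) + seq_L2 (Q t))"
    using eventually_ge_at_top[of 0]
  proof eventually_elim
    case (elim t)
    note D = fc_diff[OF inL2_v1[OF elim] inL2_v2[OF elim]]
    have W: "fc (v1 t - v2 t) = (\<lambda>k. 1 *\<^sub>R P t k + 1 *\<^sub>R Q t k)"
      using D(2) by (auto simp: fun_eq_iff P_def Q_def W_def restrict_modes_def)
    have "seq_L2 (fc (v1 t - v2 t)) \<le> seq_L2 (P t) + seq_L2 (Q t)"
      unfolding W using seq_L2_lincomb(2)[OF inH1_ell2(1)[OF inH1_P[OF elim]] inH1_ell2(1)[OF inH1_Q[OF elim]] norm_lincomb, of 1 1] by simp
    then show ?case unfolding Hnorm_eq_seq_L2(2)[OF D(1)] by (intro mult_left_mono) auto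
  qed
qed (simp_all add: Hnorm_torus(2))

end

section \<open>From the hypotheses of the theorem to the spectral gap\<close>

lemma Hnorm_convex_bdd:
  assumes "forcing g1" "forcing g2"
  shows "bdd_above ((\<lambda>t. Hnorm (\<lambda>x. r *\<^sub>R g1 t x + s *\<^sub>R g2 t x)) ` {0..})"
proof -
  obtain M1 M2 where M: "\<And>t. 0 \<le> t \<Longrightarrow> Hnorm (g1 t) \<le> M1" "\<And>t. 0 \<le> t \<Longrightarrow> Hnorm (g2 t) \<le> M2"
    using assms unfolding forcing_def by blast
  have "Hnorm (\<lambda>x. r *\<^sub>R g1 t x + s *\<^sub>R g2 t x) \<le> \<bar>r\<bar> * M1 + \<bar>s\<bar> * M2" if t: "0 \<le> t" for t
  proof -
    have g: "inL2 (g1 t)" "inL2 (g2 t)" using assms t by (auto simp: forcing_def inH_def)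
    note l = fc_linear[OF g, of r s]
    have f: "fc (\<lambda>x. r *\<^sub>R g1 t x + s *\<^sub>R g2 t x) = (\<lambda>k. r *\<^sub>R fc (g1 t) k + s *\<^sub>R fc (g2 t) k)"
      using l(2) by blast
    have "Hnorm (\<lambda>x. r *\<^sub>R g1 t x + s *\<^sub>R g2 t x) \<le> 2 * pi * (\<bar>r\<bar> * seq_L2 (fc (g1 t)) + \<bar>s\<bar> * seq_L2 (fc (g2 t)))"
      unfolding Hnorm_eq_seq_L2(2)[OF l(1)] f
      by (intro mult_left_mono seq_L2_lincomb(2)[OF Hnorm_eq_seq_L2(1)[OF g(1)] Hnorm_eq_seq_L2(1)[OF g(2)] norm_lincomb]) auto
    also have "\<dots> = \<bar>r\<bar> * Hnorm (g1 t) + \<bar>s\<bar> * Hnorm (g2 t)"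
      unfolding Hnorm_eq_seq_L2(2)[OF g(1)] Hnorm_eq_seq_L2(2)[OF g(2)] by (simp add: algebra_simps)
    also have "\<dots> \<le> \<bar>r\<bar> * M1 + \<bar>s\<bar> * M2" using M[OF t] by (intro add_mono mult_left_mono) auto
    finally show ?thesis .
  qed
  then show ?thesis by (intro bdd_aboveI2[of _ _ "\<bar>r\<bar> * M1 + \<bar>s\<bar> * M2"]) auto
qed

theorem theorem3p9:
  fixes \<theta>1 \<theta>2 \<nu> N C_L C_A :: real
    and g1 g2 v1 v2 :: "real \<Rightarrow> real^2 \<Rightarrow> real^2"
    and v01 v02 :: "real^2 \<Rightarrow> real^2"
  assumes "\<nu> > 0"
    and "C_L > 0" and "C_A > 0" and "CL_const C_L" and "CA_const C_A"
    and "\<theta>1 \<in> {0..1}" and "\<theta>2 \<in> {0..1}" and "\<theta>1 + \<theta>2 = 1"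
    and "N > 0"
    and "forcing g1" and "forcing g2"
    and "N \<ge> (if \<theta>1 \<in> {0, 1}
               then max (48 * sqrt 3 * C_L^2 * (glam \<nu> \<theta>1 \<theta>2 g1 g2)^2) (C_A / C_L^2)
               else 15 * sqrt 27 * C_L^2 * (glam \<nu> \<theta>1 \<theta>2 g1 g2)^2)"
    and "inV v01" and "inV v02"
    and "mutual_sync_solution \<nu> N \<theta>1 \<theta>2 g1 g2 v01 v02 v1 v2"
    and "((\<lambda>t. Hnorm (g1 t - g2 t)) \<longlongrightarrow> 0) at_top"
  shows "((\<lambda>t. Hnorm (v1 t - v2 t)) \<longlongrightarrow> 0) at_top"
proof -
  define \<gamma> where "\<gamma> = glam \<nu> \<theta>1 \<theta>2 g1 g2"
  \<comment> \<open>The supremum of the norm of the averaged forcing is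
    \<open>\<gamma> * \<nu>^2\<close>; dividing by \<open>2 * pi\<close> converts it to
    coefficients.\<close>
  define g where "g = \<gamma> * \<nu>^2 / (2 * pi)"
  \<comment> \<open>A common lower bound for both branches, since
    \<open>48 * sqrt 3 \<ge> 48\<close> and \<open>15 * sqrt 27 \<ge> 60\<close>.\<close>
  have NC: "48 * (C_L^2 * \<gamma>^2) \<le> N"
  proof -
    have s3: "1 \<le> sqrt 3" "4 \<le> sqrt 27" by (auto intro: real_le_rsqrt)
    have "48 * (C_L^2 * \<gamma>^2) \<le> (48 * sqrt 3) * (C_L^2 * \<gamma>^2)" "48 * (C_L^2 * \<gamma>^2) \<le> (15 * sqrt 27) * (C_L^2 * \<gamma>^2)"
      using s3 by (intro mult_right_mono; simp)+
    then have "48 * (C_L^2 * \<gamma>^2) \<le> 48 * sqrt 3 * C_L^2 * \<gamma>^2" "48 * (C_L^2 * \<gamma>^2) \<le> 15 * sqrt 27 * C_L^2 * \<gamma>^2"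
      by (simp_all only: mult.assoc)
    moreover have "48 * sqrt 3 * C_L^2 * \<gamma>^2 \<le> N \<or> 15 * sqrt 27 * C_L^2 * \<gamma>^2 \<le> N"
      using assms(12) unfolding \<gamma>_def[symmetric] by (simp split: if_splits)
    ultimately show ?thesis by linarith
  qed
  have "N \<le> max 1 (N^2)"
    using assms(9) self_le_power[of N 2] by (cases "1 \<le> N") auto
  \<comment> \<open>A value below 1 lies below the maximum trivially. From 1 upwards it is strictly
    smaller than 48 times itself, hence smaller than \<open>N\<close>, and
    \<open>N \<le> max 1 (N^2)\<close>.\<close>
  have "C_L^2 * \<gamma>^2 < max 1 (N^2)"
  proof (cases "C_L^2 * \<gamma>^2 < 1")
    case False
    then show ?thesis using NC \<open>N \<le> max 1 (N^2)\<close> by linarith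
  qed simp
  moreover have "(2 * pi * C_L)^2 * g^2 / \<nu>^3 = \<nu> * (C_L^2 * \<gamma>^2)"
    using assms(1) by (simp add: g_def power_mult_distrib power_divide power2_eq_square power3_eq_cube)
  ultimately have gap: "(2 * pi * C_L)^2 * g^2 / \<nu>^3 < \<nu> * max 1 (N^2)"
    using assms(1) by simp
  have bound: "seq_L2 (\<lambda>k. \<theta>2 *\<^sub>R fc (g1 t) k + \<theta>1 *\<^sub>R fc (g2 t) k) \<le> g" if t: "0 \<le> t" for t
  proof -
    have L2: "inL2 (g1 t)" "inL2 (g2 t)" using assms(10,11) t by (auto simp: forcing_def inH_def)
    note l = fc_linear[OF L2, of \<theta>2 \<theta>1]
    have f: "fc (\<lambda>x. \<theta>2 *\<^sub>R g1 t x + \<theta>1 *\<^sub>R g2 t x) = (\<lambda>k. \<theta>2 *\<^sub>R fc (g1 t) k + \<theta>1 *\<^sub>R fc (g2 t) k)"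
      using l(2) by blast
    have "2 * pi * seq_L2 (\<lambda>k. \<theta>2 *\<^sub>R fc (g1 t) k + \<theta>1 *\<^sub>R fc (g2 t) k) = Hnorm (\<lambda>x. \<theta>2 *\<^sub>R g1 t x + \<theta>1 *\<^sub>R g2 t x)"
      unfolding Hnorm_eq_seq_L2(2)[OF l(1)] f ..
    \<comment> \<open>The supremum is over reals, so it bounds its members only because the forcing
      is bounded in time.\<close>
    also have "\<dots> \<le> (SUP t\<in>{0..}. Hnorm (\<lambda>x. \<theta>2 *\<^sub>R g1 t x + \<theta>1 *\<^sub>R g2 t x))"
      using t by (intro cSUP_upper Hnorm_convex_bdd assms) auto
    also have "\<dots> = \<gamma> * \<nu>^2" using assms(1) by (simp add: \<gamma>_def glam_def)
    finally show ?thesis by (simp add: g_def pos_le_divide_eq mult.commute)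
  qed
  interpret mutual_sync \<nu> v1 v2 N \<theta>1 \<theta>2 C_L g g1 g2 v01 v02
    by unfold_locales (use assms gap bound in \<open>auto simp: mutual_sync_solution_def\<close>)
  show ?thesis by (rule synchronization)
qed

end
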